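(* Let $n \geq 2$ and let $D \subset \mathbb{C}^n$ be a bounded domain with $\mathcal{C}^2$-smooth boundary that is strongly Levi pseudoconvex. Let $A$ be a non-empty finite subset of $D$. Then $\Omega := D \setminus A$ is a visibility domain (with respect to the Kobayashi distance) that is not pseudoconvex. In particular, $\Omega$ is not Kobayashi complete.
   Context: A domain is a non-empty connected open set. For a domain $\Omega \subset \mathbb{C}^n$, $K_\Omega$ denotes the Kobayashi pseudodistance on $\Omega$ and $k_\Omega : \Omega \times \mathbb{C}^n \to [0,\infty)$ the Kobayashi(--Royden) pseudometric, $k_\Omega(z;v) = \inf\{|\zeta| : \exists\, f:\mathbb{D}\to\Omega \text{ holomorphic},\ f(0)=z,\ f'(0)\zeta = v\}$, where $\mathbb{D}$ is the open unit disc (so $K_\Omega$ is the integrated form of $k_\Omega$). When $\Omega$ is bounded, $K_\Omega$ is a genuine distance. $\Omega$ is called Kobayashi complete if the metric space $(\Omega, K_\Omega)$ is Cauchy-complete. Almost-geodesics: let $I \subset \mathbb{R}$ be an interval, $\lambda \geq 1$, $\kappa \geq 0$. A curve $\sigma : I \to \Omega$ is a $(\lambda,\kappa)$-almost-geodesic if (i) $\lambda^{-1}|t-s| - \kappa \leq K_\Omega(\sigma(s),\sigma(t)) \leq \lambda|t-s| + \kappa$ for all $s,t \in I$, and (ii) $\sigma$ is absolutely continuous (so $\sigma'(t)$ exists for almost every $t\in I$) and $k_\Omega(\sigma(t);\sigma'(t)) \leq \lambda$ for almost every $t \in I$. Visibility domain: a bounded domain $\Omega \subset \mathbb{C}^n$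 is a visibility domain (with respect to the Kobayashi distance) if for any $\lambda \geq 1$, $\kappa \geq 0$, each pair of distinct points $\xi,\eta \in \partial\Omega$, and each pair of relatively open subsets $V_\xi, V_\eta$ of $\overline{\Omega}$ that are neighbourhoods of $\xi,\eta$ respectively with $\overline{V_\xi} \cap \overline{V_\eta} = \emptyset$, there exists a compact subset $K \subset \Omega$ such that the image of any $(\lambda,\kappa)$-almost-geodesic $\sigma : [a,b] \to \Omega$ with $\sigma(a) \in V_\xi$, $\sigma(b) \in V_\eta$ intersects $K$. Strongly Levi pseudoconvex means that the Levi form of a $\mathcal{C}^2$ defining function of $D$ is positive definite on the complex tangent space at every point of $\partial D$. Pseudoconvex is in the usual sense (equivalently, being a domain of holomorphy). *)

theory Defs
  imports "HOL-Complex_Analysis.Complex_Analysis"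
begin

definition is_domain :: "'a::topological_space set \<Rightarrow> bool" where
  "is_domain \<Omega> \<longleftrightarrow> open \<Omega> \<and> connected \<Omega> \<and> \<Omega> \<noteq> {}"


section \<open>Kobayashi pseudometric and pseudodistance\<close>

definition analytic_disc :: "(complex^'n) set \<Rightarrow> (complex \<Rightarrow> complex^'n) \<Rightarrow> bool" where
  "analytic_disc \<Omega> f \<longleftrightarrow>
     (\<forall>i. (\<lambda>\<zeta>. f \<zeta> $ i) holomorphic_on ball 0 1) \<and> f ` ball 0 1 \<subseteq> \<Omega>"

definition disc_deriv :: "(complex \<Rightarrow> complex^'n) \<Rightarrow> complex \<Rightarrow> complex^'n" where
  "disc_deriv f \<zeta> = (\<chi> i. deriv (\<lambda>\<xi>. f \<xi> $ i) \<zeta>)"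

definition kobayashi_metric :: "(complex^'n) set \<Rightarrow> complex^'n \<Rightarrow> complex^'n \<Rightarrow> real" where
  "kobayashi_metric \<Omega> z v =
     Inf {cmod \<zeta> |\<zeta>. \<exists>f. analytic_disc \<Omega> f \<and> f 0 = z \<and> \<zeta> *s disc_deriv f 0 = v}"

text \<open>The distance of the Poincare metric \<open>|dz| / (1 - |z|\<^sup>2)\<close>. This normalisation is the one that
  agrees with \<^const>\<open>kobayashi_metric\<close> on the unit disc.\<close>

definition poincare_dist :: "complex \<Rightarrow> complex \<Rightarrow> real" where
  "poincare_dist a b = artanh (cmod ((a - b) / (1 - cnj b * a)))"

text \<open>Kobayashi's definition by chains of analytic discs; by Royden's theorem it yields the
  integrated form of \<^const>\<open>kobayashi_metric\<close>. The value \<open>0\<close> off \<open>\<Omega> \<times> \<Omega>\<close> is a dummy: it makes the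
  function non-negative and symmetric everywhere, as the locale \<^locale>\<open>Metric_space\<close> demands.\<close>

definition kobayashi_dist :: "(complex^'n) set \<Rightarrow> complex^'n \<Rightarrow> complex^'n \<Rightarrow> real" where
  "kobayashi_dist \<Omega> z w =
     (if z \<in> \<Omega> \<and> w \<in> \<Omega> then
        Inf {\<Sum>j<m. poincare_dist (a j) (b j) |(m::nat) a b.
               \<exists>p f. p 0 = z \<and> p m = w \<and>
                 (\<forall>j<m. analytic_disc \<Omega> (f j) \<and> a j \<in> ball 0 1 \<and> b j \<in> ball 0 1 \<and>
                        f j (a j) = p j \<and> f j (b j) = p (Suc j))}
      else 0)"

definition kobayashi_complete :: "(complex^'n) set \<Rightarrow> bool" where
  "kobayashi_complete \<Omega> \<longleftrightarrow> Metric_space.mcomplete \<Omega> (kobayashi_dist \<Omega>)"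


section \<open>Almost-geodesics and visibility\<close>

definition abs_continuous_on :: "real set \<Rightarrow> (real \<Rightarrow> 'a::metric_space) \<Rightarrow> bool" where
  "abs_continuous_on I f \<longleftrightarrow>
     (\<forall>\<epsilon>>0. \<exists>\<delta>>0. \<forall>(N::nat) a b.
        (\<forall>i<N. a i \<in> I \<and> b i \<in> I \<and> a i \<le> b i) \<and>
        disjoint_family_on (\<lambda>i. {a i<..<b i}) {..<N} \<and>
        (\<Sum>i<N. b i - a i) < \<delta>
        \<longrightarrow> (\<Sum>i<N. dist (f (a i)) (f (b i))) < \<epsilon>)"

text \<open>The derivative is taken relative to \<open>I\<close>, which matters only at the (at most two) end points.\<close>

definition almost_geodesic ::
    "(complex^'n) set \<Rightarrow> real \<Rightarrow> real \<Rightarrow> real set \<Rightarrow> (real \<Rightarrow> complex^'n) \<Rightarrow> bool" where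
  "almost_geodesic \<Omega> l \<kappa> I \<sigma> \<longleftrightarrow>
     is_interval I \<and> \<sigma> ` I \<subseteq> \<Omega> \<and>
     (\<forall>s\<in>I. \<forall>t\<in>I. \<bar>t - s\<bar> / l - \<kappa> \<le> kobayashi_dist \<Omega> (\<sigma> s) (\<sigma> t) \<and>
                   kobayashi_dist \<Omega> (\<sigma> s) (\<sigma> t) \<le> l * \<bar>t - s\<bar> + \<kappa>) \<and>
     abs_continuous_on I \<sigma> \<and>
     (AE t in lborel. t \<in> I \<longrightarrow>
        (\<exists>v. (\<sigma> has_vector_derivative v) (at t within I) \<and>
             kobayashi_metric \<Omega> (\<sigma> t) v \<le> l))"

definition visibility_domain :: "(complex^'n) set \<Rightarrow> bool" where
  "visibility_domain \<Omega> \<longleftrightarrow>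
     is_domain \<Omega> \<and> bounded \<Omega> \<and>
     (\<forall>l\<ge>1. \<forall>\<kappa>\<ge>0. \<forall>\<xi>\<in>frontier \<Omega>. \<forall>\<eta>\<in>frontier \<Omega>. \<forall>V W. \<xi> \<noteq> \<eta> \<and>
        openin (top_of_set (closure \<Omega>)) V \<and> openin (top_of_set (closure \<Omega>)) W \<and>
        \<xi> \<in> V \<and> \<eta> \<in> W \<and> closure V \<inter> closure W = {} \<longrightarrow>
        (\<exists>K. compact K \<and> K \<subseteq> \<Omega> \<and>
           (\<forall>a b \<sigma>. a \<le> b \<and> almost_geodesic \<Omega> l \<kappa> {a..b} \<sigma> \<and> \<sigma> a \<in> V \<and> \<sigma> b \<in> W \<longrightarrow>
                    \<sigma> ` {a..b} \<inter> K \<noteq> {})))"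


section \<open>Pseudoconvexity\<close>

definition continuous_psh_on :: "(complex^'n) set \<Rightarrow> (complex^'n \<Rightarrow> real) \<Rightarrow> bool" where
  "continuous_psh_on \<Omega> u \<longleftrightarrow>
     continuous_on \<Omega> u \<and>
     (\<forall>z w. (\<forall>\<zeta>\<in>cball 0 1. z + \<zeta> *s w \<in> \<Omega>) \<longrightarrow>
        u z \<le> integral {0..2*pi} (\<lambda>\<theta>. u (z + cis \<theta> *s w)) / (2*pi))"

text \<open>Existence of a continuous plurisubharmonic exhaustion function.\<close>

definition pseudoconvex :: "(complex^'n) set \<Rightarrow> bool" where
  "pseudoconvex \<Omega> \<longleftrightarrow>
     (\<exists>u. continuous_psh_on \<Omega> u \<and> (\<forall>c. compact {z\<in>\<Omega>. u z \<le> c}))"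


section \<open>Smooth boundaries and the Levi form\<close>

definition C2_on :: "'a::real_normed_vector set \<Rightarrow> ('a \<Rightarrow> 'b::real_normed_vector) \<Rightarrow> bool" where
  "C2_on U f \<longleftrightarrow>
     (\<exists>(f' :: 'a \<Rightarrow> 'a \<Rightarrow>\<^sub>L 'b) (f'' :: 'a \<Rightarrow> 'a \<Rightarrow>\<^sub>L 'a \<Rightarrow>\<^sub>L 'b).
        (\<forall>x\<in>U. (f has_derivative blinfun_apply (f' x)) (at x)) \<and>
        (\<forall>x\<in>U. (f' has_derivative blinfun_apply (f'' x)) (at x)) \<and>
        continuous_on U f'')"

definition C2_defining_function ::
    "(complex^'n) set \<Rightarrow> (complex^'n) set \<Rightarrow> (complex^'n \<Rightarrow> real) \<Rightarrow> bool" where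
  "C2_defining_function D U \<rho> \<longleftrightarrow>
     open U \<and> frontier D \<subseteq> U \<and> C2_on U \<rho> \<and>
     D \<inter> U = {z\<in>U. \<rho> z < 0} \<and> frontier D = {z\<in>U. \<rho> z = 0} \<and>
     (\<forall>p\<in>frontier D. frechet_derivative \<rho> (at p) \<noteq> (\<lambda>v. 0))"

definition C2_boundary :: "(complex^'n) set \<Rightarrow> bool" where
  "C2_boundary D \<longleftrightarrow> (\<exists>U \<rho>. C2_defining_function D U \<rho>)"

text \<open>The Wirtinger derivatives \<open>\<partial>f/\<partial>z\<^sub>j\<close> and \<open>\<partial>f/\<partial>(cnj z\<^sub>j)\<close>.\<close>

definition wirtinger :: "'n \<Rightarrow> (complex^'n \<Rightarrow> complex) \<Rightarrow> complex^'n \<Rightarrow> complex" where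
  "wirtinger j f z =
     (frechet_derivative f (at z) (axis j 1) - \<i> * frechet_derivative f (at z) (axis j \<i>)) / 2"

definition wirtinger_bar :: "'n \<Rightarrow> (complex^'n \<Rightarrow> complex) \<Rightarrow> complex^'n \<Rightarrow> complex" where
  "wirtinger_bar j f z =
     (frechet_derivative f (at z) (axis j 1) + \<i> * frechet_derivative f (at z) (axis j \<i>)) / 2"

definition complex_tangent_space :: "(complex^'n \<Rightarrow> real) \<Rightarrow> complex^'n \<Rightarrow> (complex^'n) set" where
  "complex_tangent_space \<rho> p =
     {v. (\<Sum>j\<in>UNIV. wirtinger j (\<lambda>z. complex_of_real (\<rho> z)) p * v $ j) = 0}"

text \<open>For a \<open>C\<^sup>2\<close> function the double sum is real, since the mixed derivatives form a Hermitian
  matrix; \<^const>\<open>Re\<close> only changes the type.\<close>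

definition levi_form :: "(complex^'n \<Rightarrow> real) \<Rightarrow> complex^'n \<Rightarrow> complex^'n \<Rightarrow> real" where
  "levi_form \<rho> p v =
     Re (\<Sum>j\<in>UNIV. \<Sum>k\<in>UNIV.
           wirtinger j (wirtinger_bar k (\<lambda>z. complex_of_real (\<rho> z))) p * v $ j * cnj (v $ k))"

definition strongly_levi_pseudoconvex :: "(complex^'n) set \<Rightarrow> bool" where
  "strongly_levi_pseudoconvex D \<longleftrightarrow>
     (\<exists>U \<rho>. C2_defining_function D U \<rho> \<and>
        (\<forall>p\<in>frontier D. \<forall>v\<in>complex_tangent_space \<rho> p. v \<noteq> 0 \<longrightarrow> levi_form \<rho> p v > 0))"

end

(* Points of A are invisible to pseudoconvexity and to completeness: discs that narrowly miss
   a puncture give the Kontinuitaetssatz, and a Kobayashi-Cauchy sequence tending to the puncture.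

   For visibility, an almost-geodesic that avoids a large compact set stays, by connectedness, near
   one point of A (then its end points are close) or near the boundary of D. There a Sibony-type
   argument with a strictly psh defining function gives |v| <= const * sqrt |rho| * k(z; v), while
   K(o, z) <= const * (1 + |ln |rho||) because the boundary is C^1. Hence |rho| decays
   exponentially in time away from its maximum along the curve, the speed is integrable, and the
   Euclidean length is bounded by a positive power of that maximum. *)
theory Submission
  imports Defs "HOL-Real_Asymp.Real_Asymp"
begin

no_notation fps_nth (infixl "$" 75)

section \<open>The Kobayashi distance\<close>

text \<open>The two boundary estimates behave oppositely when the domain shrinks. Every disc in
  \<open>D - A\<close> is a disc in \<open>D\<close>, so the derivative bound can be proved in
  \<open>D\<close>, where \<open>A\<close> is invisible. The upper bound for the distance does not
  pass from \<open>D\<close> to \<open>D - A\<close>; its chains are therefore built inside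
  \<open>D - A\<close>, close to the boundary of \<open>D\<close>, until they reach a compact set.
  The obstacle in the derivative bound is that a disc centred near the boundary may leave the
  neighbourhood in which the defining function is known to be psh; gluing with a constant yields a
  function on all of \<open>D\<close>. Decay in time alone bounds the length without making it
  small. Since the speed is of order \<open>sqrt \<bar>\<rho>\<bar>\<close>, the exponent can be
  halved: one half pays for smallness, the other for integrability over an interval of arbitrary
  length.\<close>

lemma norm_vector_scalar_mult: "norm (c *s x) = cmod c * norm (x :: complex^'n)"
  by (simp add: norm_vec_def norm_mult L2_set_right_distrib)

section \<open>The Poincare distance of the unit disc\<close>

lemma cmod_mobius_less_1:
  assumes "cmod a < 1" "cmod b < 1"
  shows "cmod ((a - b) / (1 - cnj b * a)) < 1"
  using Moebius_function_norm_lt_1[of b a 0] assms by (simp add: Moebius_function_simple)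

lemma artanh_ge_self:
  fixes x :: real
  assumes "0 \<le> x" "x < 1"
  shows "x \<le> artanh x"
proof -
  have "((\<lambda>x. artanh x - x) has_real_derivative (1 / (1 - t\<^sup>2) - 1)) (at t)"
    if "0 \<le> t" "t \<le> x" for t :: real
    using that assms by (auto intro!: derivative_eq_intros)
  moreover have "0 \<le> 1 / (1 - t\<^sup>2) - 1" if "0 \<le> t" "t \<le> x" for t :: real
  proof -
    have "t\<^sup>2 < 1" using that assms by (simp add: power_less_one_iff abs_square_less_1)
    then show ?thesis by (simp add: field_simps)
  qed
  ultimately have "artanh 0 - 0 \<le> artanh x - x"
    by (intro DERIV_nonneg_imp_nondecreasing[OF assms(1), of "\<lambda>x. artanh x - x"]) blast
  then show ?thesis by simp
qed

lemma artanh_mono_real: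
  fixes x y :: real
  assumes "0 \<le> x" "x \<le> y" "y < 1"
  shows "artanh x \<le> artanh y"
proof -
  have "(1 + x) / (1 - x) \<le> (1 + y) / (1 - y)"
    using assms by (intro frac_le) auto
  then show ?thesis
    using assms by (simp add: artanh_def)
qed

lemma poincare_dist_ge:
  assumes "cmod a < 1" "cmod b < 1"
  shows "cmod ((a - b) / (1 - cnj b * a)) \<le> poincare_dist a b"
  unfolding poincare_dist_def using cmod_mobius_less_1[OF assms] by (intro artanh_ge_self) auto

lemma poincare_dist_nonneg:
  assumes "cmod a < 1" "cmod b < 1"
  shows "0 \<le> poincare_dist a b"
  using poincare_dist_ge[OF assms] norm_ge_zero order_trans by blast

lemma poincare_dist_commute: "poincare_dist a b = poincare_dist b a"
proof -
  have "cmod (1 - cnj b * a) = cmod (1 - cnj a * b)"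
    by (metis complex_cnj_cnj complex_cnj_diff complex_cnj_mult complex_cnj_one complex_mod_cnj mult.commute)
  then show ?thesis
    by (simp add: poincare_dist_def norm_divide norm_minus_commute)
qed

lemma poincare_dist_0_left: "poincare_dist 0 b = artanh (cmod b)"
  by (simp add: poincare_dist_def)

text \<open>The chains from the definition of \<open>kobayashi_dist\<close>, in inductive form:
  concatenation, reversal and all estimates along a chain become rule inductions. The last argument
  is the exact cost, and \<open>trivial\<close> is the chain without discs.\<close>

inductive disc_chain :: "(complex^'n) set \<Rightarrow> complex^'n \<Rightarrow> complex^'n \<Rightarrow> real \<Rightarrow> bool"
  for \<Omega> where
  trivial: "disc_chain \<Omega> z z 0"
| step: "analytic_disc \<Omega> f \<Longrightarrow> cmod a < 1 \<Longrightarrow> cmod b < 1 \<Longrightarrow> disc_chain \<Omega> (f b) w c \<Longrightarrow>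
    disc_chain \<Omega> (f a) w (poincare_dist a b + c)"

text \<open>Prepending a disc shifts the indexed families by one, which \<open>case_nat\<close>
  expresses; conversely the first of \<open>m + 1\<close> links is split off.\<close>

lemma disc_chain_iff:
  "disc_chain \<Omega> z w c \<longleftrightarrow>
    (\<exists>(m::nat) a b p f. c = (\<Sum>j<m. poincare_dist (a j) (b j)) \<and> p 0 = z \<and> p m = w \<and>
       (\<forall>j<m. analytic_disc \<Omega> (f j) \<and> a j \<in> ball 0 1 \<and> b j \<in> ball 0 1 \<and>
              f j (a j) = p j \<and> f j (b j) = p (Suc j)))"
  (is "_ \<longleftrightarrow> (\<exists>m a b p f. ?Q m a b p f z w c)")
proof
  assume "disc_chain \<Omega> z w c"
  then show "\<exists>m a b p f. ?Q m a b p f z w c"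
  proof induction
    case (trivial z)
    show ?case by (rule exI[of _ 0]) auto
  next
    case (step g a b w c)
    obtain m a' b' p f where "?Q m a' b' p f (g b) w c" using step.IH by (elim exE) (rule that)
    then have Q: "c = (\<Sum>j<m. poincare_dist (a' j) (b' j))" "p 0 = g b" "p m = w"
      "\<And>j. j < m \<Longrightarrow> analytic_disc \<Omega> (f j) \<and> a' j \<in> ball 0 1 \<and> b' j \<in> ball 0 1 \<and>
              f j (a' j) = p j \<and> f j (b' j) = p (Suc j)"
      by blast+
    show ?case
    proof (intro exI conjI allI impI)
      show "poincare_dist a b + c =
          (\<Sum>j<Suc m. poincare_dist (case_nat a a' j) (case_nat b b' j))"
        by (simp only: sum.lessThan_Suc_shift Q(1)) simp
      show "case_nat (g a) p 0 = g a" "case_nat (g a) p (Suc m) = w"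
        using Q by auto
      fix j assume "j < Suc m"
      then show "analytic_disc \<Omega> (case_nat g f j)" "case_nat a a' j \<in> ball 0 1"
        "case_nat b b' j \<in> ball 0 1" "case_nat g f j (case_nat a a' j) = case_nat (g a) p j"
        "case_nat g f j (case_nat b b' j) = case_nat (g a) p (Suc j)"
        using Q step by (auto split: nat.splits)
    qed
  qed
next
  assume "\<exists>m a b p f. ?Q m a b p f z w c"
  then obtain m a b p f where "?Q m a b p f z w c" by (elim exE) (rule that)
  then show "disc_chain \<Omega> z w c"
  proof (induction m arbitrary: a b p f z w c)
    case 0
    then show ?case by (auto intro: disc_chain.trivial)
  next
    case (Suc m)
    let ?c = "\<Sum>j<m. poincare_dist (a (Suc j)) (b (Suc j))"
    have "disc_chain \<Omega> (p 1) w ?c"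
      by (rule Suc.IH[where a = "\<lambda>j. a (Suc j)" and b = "\<lambda>j. b (Suc j)"
            and p = "\<lambda>j. p (Suc j)" and f = "\<lambda>j. f (Suc j)"])
        (use Suc.prems in auto)
    moreover have "f 0 (a 0) = z" "f 0 (b 0) = p 1" "analytic_disc \<Omega> (f 0)"
      "cmod (a 0) < 1" "cmod (b 0) < 1"
      using Suc.prems by auto
    moreover have "c = poincare_dist (a 0) (b 0) + ?c"
      using Suc.prems by (simp only: sum.lessThan_Suc_shift)
    ultimately show ?case
      using disc_chain.step[of \<Omega> "f 0" "a 0" "b 0" w ?c] by simp
  qed
qed

section \<open>The Kobayashi distance as an infimum over chains\<close>

lemma kobayashi_dist_eq_Inf:
  "z \<in> \<Omega> \<Longrightarrow> w \<in> \<Omega> \<Longrightarrow> kobayashi_dist \<Omega> z w = Inf {c. disc_chain \<Omega> z w c}"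
  unfolding kobayashi_dist_def disc_chain_iff by (simp add: conj_assoc)

lemma disc_chain_single:
  "analytic_disc \<Omega> f \<Longrightarrow> cmod a < 1 \<Longrightarrow> cmod b < 1 \<Longrightarrow> disc_chain \<Omega> (f a) (f b) (poincare_dist a b)"
  using disc_chain.step[OF _ _ _ disc_chain.trivial] by fastforce

lemma disc_chain_append:
  "disc_chain \<Omega> z w c \<Longrightarrow> disc_chain \<Omega> w u d \<Longrightarrow> disc_chain \<Omega> z u (c + d)"
  by (induction rule: disc_chain.induct) (auto simp: add.assoc intro: disc_chain.step)

lemma disc_chain_commute: "disc_chain \<Omega> z w c \<Longrightarrow> disc_chain \<Omega> w z c"
proof (induction rule: disc_chain.induct)
  case (step f a b w c)
  have "disc_chain \<Omega> (f b) (f a) (poincare_dist a b)"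
    using disc_chain_single[of \<Omega> f b a] step by (simp add: poincare_dist_commute)
  from disc_chain_append[OF step.IH this] show ?case by (simp add: add.commute)
qed (auto intro: disc_chain.trivial)

lemma disc_chain_nonneg: "disc_chain \<Omega> z w c \<Longrightarrow> 0 \<le> c"
  by (induction rule: disc_chain.induct) (auto intro: add_nonneg_nonneg poincare_dist_nonneg)

lemma bdd_below_disc_chain: "bdd_below {c. disc_chain \<Omega> z w c}"
  by (rule bdd_belowI[of _ 0]) (auto intro: disc_chain_nonneg)

lemma kobayashi_dist_le:
  assumes "disc_chain \<Omega> z w c" "z \<in> \<Omega>" "w \<in> \<Omega>"
  shows "kobayashi_dist \<Omega> z w \<le> c"
  unfolding kobayashi_dist_eq_Inf[OF assms(2,3)]
  using assms bdd_below_disc_chain by (intro cInf_lower) auto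

lemma analytic_disc_affine:
  assumes "ball w s \<subseteq> \<Omega>" "norm u \<le> s" "0 < s"
  shows "analytic_disc \<Omega> (\<lambda>\<zeta>. w + \<zeta> *s u)"
proof -
  have "cmod \<zeta> * norm u < s" if "cmod \<zeta> < 1" for \<zeta>
  proof -
    have "cmod \<zeta> * norm u \<le> cmod \<zeta> * s" using assms by (intro mult_left_mono) auto
    also have "\<dots> < 1 * s" using assms that by (intro mult_strict_right_mono) auto
    finally show ?thesis by simp
  qed
  then show ?thesis
    using assms unfolding analytic_disc_def
    by (auto intro!: holomorphic_intros subsetD[OF assms(1)] simp: dist_norm norm_vector_scalar_mult)
qed

text \<open>The affine disc filling the ball reaches \<open>w'\<close> at the latest at half its
  radius, so the cost is the same for every \<open>s\<close>. This scale invariance is what makes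
  the growth towards the boundary logarithmic.\<close>

lemma disc_chain_ball:
  assumes "ball w s \<subseteq> \<Omega>" "0 < s" "norm (w' - w) \<le> s / 2"
  shows "disc_chain \<Omega> w w' (artanh (1/2))"
proof -
  have "norm (2 *s (w' - w)) \<le> s"
    using assms by (simp only: norm_vector_scalar_mult) simp
  from analytic_disc_affine[OF assms(1) this assms(2)]
  have "disc_chain \<Omega> (w + 0 *s (2 *s (w' - w))) (w + (1/2) *s (2 *s (w' - w))) (poincare_dist 0 (1/2))"
    by (intro disc_chain_single) auto
  then show ?thesis by (simp add: poincare_dist_0_left)
qed

text \<open>Being joined by a chain is an equivalence relation, and its classes are open because
  nearby points lie on one affine disc. Otherwise the infimum in \<open>kobayashi_dist\<close> might
  range over an empty set and be an unspecified real.\<close>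

lemma disc_chain_exists:
  assumes "open \<Omega>" "connected \<Omega>" "z \<in> \<Omega>" "w \<in> \<Omega>"
  shows "\<exists>c. disc_chain \<Omega> z w c"
proof (rule connected_equivalence_relation[OF assms(2-4)])
  fix a assume "a \<in> \<Omega>"
  then obtain s where s: "s > 0" "ball a s \<subseteq> \<Omega>"
    using assms(1) open_contains_ball by blast
  show "\<exists>T. openin (top_of_set \<Omega>) T \<and> a \<in> T \<and> (\<forall>x\<in>T. \<exists>c. disc_chain \<Omega> a x c)"
  proof (intro exI conjI ballI)
    show "openin (top_of_set \<Omega>) (ball a (s/2))"
      using s assms(1) by (simp add: openin_open_eq) (meson subset_ball subset_trans ball_divide_subset_numeral)
    show "a \<in> ball a (s/2)" using s by simp
    fix x assume "x \<in> ball a (s/2)"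
    then show "disc_chain \<Omega> a x (artanh (1/2))"
      using s by (intro disc_chain_ball[of a s]) (auto simp: dist_norm norm_minus_commute)
  qed
qed (blast intro: disc_chain_commute disc_chain_append)+

lemma kobayashi_dist_approx:
  assumes "open \<Omega>" "connected \<Omega>" "z \<in> \<Omega>" "w \<in> \<Omega>" "0 < e"
  obtains c where "disc_chain \<Omega> z w c" "c < kobayashi_dist \<Omega> z w + e"
proof -
  have "{c. disc_chain \<Omega> z w c} \<noteq> {}"
    using disc_chain_exists[OF assms(1-4)] by auto
  then show thesis
    using that assms(5) kobayashi_dist_eq_Inf[OF assms(3,4)]
      cInf_lessD[of "{c. disc_chain \<Omega> z w c}" "kobayashi_dist \<Omega> z w + e"] by force
qed

lemma kobayashi_dist_triangle:
  assumes "open \<Omega>" "connected \<Omega>" "z \<in> \<Omega>" "w \<in> \<Omega>" "u \<in> \<Omega>"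
  shows "kobayashi_dist \<Omega> z u \<le> kobayashi_dist \<Omega> z w + kobayashi_dist \<Omega> w u"
proof (rule field_le_epsilon)
  fix e :: real assume "e > 0"
  then have "e / 2 > 0" by simp
  obtain c where c: "disc_chain \<Omega> z w c" "c < kobayashi_dist \<Omega> z w + e/2"
    using kobayashi_dist_approx[OF assms(1-4) \<open>e / 2 > 0\<close>] .
  obtain d where d: "disc_chain \<Omega> w u d" "d < kobayashi_dist \<Omega> w u + e/2"
    using kobayashi_dist_approx[OF assms(1,2,4,5) \<open>e / 2 > 0\<close>] .
  show "kobayashi_dist \<Omega> z u \<le> kobayashi_dist \<Omega> z w + kobayashi_dist \<Omega> w u + e"
    using kobayashi_dist_le[OF disc_chain_append[OF c(1) d(1)]] assms c d by force
qed

lemma kobayashi_dist_commute: "kobayashi_dist \<Omega> z w = kobayashi_dist \<Omega> w z"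
proof -
  have "{c. disc_chain \<Omega> z w c} = {c. disc_chain \<Omega> w z c}"
    using disc_chain_commute by blast
  then show ?thesis
  proof (cases "z \<in> \<Omega> \<and> w \<in> \<Omega>")
    case False
    then show ?thesis unfolding kobayashi_dist_def by auto
  qed (simp add: kobayashi_dist_eq_Inf)
qed

lemma kobayashi_dist_nonneg:
  assumes "open \<Omega>" "connected \<Omega>"
  shows "0 \<le> kobayashi_dist \<Omega> z w"
proof (cases "z \<in> \<Omega> \<and> w \<in> \<Omega>")
  case True
  then have "{c. disc_chain \<Omega> z w c} \<noteq> {}"
    using disc_chain_exists assms by blast
  then show ?thesis
    using True cInf_greatest[of "{c. disc_chain \<Omega> z w c}" 0]
    by (auto simp: kobayashi_dist_eq_Inf dest: disc_chain_nonneg)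
qed (auto simp: kobayashi_dist_def)

text \<open>After moving \<open>b\<close> to \<open>0\<close> by a Moebius map and dividing by
  \<open>2 * M\<close>, which bounds \<open>f - f b\<close>, the Schwarz lemma applies. The constant
  is not sharp; what matters is that it is the same for all discs.\<close>

lemma schwarz_pick_bounded:
  assumes f: "f holomorphic_on ball 0 1" and M: "\<And>\<zeta>. cmod \<zeta> < 1 \<Longrightarrow> cmod (f \<zeta>) < M"
    and ab: "cmod a < 1" "cmod b < 1"
  shows "cmod (f a - f b) \<le> 2 * M * poincare_dist a b"
proof -
  define g where "g \<zeta> = (f (Moebius_function 0 (-b) \<zeta>) - f b) / of_real (2 * M)" for \<zeta>
  define c where "c = Moebius_function 0 b a"
  have M0: "0 < M" using M[of 0] norm_ge_zero[of "f 0"] by (simp del: norm_ge_zero)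
  have c: "cmod c < 1" unfolding c_def using ab by (intro Moebius_function_norm_lt_1)
  have mob: "cmod (Moebius_function 0 (-b) \<zeta>) < 1" if "cmod \<zeta> < 1" for \<zeta>
    using that ab by (intro Moebius_function_norm_lt_1) auto
  have "f \<circ> Moebius_function 0 (-b) holomorphic_on ball 0 1"
    using ab mob by (intro holomorphic_on_compose_gen[OF _ f] Moebius_function_holomorphic) auto
  then have "g holomorphic_on ball 0 1"
    unfolding g_def o_def using M0 by (intro holomorphic_intros) auto
  moreover have "g 0 = 0" by (simp add: g_def Moebius_function_of_zero)
  moreover have "cmod (g \<zeta>) < 1" if "cmod \<zeta> < 1" for \<zeta>
  proof -
    have "cmod (f (Moebius_function 0 (-b) \<zeta>) - f b) < 2 * M"
      using norm_triangle_ineq4[of "f (Moebius_function 0 (-b) \<zeta>)" "f b"] M[OF mob[OF that]] M[OF ab(2)]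
      by simp
    then show ?thesis using M0 by (simp add: g_def norm_divide norm_mult)
  qed
  ultimately have "cmod (g c) \<le> cmod c" using c by (intro Schwarz_Lemma(1)) auto
  moreover have "Moebius_function 0 (-b) c = a"
    unfolding c_def using ab by (intro Moebius_function_compose) auto
  ultimately have "cmod (f a - f b) \<le> 2 * M * cmod c"
    using M0 by (simp add: g_def norm_divide norm_mult field_simps)
  also have "cmod c \<le> poincare_dist a b"
    using poincare_dist_ge[OF ab] by (simp add: c_def Moebius_function_simple)
  finally show ?thesis using M0 by simp
qed

text \<open>The bounds for single discs add up along the chain, with a constant independent of the
  number of links. Hence the distance of a bounded domain separates points, and convergence in it
  implies convergence in every coordinate.\<close>

lemma disc_chain_component_le:
  assumes "disc_chain \<Omega> z w c" "\<And>x. x \<in> \<Omega> \<Longrightarrow> norm x < M" "M > 0"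
  shows "cmod (z $ i - w $ i) \<le> 2 * M * c"
  using assms(1)
proof induction
  case (step f a b w c)
  have "cmod (f \<zeta> $ i) < M" if "cmod \<zeta> < 1" for \<zeta>
  proof -
    have "f \<zeta> \<in> \<Omega>" using step(1) that by (auto simp: analytic_disc_def image_subset_iff)
    then show ?thesis
      using assms(2) Finite_Cartesian_Product.norm_nth_le[of "f \<zeta>" i] by fastforce
  qed
  then have "cmod (f a $ i - f b $ i) \<le> 2 * M * poincare_dist a b"
    using step by (intro schwarz_pick_bounded) (auto simp: analytic_disc_def)
  then have "cmod (f a $ i - w $ i) \<le> 2 * M * poincare_dist a b + 2 * M * c"
    using step.IH norm_triangle_ineq[of "f a $ i - f b $ i" "f b $ i - w $ i"] by simp
  then show ?case by (simp add: algebra_simps)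
qed auto

lemma kobayashi_dist_ge_component:
  assumes "open \<Omega>" "connected \<Omega>" "z \<in> \<Omega>" "w \<in> \<Omega>" "\<And>x. x \<in> \<Omega> \<Longrightarrow> norm x < M" "M > 0"
  shows "cmod (z $ i - w $ i) \<le> 2 * M * kobayashi_dist \<Omega> z w"
proof -
  have "{c. disc_chain \<Omega> z w c} \<noteq> {}"
    using disc_chain_exists assms by blast
  then have "cmod (z $ i - w $ i) / (2 * M) \<le> kobayashi_dist \<Omega> z w"
    unfolding kobayashi_dist_eq_Inf[OF assms(3,4)]
    using disc_chain_component_le[OF _ assms(5,6)] \<open>M > 0\<close>
    by (intro cInf_greatest) (auto simp: field_simps)
  then show ?thesis using \<open>M > 0\<close> by (simp add: field_simps)
qed

lemma Metric_space_kobayashi_dist: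
  assumes "open \<Omega>" "connected \<Omega>" "bounded \<Omega>"
  shows "Metric_space \<Omega> (kobayashi_dist \<Omega>)"
proof
  fix x y z
  show "0 \<le> kobayashi_dist \<Omega> x y" using assms by (intro kobayashi_dist_nonneg)
  show "kobayashi_dist \<Omega> x y = kobayashi_dist \<Omega> y x" by (rule kobayashi_dist_commute)
  show "kobayashi_dist \<Omega> x z \<le> kobayashi_dist \<Omega> x y + kobayashi_dist \<Omega> y z"
    if "x \<in> \<Omega>" "y \<in> \<Omega>" "z \<in> \<Omega>" using assms that by (intro kobayashi_dist_triangle)
  obtain M where M: "M > 0" "\<And>x. x \<in> \<Omega> \<Longrightarrow> norm x < M"
    using assms(3) bounded_pos_less by metis
  assume xy: "x \<in> \<Omega>" "y \<in> \<Omega>"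
  have "kobayashi_dist \<Omega> x x \<le> 0" using xy by (intro kobayashi_dist_le disc_chain.trivial)
  moreover have "x = y" if "kobayashi_dist \<Omega> x y = 0"
    using kobayashi_dist_ge_component[OF assms(1,2) xy M(2,1)] that by (simp add: vec_eq_iff)
  ultimately show "kobayashi_dist \<Omega> x y = 0 \<longleftrightarrow> x = y"
    using kobayashi_dist_nonneg[OF assms(1,2), of x x] by auto
qed

text \<open>Points within half the radius of an inscribed ball are at the uniform cost
  \<open>artanh (1/2)\<close> from its centre, so a finite cover by such half balls
  suffices.\<close>

lemma kobayashi_dist_bounded_on_compact:
  assumes "open \<Omega>" "connected \<Omega>" "o' \<in> \<Omega>" "compact C" "C \<subseteq> \<Omega>"
  obtains B where "\<And>z. z \<in> C \<Longrightarrow> kobayashi_dist \<Omega> o' z \<le> B"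
proof -
  have "\<exists>s>0. ball w s \<subseteq> \<Omega>" if "w \<in> C" for w
    using that assms open_contains_ball by blast
  then obtain s where s: "\<And>w. w \<in> C \<Longrightarrow> s w > 0 \<and> ball w (s w) \<subseteq> \<Omega>" by metis
  have "C \<subseteq> (\<Union>w\<in>C. ball w (s w / 2))"
  proof
    fix w assume "w \<in> C"
    then show "w \<in> (\<Union>w\<in>C. ball w (s w / 2))" using s[of w] by (intro UN_I[of w]) auto
  qed
  then obtain C' where C': "C' \<subseteq> C" "finite C'" "C \<subseteq> (\<Union>w\<in>C'. ball w (s w / 2))"
    using compactE_image[OF \<open>compact C\<close>, of C "\<lambda>w. ball w (s w / 2)"] by blast
  \<comment> \<open>The \<open>0\<close> keeps \<open>Max\<close> meaningful when the finite cover
    is empty.\<close>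
  let ?B = "Max (insert 0 (kobayashi_dist \<Omega> o' ` C')) + artanh (1/2)"
  have "kobayashi_dist \<Omega> o' z \<le> ?B" if "z \<in> C" for z
  proof -
    obtain w where w: "w \<in> C'" "dist w z < s w / 2" using C'(3) \<open>z \<in> C\<close> by auto
    have sw: "s w > 0" "ball w (s w) \<subseteq> \<Omega>" "w \<in> \<Omega>" using s w C' assms by auto
    have "disc_chain \<Omega> w z (artanh (1/2))"
      using w sw by (intro disc_chain_ball[of w "s w"]) (auto simp: dist_norm norm_minus_commute)
    then have "kobayashi_dist \<Omega> w z \<le> artanh (1/2)"
      using kobayashi_dist_le sw that assms by blast
    moreover have "kobayashi_dist \<Omega> o' w \<le> Max (insert 0 (kobayashi_dist \<Omega> o' ` C'))"
      using w C' by (intro Max_ge) auto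
    ultimately show ?thesis
      using kobayashi_dist_triangle[OF assms(1,2,3) sw(3), of z] that assms by fastforce
  qed
  then show thesis using that by blast
qed

section \<open>Isolated boundary points\<close>

lemma norm_axis_complex: "norm (axis i (c::complex) :: complex^'n) = cmod c"
proof -
  have "(cmod ((axis i c :: complex^'n) $ k))\<^sup>2 = (if k = i then (cmod c)\<^sup>2 else 0)" for k
    by (simp add: axis_def)
  then show ?thesis by (simp add: norm_vec_def L2_set_def)
qed

text \<open>The boundary circles of a family of discs sweep out a compact part of
  \<open>\<Omega>\<close>, where \<open>u\<close> is bounded. By the mean value inequality the same
  bound holds at the centres; these tend to the missing point \<open>a\<close>, so a sublevel set
  fails to be closed. Direction \<open>i\<close> carries the discs, direction \<open>j\<close> moves
  them off \<open>a\<close>.\<close>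

lemma not_pseudoconvex_if_isolated_boundary_point:
  fixes \<Omega> :: "(complex^'n) set" and a :: "complex^'n" and i j :: 'n
  assumes "i \<noteq> j" "0 < r" and sub: "cball a r - {a} \<subseteq> \<Omega>" and "a \<notin> \<Omega>"
  shows "\<not> pseudoconvex \<Omega>"
proof
  assume "pseudoconvex \<Omega>"
  then obtain u where u: "continuous_psh_on \<Omega> u" and comp: "\<And>c. compact {z\<in>\<Omega>. u z \<le> c}"
    unfolding pseudoconvex_def by blast
  \<comment> \<open>The shift and the radius each contribute at most \<open>s\<close>, and together
    they have to stay within \<open>r\<close>.\<close>
  define s where "s = r / 2"
  have s: "0 < s" using \<open>0 < r\<close> by (simp add: s_def)
  define P where "P t \<zeta> = a + axis j (complex_of_real t) + \<zeta> *s axis i (complex_of_real s)" for t \<zeta>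
  have P_in: "P t \<zeta> \<in> \<Omega>" if "0 \<le> t" "t \<le> s" "cmod \<zeta> \<le> 1" "t \<noteq> 0 \<or> \<zeta> \<noteq> 0" for t \<zeta>
  proof -
    have "norm (P t \<zeta> - a) \<le> norm (axis j (complex_of_real t) :: complex^'n)
        + norm (\<zeta> *s (axis i (complex_of_real s) :: complex^'n))"
      unfolding P_def by (simp add: add.assoc norm_triangle_ineq)
    also have "\<dots> \<le> s + 1 * s"
      unfolding norm_vector_scalar_mult norm_axis_complex
      using that s by (intro add_mono mult_mono) auto
    finally have "P t \<zeta> \<in> cball a r" by (simp add: dist_norm norm_minus_commute s_def)
    moreover have "P t \<zeta> \<noteq> a"
    proof
      assume "P t \<zeta> = a"
      then have "P t \<zeta> $ j = a $ j" "P t \<zeta> $ i = a $ i" by auto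
      then show False using that s \<open>i \<noteq> j\<close> by (simp add: P_def axis_def)
    qed
    ultimately show ?thesis using sub by blast
  qed
  have contP: "continuous_on S (\<lambda>x. P (f x) (g x))"
    if "continuous_on S f" "continuous_on S g" for S and f :: "'b::topological_space \<Rightarrow> real" and g
  proof -
    have "continuous_on S (\<lambda>x. (if l = j then complex_of_real (f x) else 0)
        + g x * (if l = i then complex_of_real s else 0))" for l
      by (cases "l = j"; cases "l = i") (auto intro!: continuous_intros that)
    then have "continuous_on S (\<lambda>x. \<chi> l. a $ l + ((if l = j then complex_of_real (f x) else 0)
        + g x * (if l = i then complex_of_real s else 0)))"
      by (intro continuous_on_vec_lambda continuous_on_add[OF continuous_on_const])
    also have "(\<lambda>x. \<chi> l. a $ l + ((if l = j then complex_of_real (f x) else 0)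
        + g x * (if l = i then complex_of_real s else 0))) = (\<lambda>x. P (f x) (g x))"
      by (auto simp: P_def vec_eq_iff axis_def fun_eq_iff)
    finally show ?thesis .
  qed
  have u_cont: "continuous_on \<Omega> u" using u by (simp add: continuous_psh_on_def)
  \<comment> \<open>The value \<open>t = 0\<close> is included: that circle still avoids
    \<open>a\<close>, which makes the bound uniform as \<open>t\<close> tends to
    \<open>0\<close>.\<close>
  have cont2: "continuous_on ({0..s} \<times> {0..2*pi}) (\<lambda>x. u (P (fst x) (cis (snd x))))"
    by (rule continuous_on_compose2[OF u_cont contP]) (auto intro!: continuous_intros P_in)
  have "compact ((\<lambda>x. u (P (fst x) (cis (snd x)))) ` ({0..s} \<times> {0..2*pi}))"
    by (intro compact_continuous_image cont2 compact_Times compact_Icc)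
  then have "bdd_above ((\<lambda>x. u (P (fst x) (cis (snd x)))) ` ({0..s} \<times> {0..2*pi}))"
    by (intro bounded_imp_bdd_above compact_imp_bounded)
  then obtain M where "\<forall>x\<in>{0..s} \<times> {0..2*pi}. u (P (fst x) (cis (snd x))) \<le> M"
    unfolding bdd_above_def by blast
  then have M: "\<And>t \<theta>. t \<in> {0..s} \<Longrightarrow> \<theta> \<in> {0..2*pi} \<Longrightarrow> u (P t (cis \<theta>)) \<le> M"
    by simp
  have bound: "u (P t 0) \<le> M" if t: "0 < t" "t \<le> s" for t
  proof -
    have "u (P t 0) \<le> integral {0..2*pi} (\<lambda>\<theta>. u (P t 0 + cis \<theta> *s axis i (complex_of_real s))) / (2*pi)"
      using u P_in[of t] t unfolding continuous_psh_on_def by (simp add: P_def)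
    also have "(\<lambda>\<theta>. u (P t 0 + cis \<theta> *s axis i (complex_of_real s))) = (\<lambda>\<theta>. u (P t (cis \<theta>)))"
      by (simp add: P_def)
    also have "integral {0..2*pi} (\<lambda>\<theta>. u (P t (cis \<theta>))) \<le> integral {0..2*pi} (\<lambda>\<theta>. M)"
    proof (rule integral_le)
      have "continuous_on {0..2*pi} (\<lambda>\<theta>. u (P t (cis \<theta>)))"
        using t by (intro continuous_on_compose2[OF u_cont contP]) (auto intro!: continuous_intros P_in)
      then show "(\<lambda>\<theta>. u (P t (cis \<theta>))) integrable_on {0..2*pi}"
        by (rule integrable_continuous_interval)
    qed (use M t in auto)
    also have "\<dots> / (2*pi) = M" by simp
    finally show ?thesis by (simp add: divide_right_mono)
  qed
  define x where "x n = P (s / real (Suc n)) 0" for n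
  have "x n \<in> {z\<in>\<Omega>. u z \<le> M}" for n
  proof -
    have "s / real (Suc n) \<le> s" "0 < s / real (Suc n)" using s by (auto simp: field_simps)
    then show ?thesis unfolding x_def using bound P_in[of _ 0] by simp
  qed
  moreover have "x \<longlonglongrightarrow> P 0 0"
  proof -
    have "(\<lambda>n. s / real (Suc n)) \<longlonglongrightarrow> 0" by real_asymp
    moreover have "continuous_on UNIV (\<lambda>t. P t 0)" by (intro contP continuous_intros)
    ultimately show ?thesis
      unfolding x_def using continuous_on_tendsto_compose[of UNIV "\<lambda>t. P t 0"] by simp
  qed
  ultimately have "P 0 0 \<in> {z\<in>\<Omega>. u z \<le> M}"
    by (rule closed_sequentially[OF compact_imp_closed[OF comp]])
  moreover have "P 0 0 = a" by (simp add: P_def vec_eq_iff axis_def)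
  ultimately show False using \<open>a \<notin> \<Omega>\<close> by simp
qed

text \<open>Any two of the points \<open>x m\<close> lie on one disc, at the parameters
  \<open>t m\<close> and \<open>t k\<close>. These tend to the interior point \<open>0\<close> of
  the unit disc, so their Poincare distances tend to \<open>0\<close> and \<open>x\<close> is
  Cauchy; but a limit in \<open>\<Omega>\<close> would have to be the Euclidean limit
  \<open>a\<close>.\<close>

lemma not_kobayashi_complete_if_isolated_boundary_point:
  fixes \<Omega> :: "(complex^'n) set" and a :: "complex^'n" and i j :: 'n
  assumes \<Omega>: "open \<Omega>" "connected \<Omega>" "bounded \<Omega>"
    and "i \<noteq> j" "0 < r" and sub: "cball a r - {a} \<subseteq> \<Omega>" and "a \<notin> \<Omega>"
  shows "\<not> kobayashi_complete \<Omega>"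
proof
  assume comp: "kobayashi_complete \<Omega>"
  interpret Metric_space \<Omega> "kobayashi_dist \<Omega>" by (rule Metric_space_kobayashi_dist[OF \<Omega>])
  define t where "t n = 1 / real (n + 2)" for n
  have t: "0 < t n" "t n < 1" for n by (auto simp: t_def)
  \<comment> \<open>On the unit disc the linear term has norm at most \<open>s\<close> and the
    bending term at most \<open>s * 2 * 2\<close>, together \<open>5 * s\<close>.\<close>
  define s where "s = r / 5"
  have s: "0 < s" using \<open>0 < r\<close> by (simp add: s_def)
  \<comment> \<open>One disc through \<open>x m\<close> and \<open>x k\<close>, bent in direction \<open>i\<close> so that it misses the puncture at \<open>\<zeta> = 0\<close>.\<close>
  define f where "f m k \<zeta> = a + axis j (of_real s * \<zeta>)
      + axis i (of_real s * (\<zeta> - of_real (t m)) * (\<zeta> - of_real (t k)))" for m k \<zeta>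
  define x where "x m = a + axis j (complex_of_real (s * t m))" for m
  have disc: "analytic_disc \<Omega> (f m k)" for m k
    unfolding analytic_disc_def
  proof (intro conjI allI)
    fix l show "(\<lambda>\<zeta>. f m k \<zeta> $ l) holomorphic_on ball 0 1"
      unfolding f_def axis_def by (cases "l = j"; cases "l = i") (auto intro!: holomorphic_intros)
    show "f m k ` ball 0 1 \<subseteq> \<Omega>"
    proof clarify
      fix \<zeta> :: complex assume \<zeta>: "\<zeta> \<in> ball 0 1"
      have le2: "cmod (\<zeta> - of_real (t m)) \<le> 2" for m
        using norm_triangle_ineq4[of \<zeta> "of_real (t m)"] \<zeta> t[of m] by simp
      have "norm (f m k \<zeta> - a) \<le> norm (axis j (of_real s * \<zeta>) :: complex^'n)
          + norm (axis i (of_real s * (\<zeta> - of_real (t m)) * (\<zeta> - of_real (t k))) :: complex^'n)"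
        unfolding f_def by (simp add: add.assoc norm_triangle_ineq)
      also have "\<dots> \<le> s * 1 + s * 2 * 2"
        unfolding norm_axis_complex norm_mult using s \<zeta> le2
        by (intro add_mono mult_mono) auto
      finally have "f m k \<zeta> \<in> cball a r" by (simp add: dist_norm norm_minus_commute s_def)
      \<comment> \<open>The \<open>j\<close>-coordinate agrees with that of \<open>a\<close> only at
        parameter \<open>0\<close>, where the bending term is \<open>s * t m * t k\<close> and does
        not vanish.\<close>
      moreover have "f m k \<zeta> \<noteq> a"
      proof
        assume "f m k \<zeta> = a"
        then have "f m k \<zeta> $ j = a $ j" "f m k \<zeta> $ i = a $ i" by auto
        then show False using s t[of m] t[of k] \<open>i \<noteq> j\<close> by (auto simp: f_def axis_def)
      qed
      ultimately show "f m k \<zeta> \<in> \<Omega>" using sub by blast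
    qed
  qed
  have fx: "f m k (of_real (t m)) = x m" "f m k (of_real (t k)) = x k" for m k
    by (auto simp: f_def x_def vec_eq_iff axis_def)
  have x_in: "x m \<in> \<Omega>" for m
  proof -
    have "f m m (of_real (t m)) \<in> \<Omega>"
      using disc[of m m] t[of m] unfolding analytic_disc_def image_subset_iff by auto
    then show ?thesis by (simp only: fx)
  qed
  have dist_x: "kobayashi_dist \<Omega> (x m) (x k) \<le> poincare_dist (of_real (t m)) (of_real (t k))" for m k
    using disc_chain_single[OF disc, of "of_real (t m)" "of_real (t k)" m k] t[of m] t[of k]
    by (intro kobayashi_dist_le x_in) (simp add: fx)
  \<comment> \<open>The condition \<open>1 \<le> N\<close> forces \<open>t N \<le> 1/3\<close>. This
    keeps \<open>2 * t N\<close> below \<open>1\<close>, as \<open>artanh\<close> demands, and the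
    Moebius denominator above \<open>1/2\<close>.\<close>
  have dist_x_le: "kobayashi_dist \<Omega> (x m) (x k) \<le> artanh (2 * t N)" if "N \<le> m" "N \<le> k" "1 \<le> N" for m k N
  proof -
    have tN: "t m \<le> t N" "t k \<le> t N" "t N \<le> 1/3" using that by (auto simp: t_def field_simps)
    have "t k * t m \<le> (1/3) * 1" using tN t[of m] t[of k] by (intro mult_mono) auto
    then have "1/2 \<le> \<bar>1 - t k * t m\<bar>" by simp
    moreover have "\<bar>t m - t k\<bar> \<le> t N" using tN t[of m] t[of k] by (simp add: abs_le_iff)
    ultimately have "\<bar>t m - t k\<bar> / \<bar>1 - t k * t m\<bar> \<le> t N / (1/2)"
      using t[of N] by (intro frac_le) auto
    then have "artanh (\<bar>t m - t k\<bar> / \<bar>1 - t k * t m\<bar>) \<le> artanh (2 * t N)"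
      using tN by (intro artanh_mono_real) auto
    moreover have "of_real (t m) - of_real (t k) = complex_of_real (t m - t k)"
      "1 - cnj (of_real (t k)) * of_real (t m) = complex_of_real (1 - t k * t m)"
      by simp_all
    then have "poincare_dist (of_real (t m)) (of_real (t k)) = artanh (\<bar>t m - t k\<bar> / \<bar>1 - t k * t m\<bar>)"
      by (simp only: poincare_dist_def norm_divide norm_of_real)
    ultimately show ?thesis using dist_x[of m k] by simp
  qed
  have "MCauchy x"
    unfolding MCauchy_def
  proof (intro conjI allI impI)
    show "range x \<subseteq> \<Omega>" using x_in by auto
    fix e :: real assume "e > 0"
    have "(\<lambda>n. artanh (2 * t n)) \<longlonglongrightarrow> 0"
      unfolding t_def artanh_def by real_asymp
    then have "\<forall>\<^sub>F n in sequentially. artanh (2 * t n) < e \<and> 1 \<le> n"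
      using \<open>e > 0\<close> by (intro eventually_conj order_tendstoD(2) eventually_ge_at_top) auto
    then obtain N where "artanh (2 * t N) < e" "1 \<le> N"
      using eventually_happens' sequentially_bot by blast
    then show "\<exists>N. \<forall>n n'. N \<le> n \<longrightarrow> N \<le> n' \<longrightarrow> kobayashi_dist \<Omega> (x n) (x n') < e"
      using dist_x_le order.strict_trans1 by blast
  qed
  then obtain l where "limitin mtopology x l sequentially"
    using comp unfolding kobayashi_complete_def mcomplete_def by blast
  then have l: "l \<in> \<Omega>" "\<And>e. e > 0 \<Longrightarrow> \<exists>N. \<forall>n\<ge>N. kobayashi_dist \<Omega> (x n) l < e"
    unfolding limit_metric_sequentially by blast+
  \<comment> \<open>By the lower bound on bounded domains, convergence to \<open>l\<close> holds in
    every coordinate as well, while the coordinates of \<open>x n\<close> tend to those of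
    \<open>a\<close>.\<close>
  obtain M where M: "M > 0" "\<And>z. z \<in> \<Omega> \<Longrightarrow> norm z < M"
    using \<Omega>(3) bounded_pos_less by metis
  have "(\<lambda>n. kobayashi_dist \<Omega> (x n) l) \<longlonglongrightarrow> 0"
    using l(2) unfolding LIMSEQ_iff by simp
  then have *: "(\<lambda>n. 2 * M * kobayashi_dist \<Omega> (x n) l) \<longlonglongrightarrow> 0"
    by (rule tendsto_mult_right_zero)
  have lim1: "(\<lambda>n. x n $ q) \<longlonglongrightarrow> l $ q" for q
  proof (rule LIM_zero_cancel, rule Lim_null_comparison[OF always_eventually *], rule allI)
    show "norm (x n $ q - l $ q) \<le> 2 * M * kobayashi_dist \<Omega> (x n) l" for n
      using kobayashi_dist_ge_component[OF \<Omega>(1,2) x_in l(1) M(2,1)] .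
  qed
  have "t \<longlonglongrightarrow> 0" unfolding t_def by real_asymp
  then have "(\<lambda>n. a $ q + (if q = j then complex_of_real (s * t n) else 0))
      \<longlonglongrightarrow> a $ q + (if q = j then of_real (s * 0) else 0)" for q
    using tendsto_add[OF tendsto_const tendsto_of_real[OF tendsto_mult[OF tendsto_const]], of t 0 sequentially "a $ q" s]
    by (cases "q = j") simp_all
  moreover have "x n $ q = a $ q + (if q = j then complex_of_real (s * t n) else 0)" for n q
    by (simp add: x_def axis_def)
  ultimately have "(\<lambda>n. x n $ q) \<longlonglongrightarrow> a $ q + (if q = j then of_real (s * 0) else 0)" for q
    by presburger
  then have "l $ q = a $ q + (if q = j then of_real (s * 0) else 0)" for q
    using LIMSEQ_unique[OF lim1] by blast
  then have "l = a" by (simp add: vec_eq_iff)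
  then show False using l(1) \<open>a \<notin> \<Omega>\<close> by simp
qed

section \<open>Absolutely continuous curves\<close>

text \<open>A mean value inequality for a speed bound that holds almost everywhere, phrased with an
  antiderivative \<open>G\<close> of the bound so that no integral of the speed appears. On a fine
  tagged division, intervals tagged outside the null set obey the derivative bound; those tagged
  inside it lie in an open set of small measure, where absolute continuity takes over.\<close>

lemma abs_continuous_norm_le_increment:
  fixes \<sigma> :: "real \<Rightarrow> 'a::real_normed_vector" and G g :: "real \<Rightarrow> real"
  assumes ac: "abs_continuous_on {a..b} \<sigma>" and "a \<le> b"
    and ae: "AE t in lborel. t \<in> {a..b} \<longrightarrow>
      (\<exists>v. (\<sigma> has_vector_derivative v) (at t within {a..b}) \<and> norm v \<le> g t)"
    and G: "\<And>t. (G has_real_derivative g t) (at t)" and g: "\<And>t. 0 \<le> g t"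
  shows "norm (\<sigma> b - \<sigma> a) \<le> G b - G a"
proof (rule field_le_epsilon)
  fix e' :: real assume "e' > 0"
  \<comment> \<open>The exceptional intervals will cost \<open>e\<close> in total and the others
    \<open>2 * e\<close> per unit of length, which adds up to \<open>e'\<close>.\<close>
  define e where "e = e' / (1 + 2 * (b - a))"
  have e: "0 < e" "e * (1 + 2 * (b - a)) = e'"
    using \<open>e' > 0\<close> \<open>a \<le> b\<close> by (auto simp: e_def)
  from ac e obtain \<delta> where "\<delta> > 0" and \<delta>: "\<And>(n::nat) l r.
      (\<And>i. i < n \<Longrightarrow> l i \<in> {a..b} \<and> r i \<in> {a..b} \<and> l i \<le> r i) \<Longrightarrow>
      disjoint_family_on (\<lambda>i. {l i<..<r i}) {..<n} \<Longrightarrow>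
      (\<Sum>i<n. r i - l i) < \<delta> \<Longrightarrow> (\<Sum>i<n. dist (\<sigma> (l i)) (\<sigma> (r i))) < e"
    unfolding abs_continuous_on_def by meson
  from ae obtain N where N: "N \<in> null_sets lborel"
    and sub: "{t \<in> space lborel. \<not> (t \<in> {a..b} \<longrightarrow>
      (\<exists>v. (\<sigma> has_vector_derivative v) (at t within {a..b}) \<and> norm v \<le> g t))} \<subseteq> N"
    unfolding eventually_ae_filter by blast
  have "\<exists>v. (\<sigma> has_vector_derivative v) (at t within {a..b}) \<and> norm v \<le> g t"
    if "t \<in> {a..b}" "t \<notin> N" for t
    using subsetD[OF sub, of t] that unfolding space_lborel space_borel by blast
  then obtain v where v: "\<And>t. t \<in> {a..b} \<Longrightarrow> t \<notin> N \<Longrightarrow>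
      (\<sigma> has_vector_derivative v t) (at t within {a..b}) \<and> norm (v t) \<le> g t"
    by metis
  have NB: "N \<in> sets borel" using null_setsD2[OF N(1)] by simp
  obtain U where U: "open U" "N \<subseteq> U" "emeasure lborel (U - N) < \<delta>"
    using outer_regular_lborel[OF NB \<open>\<delta> > 0\<close>] by blast
  have "emeasure lborel U \<le> emeasure lborel (U - N) + emeasure lborel N"
    using U N by (intro order_trans[OF emeasure_mono emeasure_subadditive]) auto
  also have "emeasure lborel N = 0" using N by auto
  finally have U_less: "emeasure lborel U < \<delta>" using U(3) by simp
  have G_mono: "G s \<le> G s'" if "s \<le> s'" for s s'
    using DERIV_nonneg_imp_nondecreasing[OF that] G g by blast
  \<comment> \<open>The tag lies between \<open>s\<close> and \<open>s'\<close>, so the errors of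
    the expansions towards both sides add up to at most \<open>e * (s' - s)\<close>. They arise once
    for \<open>\<sigma>\<close> and once for \<open>G\<close>, hence the factor
    \<open>2\<close>.\<close>
  have "\<exists>d>0. if t \<in> N then ball t d \<subseteq> U else
      \<forall>s s'. a \<le> s \<longrightarrow> s \<le> t \<longrightarrow> t \<le> s' \<longrightarrow> s' \<le> b \<longrightarrow> s \<in> ball t d \<longrightarrow> s' \<in> ball t d \<longrightarrow>
        norm (\<sigma> s' - \<sigma> s) \<le> G s' - G s + 2 * e * (s' - s)" if t: "t \<in> {a..b}" for t
  proof (cases "t \<in> N")
    case True
    then show ?thesis using U open_contains_ball by (metis subsetD)
  next
    case False
    have "(\<sigma> has_derivative (\<lambda>h. h *\<^sub>R v t)) (at t within {a..b})"
      using v[OF t False] by (simp add: has_vector_derivative_def)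
    then obtain d1 where d1: "d1 > 0" "\<And>y. y \<in> {a..b} \<Longrightarrow> norm (y - t) < d1 \<Longrightarrow>
        norm (\<sigma> y - \<sigma> t - (y - t) *\<^sub>R v t) \<le> e * norm (y - t)"
      using e(1) unfolding has_derivative_within_alt by meson
    have "(G has_derivative (\<lambda>h. h * g t)) (at t within UNIV)"
      using G[of t] by (simp add: has_field_derivative_def mult_commute_abs)
    then obtain d2 where d2: "d2 > 0" "\<And>y. norm (y - t) < d2 \<Longrightarrow>
        norm (G y - G t - (y - t) * g t) \<le> e * norm (y - t)"
      using e(1) unfolding has_derivative_within_alt by (meson UNIV_I)
    have "norm (\<sigma> s' - \<sigma> s) \<le> G s' - G s + 2 * e * (s' - s)"
      if s: "a \<le> s" "s \<le> t" "t \<le> s'" "s' \<le> b" "s \<in> ball t (min d1 d2)" "s' \<in> ball t (min d1 d2)" for s s'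
    proof -
      have "\<sigma> s' - \<sigma> s = (\<sigma> s' - \<sigma> t - (s' - t) *\<^sub>R v t) - (\<sigma> s - \<sigma> t - (s - t) *\<^sub>R v t)
          + (s' - s) *\<^sub>R v t"
        by (simp add: algebra_simps)
      also have "norm \<dots> \<le> e * (s' - t) + e * (t - s) + (s' - s) * g t"
      proof -
        have "norm (\<sigma> s' - \<sigma> t - (s' - t) *\<^sub>R v t) \<le> e * (s' - t)"
          using d1(2)[of s'] s t by (auto simp: dist_norm)
        moreover have "norm (\<sigma> s - \<sigma> t - (s - t) *\<^sub>R v t) \<le> e * (t - s)"
          using d1(2)[of s] s t by (auto simp: dist_norm)
        moreover have "norm ((s' - s) *\<^sub>R v t) \<le> (s' - s) * g t"
          using s v[OF t False] by (auto intro!: mult_left_mono)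
        ultimately show ?thesis
          by (intro norm_triangle_le add_mono norm_triangle_le_diff[OF add_mono])
      qed
      also have "(s' - s) * g t \<le> G s' - G s + e * (s' - t) + e * (t - s)"
      proof -
        have "\<bar>G s' - G t - (s' - t) * g t\<bar> \<le> e * (s' - t)"
          "\<bar>G s - G t - (s - t) * g t\<bar> \<le> e * (t - s)"
          using d2(2)[of s'] d2(2)[of s] s by (auto simp: dist_norm)
        then show ?thesis by (simp add: algebra_simps abs_le_iff)
      qed
      finally show ?thesis by (simp add: algebra_simps)
    qed
    then show ?thesis using False d1 d2 by (intro exI[of _ "min d1 d2"]) auto
  qed
  then obtain d where d: "\<And>t. t \<in> {a..b} \<Longrightarrow> d t > 0"
    "\<And>t. t \<in> {a..b} \<Longrightarrow> t \<in> N \<Longrightarrow> ball t (d t) \<subseteq> U"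
    "\<And>t s s'. t \<in> {a..b} \<Longrightarrow> t \<notin> N \<Longrightarrow> a \<le> s \<Longrightarrow> s \<le> t \<Longrightarrow> t \<le> s' \<Longrightarrow> s' \<le> b \<Longrightarrow>
      s \<in> ball t (d t) \<Longrightarrow> s' \<in> ball t (d t) \<Longrightarrow>
      norm (\<sigma> s' - \<sigma> s) \<le> G s' - G s + 2 * e * (s' - s)"
    by metis
  \<comment> \<open>The radius \<open>1\<close> off \<open>{a..b}\<close> is a dummy, because all
    tags lie in the interval.\<close>
  define \<gamma> where "\<gamma> t = ball t (if t \<in> {a..b} then d t else 1)" for t
  have "gauge \<gamma>" unfolding gauge_def \<gamma>_def using d(1) by auto
  then obtain p where p: "p tagged_division_of {a..b}" "\<gamma> fine p"
    by (rule fine_division_exists_real)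
  have fin: "finite p" using p(1) by (rule tagged_division_of_finite)
  have mem: "Inf k \<le> x \<and> x \<le> Sup k \<and> a \<le> Inf k \<and> Sup k \<le> b \<and> k = {Inf k..Sup k} \<and>
      k \<subseteq> ball x (d x) \<and> x \<in> {a..b}" if xk: "(x, k) \<in> p" for x k
  proof -
    obtain u w where k: "k = {u..w}" using tagged_division_ofD(4)[OF p(1) xk] by auto
    have x: "x \<in> k" "k \<subseteq> {a..b}" using tagged_division_ofD(2,3)[OF p(1) that] by auto
    have "k \<subseteq> \<gamma> x" using p(2) that by (auto simp: fine_def)
    then show ?thesis using k x by (auto simp: \<gamma>_def split: if_splits)
  qed
  define q where "q = {xk \<in> p. fst xk \<in> N}"
  define L where "L xk = norm (\<sigma> (Sup (snd xk)) - \<sigma> (Inf (snd xk)))" for xk :: "real \<times> real set"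
  have tele: "(\<Sum>xk\<in>p. f (Sup (snd xk)) - f (Inf (snd xk))) = f b - f a"
    for f :: "real \<Rightarrow> 'b::real_normed_vector"
    using additive_tagged_division_1[OF \<open>a \<le> b\<close> p(1), of f] by (simp add: case_prod_unfold)
  have "(\<Sum>xk\<in>q. L xk) \<le> e"
  proof -
    have "finite q" using fin by (simp add: q_def)
    \<comment> \<open>An enumeration is needed because \<open>abs_continuous_on\<close> speaks of
      families indexed by \<open>{..<N}\<close>.\<close>
    then obtain h where h: "bij_betw h {..<card q} q"
      using ex_bij_betw_nat_finite[of q] by (auto simp: atLeast0LessThan)
    define l r where "l i = Inf (snd (h i))" and "r i = Sup (snd (h i))" for i
    have hq: "h i \<in> p" "fst (h i) \<in> N" if "i < card q" for i
      using bij_betwE[OF h] that by (auto simp: q_def)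
    have lr: "l i \<in> {a..b} \<and> r i \<in> {a..b} \<and> l i \<le> r i \<and> {l i..r i} \<subseteq> U \<and> snd (h i) = {l i..r i}"
      if "i < card q" for i
    proof -
      have "(fst (h i), snd (h i)) \<in> p" using hq that by simp
      from mem[OF this] show ?thesis
        using d(2)[of "fst (h i)"] hq[OF that] unfolding l_def r_def by auto
    qed
    have disj: "disjoint_family_on (\<lambda>i. {l i<..<r i}) {..<card q}"
      unfolding disjoint_family_on_def
    proof (intro ballI impI)
      fix i j assume ij: "i \<in> {..<card q}" "j \<in> {..<card q}" "i \<noteq> j"
      then have "h i \<noteq> h j" using h by (auto simp: bij_betw_def inj_on_def)
      moreover have "(fst (h i), snd (h i)) \<in> p" "(fst (h j), snd (h j)) \<in> p" using hq ij by auto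
      ultimately have "interior (snd (h i)) \<inter> interior (snd (h j)) = {}"
        using tagged_division_ofD(5)[OF p(1), of "fst (h i)" "snd (h i)" "fst (h j)" "snd (h j)"]
        by (metis prod.collapse)
      then show "{l i<..<r i} \<inter> {l j<..<r j} = {}"
        using lr ij by (simp add: interior_atLeastAtMost_real)
    qed
    have "ennreal (\<Sum>i<card q. r i - l i) = (\<Sum>i<card q. emeasure lborel {l i<..<r i})"
      using lr by (subst sum_ennreal[symmetric]) (auto intro!: sum.cong)
    also have "\<dots> = emeasure lborel (\<Union>i<card q. {l i<..<r i})"
      by (intro sum_emeasure disj) auto
    also have "\<dots> \<le> emeasure lborel U"
      using lr U by (intro emeasure_mono) force+
    also have "\<dots> < ennreal \<delta>" by (rule U_less)
    finally have "(\<Sum>i<card q. r i - l i) < \<delta>"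
      by (metis ennreal_leI not_le)
    then have "(\<Sum>i<card q. dist (\<sigma> (l i)) (\<sigma> (r i))) < e"
      using lr disj by (intro \<delta>) auto
    also have "(\<Sum>i<card q. dist (\<sigma> (l i)) (\<sigma> (r i))) = (\<Sum>xk\<in>q. L xk)"
      unfolding sum.reindex_bij_betw[OF h, of L, symmetric]
      by (simp add: L_def l_def r_def dist_norm norm_minus_commute)
    finally show ?thesis by simp
  qed
  moreover have "(\<Sum>xk\<in>p - q. L xk) \<le> (\<Sum>xk\<in>p - q. G (Sup (snd xk)) - G (Inf (snd xk)) + 2 * e * (Sup (snd xk) - Inf (snd xk)))"
  proof (rule sum_mono)
    fix xk assume xk: "xk \<in> p - q"
    then have "(fst xk, snd xk) \<in> p" by simp
    note m = mem[OF this]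
    have "u \<in> {u..w}" "w \<in> {u..w}" if "u \<le> w" for u w :: real using that by auto
    then have "Inf (snd xk) \<in> snd xk" "Sup (snd xk) \<in> snd xk" using m by (metis order_trans)+
    then show "L xk \<le> G (Sup (snd xk)) - G (Inf (snd xk)) + 2 * e * (Sup (snd xk) - Inf (snd xk))"
      unfolding L_def using m xk by (intro d(3)[of "fst xk"]) (auto simp: q_def)
  qed
  \<comment> \<open>The terms belonging to \<open>q\<close> may be added since \<open>G\<close> is
    non-decreasing; the full sum then telescopes.\<close>
  moreover have "\<dots> \<le> (\<Sum>xk\<in>p. G (Sup (snd xk)) - G (Inf (snd xk)) + 2 * e * (Sup (snd xk) - Inf (snd xk)))"
  proof (rule sum_mono2[OF fin])
    fix xk assume "xk \<in> p - (p - q)"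
    then have "(fst xk, snd xk) \<in> p" by simp
    from mem[OF this] have "Inf (snd xk) \<le> Sup (snd xk)" by linarith
    then show "0 \<le> G (Sup (snd xk)) - G (Inf (snd xk)) + 2 * e * (Sup (snd xk) - Inf (snd xk))"
      using G_mono e(1) by (intro add_nonneg_nonneg) auto
  qed auto
  moreover have "\<dots> = G b - G a + 2 * e * (b - a)"
    using tele[of G] tele[of "\<lambda>x. x"]
    by (simp add: sum.distrib sum_distrib_left[symmetric])
  moreover have "(\<Sum>xk\<in>p. L xk) = (\<Sum>xk\<in>p - q. L xk) + (\<Sum>xk\<in>q. L xk)"
    using fin by (intro sum.subset_diff) (auto simp: q_def)
  moreover have "norm (\<sigma> b - \<sigma> a) \<le> (\<Sum>xk\<in>p. L xk)"
    unfolding tele[of \<sigma>, symmetric] L_def by (rule norm_sum)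
  moreover have "2 * e * (b - a) + e = e'" using e(2) by (simp add: algebra_simps)
  ultimately show "norm (\<sigma> b - \<sigma> a) \<le> G b - G a + e'" by linarith
qed

section \<open>A derivative bound for analytic discs\<close>

text \<open>\<open>v\<close> is touched from below at each interior point by the modulus of a
  holomorphic function. Among the points where \<open>v\<close> is maximal, one of largest modulus
  is taken. If it were interior, its support function would be locally constant by the maximum
  modulus principle, and maximality would spread to points of larger modulus.\<close>

lemma maximum_principle_holomorphic_support:
  fixes v :: "complex \<Rightarrow> real"
  assumes "0 < r" and cont: "continuous_on (cball 0 r) v"
    and supp: "\<And>\<zeta>. \<zeta> \<in> ball 0 r \<Longrightarrow> \<exists>g e. 0 < e \<and> g holomorphic_on ball \<zeta> e \<and>
      (\<forall>\<xi>\<in>ball \<zeta> e. cmod (g \<xi>) \<le> v \<xi>) \<and> cmod (g \<zeta>) = v \<zeta>"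
  obtains \<zeta> where "cmod \<zeta> = r" "v 0 \<le> v \<zeta>"
proof -
  have "cball 0 r \<noteq> ({}::complex set)" using \<open>0 < r\<close> by simp
  then obtain m where m: "m \<in> cball 0 r" "\<And>\<zeta>. \<zeta> \<in> cball 0 r \<Longrightarrow> v \<zeta> \<le> v m"
    using continuous_attains_sup[OF compact_cball _ cont] by blast
  define S where "S = {\<zeta> \<in> cball 0 r. v \<zeta> = v m}"
  have "closed S" unfolding S_def
    using continuous_closed_preimage_constant[OF cont closed_cball] .
  moreover have "bounded S" by (rule bounded_subset[OF bounded_cball[of 0 r]]) (auto simp: S_def)
  ultimately have "compact S" by (simp add: compact_eq_bounded_closed)
  moreover have "S \<noteq> {}" using m by (auto simp: S_def)
  moreover have "continuous_on S cmod" by (intro continuous_intros)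
  ultimately obtain s where s: "s \<in> S" "\<And>\<zeta>. \<zeta> \<in> S \<Longrightarrow> cmod \<zeta> \<le> cmod s"
    using continuous_attains_sup[of S cmod] by blast
  have "cmod s = r"
  proof (rule ccontr)
    assume "cmod s \<noteq> r"
    then have s_in: "s \<in> ball 0 r" using s(1) by (auto simp: S_def)
    obtain g e where g: "0 < e" "g holomorphic_on ball s e" "\<And>\<xi>. \<xi> \<in> ball s e \<Longrightarrow> cmod (g \<xi>) \<le> v \<xi>"
      "cmod (g s) = v s"
      using supp[OF s_in] by blast
    define d where "d = min e (r - cmod s)"
    have d: "0 < d" "d \<le> e" "d \<le> r - cmod s" using g s_in by (auto simp: d_def)
    have in_ball: "\<xi> \<in> cball 0 r" "\<xi> \<in> ball s e" if "\<xi> \<in> ball s d" for \<xi>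
    proof -
      have "cmod \<xi> \<le> cmod s + dist s \<xi>" by (metis dist_0_norm dist_triangle)
      then show "\<xi> \<in> cball 0 r" "\<xi> \<in> ball s e" using that d by auto
    qed
    have "g constant_on ball s d"
    proof (rule maximum_modulus_principle[where U = "ball s d"])
      show "g holomorphic_on ball s d"
        using g(2) by (rule holomorphic_on_subset) (use d in auto)
      fix \<xi> assume "\<xi> \<in> ball s d"
      then have "cmod (g \<xi>) \<le> v m" using in_ball g m order_trans by meson
      then show "cmod (g \<xi>) \<le> cmod (g s)" using g(4) s(1) by (simp add: S_def)
    qed (use d in auto)
    then have const: "g \<xi> = g s" if "\<xi> \<in> ball s d" for \<xi>
      using that d(1) unfolding constant_on_def by (metis centre_in_ball)
    \<comment> \<open>A step outwards along the ray through \<open>s\<close>; at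
      \<open>s = 0\<close> any direction increases the modulus.\<close>
    define \<xi> where "\<xi> = s + of_real (d / 2) * (if s = 0 then 1 else sgn s)"
    have "dist s \<xi> = d / 2" using d by (auto simp: \<xi>_def dist_norm norm_mult norm_sgn)
    then have \<xi>: "\<xi> \<in> ball s d" using d by simp
    have "\<xi> = of_real (cmod s + d / 2) * (if s = 0 then 1 else sgn s)"
      by (simp add: \<xi>_def algebra_simps sgn_eq)
    then have "cmod \<xi> = cmod s + d / 2"
      using d by (simp only: norm_mult norm_of_real) (simp add: norm_sgn)
    moreover have "\<xi> \<in> S"
      using in_ball[OF \<xi>] m g(3)[of \<xi>] const[OF \<xi>] g(4) s(1) by (force simp: S_def)
    ultimately show False using s(2)[of \<xi>] d by simp
  qed
  moreover have "v 0 \<le> v s" using m(2)[of 0] s(1) \<open>0 < r\<close> by (simp add: S_def)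
  ultimately show thesis using that by blast
qed

text \<open>The Levi form enters only through a lower support by the real part of a holomorphic quadratic
  polynomial: it composes with analytic discs without differentiating, so the maximum modulus
  principle can stand in for the theory of subharmonic functions.\<close>

definition strictly_psh_at :: "real \<Rightarrow> (complex^'n \<Rightarrow> real) \<Rightarrow> complex^'n \<Rightarrow> bool" where
  "strictly_psh_at c u w \<longleftrightarrow> (\<exists>L C e. 0 < e \<and> (\<forall>\<eta>. norm \<eta> < e \<longrightarrow>
     u w + Re ((\<Sum>j\<in>UNIV. L j * \<eta> $ j) + (\<Sum>j\<in>UNIV. \<Sum>k\<in>UNIV. C j k * \<eta> $ j * \<eta> $ k))
       + c * (norm \<eta>)\<^sup>2 \<le> u (w + \<eta>)))"

lemma analytic_disc_continuous_on: "analytic_disc D f \<Longrightarrow> continuous_on (ball 0 1) f"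
  unfolding analytic_disc_def
  using continuous_on_vec_lambda[of "ball 0 1" "\<lambda>i \<zeta>. f \<zeta> $ i"]
  by (simp add: holomorphic_on_imp_continuous_on)

lemma inner_eq_Re_sum: "inner x y = Re (\<Sum>j\<in>UNIV. cnj (x $ j) * y $ j)" for x y :: "complex^'n"
  by (simp add: inner_vec_def inner_complex_def)

text \<open>Sibony's argument with the depth \<open>- u z\<close> as small parameter. The disc may
  leave the ball where \<open>u\<close> is under control; the bound \<open>M\<close> on distances
  from \<open>z\<close> keeps a quadratic estimate valid on all of \<open>D\<close>. The factor
  \<open>12\<close> is \<open>4\<close> from the circle of radius \<open>1/2\<close> times the bound
  \<open>3\<close> for \<open>exp 1\<close>.\<close>

lemma disc_derivative_bound:
  fixes u :: "complex^'n \<Rightarrow> real"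
  assumes "open D" "0 < R" "0 < c" "0 < M"
    and diam: "\<And>w. w \<in> D \<Longrightarrow> norm (w - z) \<le> M"
    and cont: "continuous_on (D \<inter> ball z R) u"
    and neg: "\<And>w. w \<in> D \<inter> ball z R \<Longrightarrow> u w < 0"
    and psh: "\<And>w. w \<in> D \<inter> ball z R \<Longrightarrow> strictly_psh_at c u w"
    and f: "analytic_disc D f" "f 0 = z"
  shows "(cmod (deriv (\<lambda>\<zeta>. f \<zeta> $ i) 0))\<^sup>2 \<le> 12 / min c (c * (R / 2)\<^sup>2 / M\<^sup>2) * (- u z)"
proof -
  \<comment> \<open>From distance \<open>R / 2\<close> on, the quadratic term alone pushes
    \<open>\<phi>\<close> down to \<open>- a\<close>, so that the maximum with \<open>- a\<close> is
    constant there and extends continuously.\<close>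
  define a where "a = c * (R / 2)\<^sup>2"
  \<comment> \<open>The first entry serves where \<open>\<Phi>\<close> equals \<open>\<phi>\<close>,
    the second where it equals \<open>- a\<close>.\<close>
  define c' where "c' = min c (a / M\<^sup>2)"
  have pos: "0 < a" "0 < c'" using assms(2-4) by (auto simp: a_def c'_def)
  have f_in: "f \<zeta> \<in> D" if "cmod \<zeta> < 1" for \<zeta> using f(1) that by (auto simp: analytic_disc_def)
  have "z \<in> D" using f_in[of 0] f(2) by simp
  define \<delta> where "\<delta> = - u z"
  have \<delta>: "0 < \<delta>" using neg[of z] \<open>z \<in> D\<close> \<open>0 < R\<close> by (simp add: \<delta>_def)
  \<comment> \<open>\<open>\<Phi>\<close> is a negative psh function on all of \<open>D\<close> with \<open>\<Phi> w \<le> - c' |w - z|\<^sup>2\<close> and \<open>\<Phi> z \<ge> u z\<close>;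
    gluing with the constant \<open>- a\<close> handles discs that leave the neighbourhood of \<open>z\<close>.\<close>
  define \<phi> where "\<phi> w = u w - c * (norm (w - z))\<^sup>2" for w
  define \<Phi> where "\<Phi> w = (if w \<in> ball z R then max (\<phi> w) (- a) else - a)" for w
  have \<phi>_far: "\<phi> w \<le> - a" if "w \<in> D \<inter> ball z R" "R / 2 \<le> norm (w - z)" for w
  proof -
    have "c * (R / 2)\<^sup>2 \<le> c * (norm (w - z))\<^sup>2"
      using that assms(2,3) by (intro mult_left_mono power_mono) auto
    then show ?thesis using neg[OF that(1)] by (simp add: \<phi>_def a_def)
  qed
  have "continuous_on (D \<inter> ball z R \<union> (D - cball z (R / 2))) \<Phi>"
  proof (rule continuous_on_open_Un)
    have "continuous_on (D \<inter> ball z R) (\<lambda>w. max (\<phi> w) (- a))"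
      unfolding \<phi>_def by (intro continuous_intros cont)
    then show "continuous_on (D \<inter> ball z R) \<Phi>"
      by (rule continuous_on_eq) (simp add: \<Phi>_def)
    have "\<Phi> w = - a" if "w \<in> D - cball z (R / 2)" for w
      using that \<phi>_far[of w] by (auto simp: \<Phi>_def dist_norm norm_minus_commute)
    then show "continuous_on (D - cball z (R / 2)) \<Phi>"
      using continuous_on_eq[OF continuous_on_const] by metis
  qed (use \<open>open D\<close> in auto)
  moreover have "D \<inter> ball z R \<union> (D - cball z (R / 2)) = D" using \<open>0 < R\<close> by auto
  ultimately have cont_\<Phi>: "continuous_on D \<Phi>" by simp
  have \<Phi>_ge: "- a \<le> \<Phi> w" "w \<in> ball z R \<Longrightarrow> \<phi> w \<le> \<Phi> w" for w by (auto simp: \<Phi>_def)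
  have \<Phi>_le: "\<Phi> w \<le> - c' * (norm (w - z))\<^sup>2" if "w \<in> D" for w
  proof -
    have "c' * (norm (w - z))\<^sup>2 \<le> a / M\<^sup>2 * M\<^sup>2"
      using diam[OF that] pos by (intro mult_mono power_mono) (auto simp: c'_def)
    then have 1: "- a \<le> - c' * (norm (w - z))\<^sup>2" using \<open>0 < M\<close> by simp
    have "c' * (norm (w - z))\<^sup>2 \<le> c * (norm (w - z))\<^sup>2"
      by (intro mult_right_mono) (auto simp: c'_def)
    then have "\<phi> w \<le> - c' * (norm (w - z))\<^sup>2" if "w \<in> ball z R"
      using neg[of w] \<open>w \<in> D\<close> that by (simp add: \<phi>_def)
    with 1 show ?thesis by (auto simp: \<Phi>_def)
  qed
  \<comment> \<open>The difference quotient, holomorphic across \<open>0\<close>: it carries the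
    derivative at the centre and is at most \<open>2 * norm (f \<zeta> - z)\<close> on the circle of
    radius \<open>1/2\<close>.\<close>
  define h where "h \<zeta> = (if \<zeta> = 0 then deriv (\<lambda>\<zeta>. f \<zeta> $ i) 0 else (f \<zeta> $ i - f 0 $ i) / (\<zeta> - 0))" for \<zeta>
  have f_hol: "(\<lambda>\<zeta>. f \<zeta> $ j) holomorphic_on ball 0 1" for j using f(1) by (simp add: analytic_disc_def)
  have h: "h holomorphic_on ball 0 1"
    unfolding h_def using pole_lemma[OF f_hol, of 0 i] by simp
  \<comment> \<open>Sibony's device: \<open>ln v\<close> is subharmonic, and the factor \<open>exp\<close> beats \<open>h\<close> on the circle because
    \<open>x * exp (- c' x\<^sup>2 / (2\<delta>))\<close> is of order \<open>sqrt \<delta>\<close>.\<close>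
  define v where "v \<zeta> = cmod (h \<zeta>) * exp (\<Phi> (f \<zeta>) / (2 * \<delta>))" for \<zeta>
  have f_cont: "continuous_on (ball 0 1) f" using f(1) by (rule analytic_disc_continuous_on)
  have "continuous_on (ball 0 1) (\<lambda>\<zeta>. \<Phi> (f \<zeta>))"
    by (rule continuous_on_compose2[OF cont_\<Phi> f_cont]) (use f_in in auto)
  then have "continuous_on (ball 0 1) v"
    unfolding v_def using h \<delta> by (intro continuous_intros holomorphic_on_imp_continuous_on) auto
  then have v_cont: "continuous_on (cball 0 (1/2)) v"
    by (rule continuous_on_subset) auto
  obtain \<zeta> where \<zeta>: "cmod \<zeta> = 1/2" "v 0 \<le> v \<zeta>"
  proof (rule maximum_principle_holomorphic_support[OF _ v_cont])
    fix \<zeta>1 :: complex assume \<zeta>1: "\<zeta>1 \<in> ball 0 (1/2)"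
    have sub: "ball \<zeta>1 (1/2) \<subseteq> ball 0 1"
    proof
      fix \<xi> assume "\<xi> \<in> ball \<zeta>1 (1/2)"
      then show "\<xi> \<in> ball 0 1" using \<zeta>1 norm_triangle_ineq2[of \<xi> \<zeta>1]
        by (auto simp: dist_norm norm_minus_commute)
    qed
    define w1 where "w1 = f \<zeta>1"
    have w1: "w1 \<in> D" using f_in[of \<zeta>1] \<zeta>1 by (simp add: w1_def)
    show "\<exists>g e. 0 < e \<and> g holomorphic_on ball \<zeta>1 e \<and>
      (\<forall>\<xi>\<in>ball \<zeta>1 e. cmod (g \<xi>) \<le> v \<xi>) \<and> cmod (g \<zeta>1) = v \<zeta>1"
    \<comment> \<open>Where \<open>\<Phi>\<close> takes its least value \<open>- a\<close>, a
      constant exponent supports it. Elsewhere \<open>\<Phi>\<close> equals \<open>\<phi>\<close>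
      and the quadratic polynomial of \<open>strictly_psh_at\<close> is available.\<close>
    proof (cases "\<Phi> w1 = - a")
      case True
      show ?thesis
      proof (intro exI conjI ballI)
        show "(\<lambda>\<zeta>. h \<zeta> * of_real (exp (- a / (2 * \<delta>)))) holomorphic_on ball \<zeta>1 (1/2)"
          by (intro holomorphic_intros holomorphic_on_subset[OF h sub])
        show "cmod (h \<xi> * of_real (exp (- a / (2 * \<delta>)))) \<le> v \<xi>" for \<xi>
          unfolding v_def norm_mult using \<Phi>_ge(1)[of "f \<xi>"] \<delta>
          by (intro mult_left_mono) (auto simp: field_simps)
        show "cmod (h \<zeta>1 * of_real (exp (- a / (2 * \<delta>)))) = v \<zeta>1"
          using True by (simp add: v_def norm_mult w1_def)
      qed auto
    next
      case False
      then have w1R: "w1 \<in> ball z R" and \<Phi>w1: "\<Phi> w1 = \<phi> w1"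
        by (auto simp: \<Phi>_def max_def split: if_splits)
      then have "strictly_psh_at c u w1" using psh w1 by blast
      then obtain L C e where e: "0 < e" and LC: "\<And>\<eta>. norm \<eta> < e \<Longrightarrow> u w1 +
         Re ((\<Sum>j\<in>UNIV. L j * \<eta> $ j) + (\<Sum>j\<in>UNIV. \<Sum>k\<in>UNIV. C j k * \<eta> $ j * \<eta> $ k))
           + c * (norm \<eta>)\<^sup>2 \<le> u (w1 + \<eta>)"
        unfolding strictly_psh_at_def by blast
      \<comment> \<open>A holomorphic polynomial whose real part supports \<open>\<phi>\<close> at
        \<open>w1\<close>. The strictness term \<open>c * (norm \<eta>)\<^sup>2\<close> cancels the
        quadratic part of the subtracted square, whose mixed term is the real part of a complex
        linear form.\<close>
      define H where "H \<eta> = of_real (\<phi> w1) + ((\<Sum>j\<in>UNIV. L j * \<eta> $ j)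
          + (\<Sum>j\<in>UNIV. \<Sum>k\<in>UNIV. C j k * \<eta> $ j * \<eta> $ k))
          - 2 * of_real c * (\<Sum>j\<in>UNIV. cnj ((w1 - z) $ j) * \<eta> $ j)" for \<eta> :: "complex^'n"
      have H_le: "Re (H \<eta>) \<le> \<phi> (w1 + \<eta>)" if "norm \<eta> < e" for \<eta>
      proof -
        have "(norm (w1 + \<eta> - z))\<^sup>2 = (norm (w1 - z))\<^sup>2 + 2 * inner (w1 - z) \<eta> + (norm \<eta>)\<^sup>2"
          unfolding power2_norm_eq_inner by (simp add: algebra_simps inner_commute)
        then have "\<phi> (w1 + \<eta>) = u (w1 + \<eta>)
            - (c * (norm (w1 - z))\<^sup>2 + 2 * c * inner (w1 - z) \<eta> + c * (norm \<eta>)\<^sup>2)"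
          unfolding \<phi>_def by (simp add: distrib_left)
        moreover have "Re (H \<eta>) = u w1 - c * (norm (w1 - z))\<^sup>2
            + Re ((\<Sum>j\<in>UNIV. L j * \<eta> $ j) + (\<Sum>j\<in>UNIV. \<Sum>k\<in>UNIV. C j k * \<eta> $ j * \<eta> $ k))
            - 2 * c * inner (w1 - z) \<eta>"
          unfolding H_def inner_eq_Re_sum by (simp add: \<phi>_def)
        ultimately show ?thesis using LC[OF that] by linarith
      qed
      have "isCont f \<zeta>1"
        using f_cont \<zeta>1 by (simp add: continuous_on_eq_continuous_at)
      moreover have "open (ball w1 e \<inter> ball z R)" "f \<zeta>1 \<in> ball w1 e \<inter> ball z R"
        using w1R e by (auto simp: w1_def)
      ultimately have "\<forall>\<^sub>F \<xi> in nhds \<zeta>1. f \<xi> \<in> ball w1 e \<inter> ball z R"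
        by (auto simp: continuous_within tendsto_def eventually_nhds_conv_at simp del: mem_ball)
      then obtain d where d: "d > 0" "\<And>\<xi>. dist \<xi> \<zeta>1 < d \<Longrightarrow> f \<xi> \<in> ball w1 e \<inter> ball z R"
        unfolding eventually_nhds_metric by blast
      show ?thesis
      proof (intro exI conjI ballI)
        show "0 < min d (1/2)" using d by simp
        have "(\<lambda>\<xi>. f \<xi> $ j) holomorphic_on ball \<zeta>1 (min d (1/2))" for j
          by (rule holomorphic_on_subset[OF f_hol]) (use sub in auto)
        then show "(\<lambda>\<xi>. h \<xi> * exp (H (f \<xi> - w1) / of_real (2 * \<delta>))) holomorphic_on ball \<zeta>1 (min d (1/2))"
          unfolding H_def vector_minus_component using \<delta> sub
          by (intro holomorphic_intros holomorphic_on_subset[OF h]) auto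
        have nrm: "cmod (h \<xi> * exp (H (f \<xi> - w1) / of_real (2 * \<delta>)))
            = cmod (h \<xi>) * exp (Re (H (f \<xi> - w1)) / (2 * \<delta>))" for \<xi>
          by (simp only: norm_mult norm_exp_eq_Re Re_divide_of_real)
        show "cmod (h \<zeta>1 * exp (H (f \<zeta>1 - w1) / of_real (2 * \<delta>))) = v \<zeta>1"
          unfolding nrm by (simp add: v_def \<Phi>w1 w1_def[symmetric]) (simp add: H_def)
        fix \<xi> assume "\<xi> \<in> ball \<zeta>1 (min d (1/2))"
        then have "f \<xi> \<in> ball w1 e \<inter> ball z R" using d(2)[of \<xi>] by (simp add: dist_commute)
        then have "Re (H (f \<xi> - w1)) \<le> \<Phi> (f \<xi>)"
          using H_le[of "f \<xi> - w1"] \<Phi>_ge(2)[of "f \<xi>"] by (simp add: dist_norm norm_minus_commute)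
        then show "cmod (h \<xi> * exp (H (f \<xi> - w1) / of_real (2 * \<delta>))) \<le> v \<xi>"
          unfolding nrm v_def using \<delta> by (intro mult_left_mono) (auto simp: divide_right_mono)
      qed
    qed
  qed auto
  define x where "x = norm (f \<zeta> - z)"
  \<comment> \<open>In terms of \<open>y\<close> the bound is \<open>4 * \<delta> / c'\<close> times
    \<open>y * exp (- y)\<close>, so the distance travelled by the disc drops out.\<close>
  define y where "y = c' * x\<^sup>2 / \<delta>"
  have y0: "0 \<le> y" using pos \<delta> by (simp add: y_def)
  have \<zeta>_in: "f \<zeta> \<in> D" and "\<zeta> \<noteq> 0" using f_in[of \<zeta>] \<zeta>(1) by auto
  have "cmod (h \<zeta>) = cmod ((f \<zeta> - z) $ i) * 2"
    using \<open>\<zeta> \<noteq> 0\<close> by (simp add: h_def norm_divide \<zeta>(1) f(2))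
  also have "\<dots> \<le> 2 * x" using Finite_Cartesian_Product.norm_nth_le[of "f \<zeta> - z" i] by (simp add: x_def)
  finally have "v \<zeta> \<le> 2 * x * exp (\<Phi> (f \<zeta>) / (2 * \<delta>))"
    unfolding v_def by (intro mult_right_mono) auto
  also have "\<dots> \<le> 2 * x * exp (- c' * x\<^sup>2 / (2 * \<delta>))"
    using \<Phi>_le[OF \<zeta>_in] \<delta> by (intro mult_left_mono) (auto simp: x_def field_simps)
  finally have "(v \<zeta>)\<^sup>2 \<le> (2 * x * exp (- c' * x\<^sup>2 / (2 * \<delta>)))\<^sup>2"
    by (intro power_mono) (auto simp: v_def)
  also have "\<dots> = 4 * x\<^sup>2 * exp (- y)"
    using \<delta> by (simp add: power_mult_distrib exp_double[symmetric] y_def)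
  also have "\<dots> \<le> 4 * \<delta> / c'"
  proof -
    have "y * exp (- y) \<le> 1"
      using exp_ge_add_one_self[of y] y0 by (simp add: exp_minus field_simps del: exp_ge_add_one_self)
    then have "(4 * \<delta> / c') * (y * exp (- y)) \<le> 4 * \<delta> / c' * 1"
      using pos \<delta> by (intro mult_left_mono) auto
    then show ?thesis using pos \<delta> by (simp add: y_def field_simps)
  qed
  finally have v\<zeta>: "(v \<zeta>)\<^sup>2 \<le> 4 * \<delta> / c'" .
  have "- \<delta> \<le> \<Phi> z" using \<Phi>_ge(2)[of z] \<open>0 < R\<close> by (simp add: \<phi>_def \<delta>_def)
  then have "- 1 / 2 \<le> \<Phi> z / (2 * \<delta>)" using \<delta> by (simp add: field_simps)
  then have "cmod (h 0) * exp (- 1 / 2) \<le> v 0"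
    unfolding v_def f(2) by (intro mult_left_mono) auto
  then have "(cmod (h 0) * exp (- 1 / 2))\<^sup>2 \<le> (v \<zeta>)\<^sup>2"
    using \<zeta>(2) by (intro power_mono) auto
  also note v\<zeta>
  also have "(cmod (h 0) * exp (- 1 / 2))\<^sup>2 = (cmod (h 0))\<^sup>2 * exp (- 1)"
    by (simp add: power_mult_distrib exp_double[symmetric])
  finally have "(cmod (h 0))\<^sup>2 \<le> exp 1 * (4 * \<delta> / c')"
    by (simp add: exp_minus field_simps)
  also have "\<dots> \<le> 3 * (4 * \<delta> / c')"
    using pos \<delta> exp_le by (intro mult_right_mono) auto
  finally show ?thesis by (simp add: h_def \<delta>_def c'_def a_def)
qed

section \<open>The Levi form and strict plurisubharmonicity\<close>

lemma imaginary_unit_smult [simp]: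
  "\<i> *s (x + y) = \<i> *s x + \<i> *s (y :: complex^'n)"
  "\<i> *s (r *\<^sub>R x) = r *\<^sub>R (\<i> *s (x :: complex^'n))"
  "\<i> *s (\<i> *s x) = - (x :: complex^'n)"
  by (simp_all add: vec_eq_iff algebra_simps scaleR_conv_of_real[where 'a = complex])

text \<open>Complex linearity is given as real linearity plus compatibility with
  \<open>\<i>\<close>, because the forms in question are built from real derivatives.\<close>

lemma complex_linear_expand:
  fixes S :: "complex^'n \<Rightarrow> complex"
  assumes "linear S" and i: "\<And>x. S (\<i> *s x) = \<i> * S x"
  shows "S x = (\<Sum>j\<in>UNIV. x $ j * S (axis j 1))"
proof -
  interpret linear S by fact
  have cs: "c *s y = Re c *\<^sub>R y + Im c *\<^sub>R (\<i> *s y)" for c and y :: "complex^'n"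
    by (simp add: vec_eq_iff complex_eq_iff)
  have "S (c *s y) = c * S y" for c y
    unfolding arg_cong[OF cs, of S] by (simp add: add scaleR i complex_eq_iff)
  then have "(\<Sum>j\<in>UNIV. x $ j * S (axis j 1)) = S (\<Sum>j\<in>UNIV. x $ j *s axis j 1)"
    by (simp add: sum)
  then show ?thesis by (simp add: basis_expansion)
qed

lemma complex_bilinear_expand:
  fixes C :: "complex^'n \<Rightarrow> complex^'n \<Rightarrow> complex"
  assumes "\<And>y. linear (\<lambda>x. C x y)" "\<And>x. linear (C x)"
    and "\<And>x y. C (\<i> *s x) y = \<i> * C x y" "\<And>x y. C x (\<i> *s y) = \<i> * C x y"
  shows "C x y = (\<Sum>j\<in>UNIV. \<Sum>k\<in>UNIV. C (axis j 1) (axis k 1) * x $ j * y $ k)"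
proof -
  have "C x y = (\<Sum>j\<in>UNIV. x $ j * C (axis j 1) y)"
    using complex_linear_expand[of "\<lambda>x. C x y" x] assms by simp
  also have "\<dots> = (\<Sum>j\<in>UNIV. x $ j * (\<Sum>k\<in>UNIV. y $ k * C (axis j 1) (axis k 1)))"
    using complex_linear_expand[of "C (axis _ 1)" y] assms by simp
  finally show ?thesis by (simp add: sum_distrib_left mult_ac)
qed

lemma complex_sesquilinear_expand:
  fixes C :: "complex^'n \<Rightarrow> complex^'n \<Rightarrow> complex"
  assumes "\<And>y. linear (\<lambda>x. C x y)" "\<And>x. linear (C x)"
    and "\<And>x y. C (\<i> *s x) y = \<i> * C x y" "\<And>x y. C x (\<i> *s y) = - \<i> * C x y"
  shows "C x y = (\<Sum>j\<in>UNIV. \<Sum>k\<in>UNIV. C (axis j 1) (axis k 1) * x $ j * cnj (y $ k))"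
proof -
  have cl: "linear (\<lambda>y. cnj (C x y))" for x
    using linear_compose[OF assms(2)[of x], of cnj] bounded_linear_cnj
    by (simp add: o_def bounded_linear.linear)
  have "C x y = (\<Sum>j\<in>UNIV. x $ j * C (axis j 1) y)"
    using complex_linear_expand[of "\<lambda>x. C x y" x] assms by simp
  also have "\<dots> = (\<Sum>j\<in>UNIV. x $ j * (\<Sum>k\<in>UNIV. cnj (y $ k) * C (axis j 1) (axis k 1)))"
  proof (rule sum.cong[OF refl], rule arg_cong2[where f = "(*)", OF refl])
    fix j
    have "cnj (C (axis j 1) y) = (\<Sum>k\<in>UNIV. y $ k * cnj (C (axis j 1) (axis k 1)))"
      using complex_linear_expand[OF cl, of "axis j 1" y] assms(4) by simp
    then have "cnj (cnj (C (axis j 1) y)) = cnj (\<Sum>k\<in>UNIV. y $ k * cnj (C (axis j 1) (axis k 1)))"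
      by (rule arg_cong)
    then show "C (axis j 1) y = (\<Sum>k\<in>UNIV. cnj (y $ k) * C (axis j 1) (axis k 1))"
      by simp
  qed
  finally show ?thesis by (simp add: sum_distrib_left mult_ac)
qed

text \<open>This is the complex linear form with real part \<open>l\<close>, that is, twice the part
  of type (1,0) of \<open>l\<close>. It turns real differentials into real parts of holomorphic
  linear terms.\<close>

lemma linear_blinfun_form:
  fixes l :: "(complex^'n) \<Rightarrow>\<^sub>L real"
  shows "linear (\<lambda>x. complex_of_real (l x) - \<i> * complex_of_real (l (\<i> *s x)))"
  by (rule linearI) (simp_all add: blinfun.bilinear_simps algebra_simps scaleR_conv_of_real[where 'a = complex])

lemma complex_linear_blinfun_form:
  fixes l :: "(complex^'n) \<Rightarrow>\<^sub>L real"
  defines "S \<equiv> \<lambda>x. complex_of_real (l x) - \<i> * complex_of_real (l (\<i> *s x))"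
  shows "S x = (\<Sum>j\<in>UNIV. x $ j * S (axis j 1))"
  unfolding S_def
  by (rule complex_linear_expand[OF linear_blinfun_form])
    (simp add: blinfun.bilinear_simps algebra_simps)

lemma axis_imaginary_unit: "axis j \<i> = \<i> *s (axis j 1 :: complex^'n)"
  by (simp add: vec_eq_iff axis_def)

section \<open>The complex Hessian of a fixed function of class C^2\<close>

context
  fixes U :: "(complex^'n) set" and \<rho> :: "complex^'n \<Rightarrow> real"
    and \<rho>' :: "complex^'n \<Rightarrow> (complex^'n) \<Rightarrow>\<^sub>L real"
    and \<rho>'' :: "complex^'n \<Rightarrow> (complex^'n) \<Rightarrow>\<^sub>L (complex^'n) \<Rightarrow>\<^sub>L real"
  assumes U: "open U"
    and der: "\<And>x. x \<in> U \<Longrightarrow> (\<rho> has_derivative blinfun_apply (\<rho>' x)) (at x)"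
    and der2: "\<And>x. x \<in> U \<Longrightarrow> (\<rho>' has_derivative blinfun_apply (\<rho>'' x)) (at x)"
    and cont2: "continuous_on U \<rho>''"
begin

lemma frechet_derivative_of_real_comp:
  assumes "x \<in> U"
  shows "frechet_derivative (\<lambda>z. complex_of_real (\<rho> z)) (at x) = (\<lambda>h. complex_of_real (\<rho>' x h))"
  using has_derivative_of_real[OF der[OF assms]] by (rule frechet_derivative_at[symmetric])

lemma wirtinger_bar_eq:
  assumes "x \<in> U"
  shows "wirtinger_bar k (\<lambda>z. complex_of_real (\<rho> z)) x =
    (complex_of_real (\<rho>' x (axis k 1)) + \<i> * complex_of_real (\<rho>' x (\<i> *s axis k 1))) / 2"
  by (simp add: wirtinger_bar_def frechet_derivative_of_real_comp[OF assms] axis_imaginary_unit)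

text \<open>The Wirtinger sum is half the complex linear form with real part
  \<open>\<rho>' p\<close>, so its kernel is the largest complex subspace of the kernel of
  \<open>\<rho>' p\<close>.\<close>

lemma complex_tangent_space_iff:
  assumes "p \<in> U"
  shows "v \<in> complex_tangent_space \<rho> p \<longleftrightarrow> \<rho>' p v = 0 \<and> \<rho>' p (\<i> *s v) = 0"
proof -
  let ?S = "\<lambda>x. complex_of_real (\<rho>' p x) - \<i> * complex_of_real (\<rho>' p (\<i> *s x))"
  have "(\<Sum>j\<in>UNIV. wirtinger j (\<lambda>z. complex_of_real (\<rho> z)) p * v $ j)
      = (\<Sum>j\<in>UNIV. v $ j * ?S (axis j 1)) / 2"
    by (simp add: wirtinger_def frechet_derivative_of_real_comp[OF assms] axis_imaginary_unit
        sum_divide_distrib mult.commute)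
  also have "\<dots> = ?S v / 2"
    using complex_linear_blinfun_form[of "\<rho>' p" v] by simp
  finally have "(\<Sum>j\<in>UNIV. wirtinger j (\<lambda>z. complex_of_real (\<rho> z)) p * v $ j) = ?S v / 2" .
  then have "(\<Sum>j\<in>UNIV. wirtinger j (\<lambda>z. complex_of_real (\<rho> z)) p * v $ j) = 0 \<longleftrightarrow> ?S v = 0"
    by (simp only: divide_eq_0_iff) simp
  also have "?S v = 0 \<longleftrightarrow> \<rho>' p v = 0 \<and> \<rho>' p (\<i> *s v) = 0" by (simp add: complex_eq_iff)
  finally show ?thesis
    unfolding complex_tangent_space_def mem_Collect_eq .
qed

text \<open>The mixed Wirtinger derivatives are a quarter of the matrix of the sesquilinear form
  \<open>T\<close>. On the diagonal its real part is the Hessian summed over \<open>v\<close> and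
  \<open>\<i> *s v\<close>, an expression that fits the Taylor expansion.\<close>

lemma levi_form_eq:
  assumes p: "p \<in> U"
  shows "levi_form \<rho> p v = (\<rho>'' p v v + \<rho>'' p (\<i> *s v) (\<i> *s v)) / 4"
proof -
  define T where "T x y = complex_of_real (\<rho>'' p x y) + \<i> * complex_of_real (\<rho>'' p x (\<i> *s y))
      - \<i> * complex_of_real (\<rho>'' p (\<i> *s x) y) + complex_of_real (\<rho>'' p (\<i> *s x) (\<i> *s y))" for x y
  have W: "wirtinger j (wirtinger_bar k (\<lambda>z. complex_of_real (\<rho> z))) p = T (axis j 1) (axis k 1) / 4" for j k
  proof -
    let ?D = "\<lambda>h. (complex_of_real (\<rho>'' p h (axis k 1)) + \<i> * complex_of_real (\<rho>'' p h (\<i> *s axis k 1))) / 2"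
    have "((\<lambda>x. (complex_of_real (\<rho>' x (axis k 1)) + \<i> * complex_of_real (\<rho>' x (\<i> *s axis k 1))) / 2)
        has_derivative ?D) (at p)"
      by (auto intro!: derivative_eq_intros der2[OF p] simp: blinfun.bilinear_simps)
    then have "(wirtinger_bar k (\<lambda>z. complex_of_real (\<rho> z)) has_derivative ?D) (at p)"
      by (rule has_derivative_transform_within_open[OF _ U p]) (simp add: wirtinger_bar_eq)
    then have "frechet_derivative (wirtinger_bar k (\<lambda>z. complex_of_real (\<rho> z))) (at p) = ?D"
      by (rule frechet_derivative_at[symmetric])
    then show ?thesis
      by (simp add: wirtinger_def axis_imaginary_unit T_def field_simps)
  qed
  have "levi_form \<rho> p v = Re (\<Sum>j\<in>UNIV. \<Sum>k\<in>UNIV. T (axis j 1) (axis k 1) / 4 * v $ j * cnj (v $ k))"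
    by (simp only: levi_form_def W)
  also have "\<dots> = Re ((\<Sum>j\<in>UNIV. \<Sum>k\<in>UNIV. T (axis j 1) (axis k 1) * v $ j * cnj (v $ k)) / 4)"
    by (simp only: sum_divide_distrib times_divide_eq_left)
  also have "\<dots> = Re (T v v) / 4"
    by (subst complex_sesquilinear_expand[of T v v, symmetric])
      (auto simp: T_def blinfun.bilinear_simps algebra_simps scaleR_conv_of_real[where 'a = complex] intro!: linearI)
  finally show ?thesis by (simp add: T_def)
qed

text \<open>Peano form of the remainder: the mean value theorem along the segment reduces the claim
  to the first-order expansion of \<open>\<rho>'\<close> at \<open>w\<close>.\<close>

lemma second_order_taylor:
  assumes w: "w \<in> U" and "0 < \<epsilon>"
  obtains d where "0 < d" "\<And>\<eta>. norm \<eta> < d \<Longrightarrow>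
    \<bar>\<rho> (w + \<eta>) - \<rho> w - \<rho>' w \<eta> - \<rho>'' w \<eta> \<eta> / 2\<bar> \<le> \<epsilon> * (norm \<eta>)\<^sup>2"
proof -
  obtain d1 where d1: "0 < d1" "ball w d1 \<subseteq> U" using U w open_contains_ball by blast
  have "(\<rho>' has_derivative blinfun_apply (\<rho>'' w)) (at w within UNIV)" using der2[OF w] by simp
  then obtain d2 where d2: "0 < d2" "\<And>y. norm (y - w) < d2 \<Longrightarrow>
      norm (\<rho>' y - \<rho>' w - \<rho>'' w (y - w)) \<le> \<epsilon> * norm (y - w)"
    using \<open>0 < \<epsilon>\<close> unfolding has_derivative_within_alt by (meson UNIV_I)
  have "\<bar>\<rho> (w + \<eta>) - \<rho> w - \<rho>' w \<eta> - \<rho>'' w \<eta> \<eta> / 2\<bar> \<le> \<epsilon> * (norm \<eta>)\<^sup>2"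
    if \<eta>: "norm \<eta> < min d1 d2" for \<eta>
  proof -
    define \<theta> where "\<theta> s = \<rho> (w + s *\<^sub>R \<eta>) - s * \<rho>' w \<eta> - s\<^sup>2 * \<rho>'' w \<eta> \<eta> / 2" for s
    have le: "norm (s *\<^sub>R \<eta>) \<le> norm \<eta>" if "0 \<le> s" "s \<le> 1" for s
      using that by (simp add: mult_left_le_one_le)
    have D: "(\<theta> has_real_derivative (\<rho>' (w + s *\<^sub>R \<eta>) \<eta> - \<rho>' w \<eta> - s * \<rho>'' w \<eta> \<eta>)) (at s)"
      if s: "0 \<le> s" "s \<le> 1" for s
    proof -
      have "w + s *\<^sub>R \<eta> \<in> U" using le[OF s] \<eta> d1 by (auto intro!: subsetD[OF d1(2)] simp: dist_norm)
      from der[OF this] have "((\<lambda>s. \<rho> (w + s *\<^sub>R \<eta>)) has_derivative (\<lambda>h. \<rho>' (w + s *\<^sub>R \<eta>) (h *\<^sub>R \<eta>))) (at s)"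
        by (rule has_derivative_compose[rotated]) (auto intro!: derivative_eq_intros)
      then have "((\<lambda>s. \<rho> (w + s *\<^sub>R \<eta>)) has_real_derivative \<rho>' (w + s *\<^sub>R \<eta>) \<eta>) (at s)"
        by (simp add: has_field_derivative_def blinfun.bilinear_simps mult_commute_abs)
      then show ?thesis
        unfolding \<theta>_def by (auto intro!: derivative_eq_intros)
    qed
    obtain s where s: "0 < s" "s < 1"
      "\<theta> 1 - \<theta> 0 = (1 - 0) * (\<rho>' (w + s *\<^sub>R \<eta>) \<eta> - \<rho>' w \<eta> - s * \<rho>'' w \<eta> \<eta>)"
      using MVT2[OF zero_less_one D] by blast
    have "\<rho>' (w + s *\<^sub>R \<eta>) \<eta> - \<rho>' w \<eta> - s * \<rho>'' w \<eta> \<eta>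
        = (\<rho>' (w + s *\<^sub>R \<eta>) - \<rho>' w - \<rho>'' w (s *\<^sub>R \<eta>)) \<eta>"
      by (simp add: blinfun.bilinear_simps)
    also have "\<bar>\<dots>\<bar> \<le> norm (\<rho>' (w + s *\<^sub>R \<eta>) - \<rho>' w - \<rho>'' w (s *\<^sub>R \<eta>)) * norm \<eta>"
      using norm_blinfun by (metis real_norm_def)
    also have "\<dots> \<le> (\<epsilon> * norm (s *\<^sub>R \<eta>)) * norm \<eta>"
      using d2(2)[of "w + s *\<^sub>R \<eta>"] le[of s] s \<eta> by (intro mult_right_mono) auto
    also have "\<dots> \<le> (\<epsilon> * norm \<eta>) * norm \<eta>"
      using le[of s] s \<open>0 < \<epsilon>\<close> by (intro mult_right_mono mult_left_mono) auto
    finally have "\<bar>\<theta> 1 - \<theta> 0\<bar> \<le> \<epsilon> * (norm \<eta>)\<^sup>2"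
      using s by (simp add: power2_eq_square mult.assoc)
    then show ?thesis by (simp add: \<theta>_def)
  qed
  then show thesis using that[of "min d1 d2"] d1 d2 by auto
qed

lemma C2_function_continuous: "continuous_on U \<rho>"
  using der has_derivative_continuous continuous_at_imp_continuous_on by blast

lemma C2_derivative_continuous: "continuous_on U \<rho>'"
  using der2 has_derivative_continuous continuous_at_imp_continuous_on by blast

text \<open>A real quadratic form is the sum of a part invariant under \<open>\<i>\<close> and the
  real part of a complex quadratic form. In the second-order expansion of
  \<open>\<rho> + K * \<rho>\<^sup>2\<close> the latter, with the linear term, goes into the
  holomorphic polynomial; the invariant part is what \<open>F\<close> bounds from below.\<close>

lemma strictly_psh_at_of_form:
  assumes w: "w \<in> U" and "0 < c" "0 \<le> K"
    and F: "\<And>\<eta>. 2 * c * (norm \<eta>)\<^sup>2 \<le> (1 + 2 * K * \<rho> w) * ((\<rho>'' w \<eta> \<eta> + \<rho>'' w (\<i> *s \<eta>) (\<i> *s \<eta>)) / 4)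
        + K / 2 * ((\<rho>' w \<eta>)\<^sup>2 + (\<rho>' w (\<i> *s \<eta>))\<^sup>2)"
  shows "strictly_psh_at c (\<lambda>z. \<rho> z + K * (\<rho> z)\<^sup>2) w"
proof -
  define A where "A = 1 + 2 * K * \<rho> w"
  \<comment> \<open>Of the available \<open>2 * c\<close>, one \<open>c / 2\<close> pays for the
    Taylor remainder and one for the error in the squared increment; \<open>c\<close> is left as
    strictness.\<close>
  define \<epsilon> where "\<epsilon> = c / (2 * (\<bar>A\<bar> + 1))"
  have \<epsilon>: "0 < \<epsilon>" "\<bar>A\<bar> * \<epsilon> \<le> c / 2"
    using \<open>0 < c\<close> by (auto simp: \<epsilon>_def field_simps)
  obtain d where d: "0 < d" "\<And>\<eta>. norm \<eta> < d \<Longrightarrow>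
      \<bar>\<rho> (w + \<eta>) - \<rho> w - \<rho>' w \<eta> - \<rho>'' w \<eta> \<eta> / 2\<bar> \<le> \<epsilon> * (norm \<eta>)\<^sup>2"
    using second_order_taylor[OF w \<epsilon>(1)] by blast
  \<comment> \<open>\<open>K1\<close> bounds increment minus linear part to second order,
    \<open>K2\<close> their sum to first order. The difference of their squares is thus of third
    order, and below the radius \<open>e\<close> it costs at most \<open>c / 2\<close>.\<close>
  define K1 where "K1 = norm (\<rho>'' w) + \<epsilon>"
  define K2 where "K2 = 2 * norm (\<rho>' w) + K1"
  have K: "0 \<le> K1" "0 \<le> K2" using \<epsilon> by (auto simp: K1_def K2_def)
  define e where "e = min d (min 1 (c / (2 * (K * K1 * K2 + 1))))"
  have pos: "0 < K * K1 * K2 + 1" using K \<open>0 \<le> K\<close> by (simp add: add_nonneg_pos)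
  have e: "0 < e" "e \<le> d" "e \<le> 1" "K * K1 * K2 * e \<le> c / 2"
  proof -
    show "0 < e" "e \<le> d" "e \<le> 1" using d \<open>0 < c\<close> pos by (auto simp: e_def)
    have "K * K1 * K2 * e \<le> (K * K1 * K2 + 1) * (c / (2 * (K * K1 * K2 + 1)))"
      using K \<open>0 \<le> K\<close> \<open>0 < e\<close> pos by (intro mult_mono) (auto simp: e_def)
    moreover have "y * (c / (2 * y)) = c / 2" if "0 < y" for y using that by simp
    ultimately show "K * K1 * K2 * e \<le> c / 2" using pos by metis
  qed
  define S where "S x = complex_of_real (\<rho>' w x) - \<i> * complex_of_real (\<rho>' w (\<i> *s x))" for x
  \<comment> \<open>\<open>S0\<close> is the part of the Hessian that changes sign when both
    arguments are multiplied by \<open>\<i>\<close>; \<open>C\<close> is the complex bilinear form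
    with real part \<open>S0\<close>.\<close>
  define S0 where "S0 x y = (\<rho>'' w x y - \<rho>'' w (\<i> *s x) (\<i> *s y)) / 2" for x y
  define C where "C x y = complex_of_real (S0 x y) - \<i> * complex_of_real (S0 (\<i> *s x) y)" for x y
  define s where "s j = S (axis j 1)" for j
  define cc where "cc j k = C (axis j 1) (axis k 1)" for j k
  have S: "S \<eta> = (\<Sum>j\<in>UNIV. \<eta> $ j * s j)" for \<eta>
    unfolding S_def s_def by (rule complex_linear_blinfun_form)
  have C: "C \<eta> \<eta> = (\<Sum>j\<in>UNIV. \<Sum>k\<in>UNIV. cc j k * \<eta> $ j * \<eta> $ k)" for \<eta>
    unfolding cc_def
    by (rule complex_bilinear_expand)
      (auto simp: C_def S0_def blinfun.bilinear_simps complex_eq_iff add_divide_distrib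
        diff_divide_distrib right_diff_distrib intro!: linearI)
  have Q: "of_real A * S \<eta> + (of_real (A / 2) * C \<eta> \<eta> + of_real (K / 2) * (S \<eta>)\<^sup>2)
    = (\<Sum>j\<in>UNIV. (of_real A * s j) * \<eta> $ j) + (\<Sum>j\<in>UNIV. \<Sum>k\<in>UNIV.
        (of_real (A / 2) * cc j k + of_real (K / 2) * (s j * s k)) * \<eta> $ j * \<eta> $ k)"
    (is "_ = ?Q \<eta>") for \<eta>
  proof -
    have "(S \<eta>)\<^sup>2 = (\<Sum>j\<in>UNIV. \<Sum>k\<in>UNIV. (s j * s k) * \<eta> $ j * \<eta> $ k)"
      unfolding power2_eq_square S by (simp add: sum_product mult_ac)
    moreover have "of_real A * S \<eta> = (\<Sum>j\<in>UNIV. (of_real A * s j) * \<eta> $ j)"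
      unfolding S by (simp add: sum_distrib_left mult_ac)
    ultimately show ?thesis
      by (simp only: C sum_distrib_left sum.distrib distrib_right mult.assoc)
  qed
  have ReQ: "Re (of_real A * S \<eta> + (of_real (A / 2) * C \<eta> \<eta> + of_real (K / 2) * (S \<eta>)\<^sup>2))
      = A * \<rho>' w \<eta> + A * (\<rho>'' w \<eta> \<eta> - \<rho>'' w (\<i> *s \<eta>) (\<i> *s \<eta>)) / 4
        + K / 2 * ((\<rho>' w \<eta>)\<^sup>2 - (\<rho>' w (\<i> *s \<eta>))\<^sup>2)" for \<eta>
    by (simp add: S_def C_def S0_def power2_eq_square)
  have "(\<rho> w + K * (\<rho> w)\<^sup>2) + Re (?Q \<eta>) + c * (norm \<eta>)\<^sup>2 \<le> \<rho> (w + \<eta>) + K * (\<rho> (w + \<eta>))\<^sup>2"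
    if \<eta>: "norm \<eta> < e" for \<eta>
  proof -
    define l q \<Delta> n where "l = \<rho>' w \<eta>" and "q = \<rho>'' w \<eta> \<eta>" and "\<Delta> = \<rho> (w + \<eta>) - \<rho> w"
      and "n = norm \<eta>"
    have n: "0 \<le> n" "n < e" "n \<le> 1" using \<eta> e by (auto simp: n_def)
    have tay: "\<bar>\<Delta> - l - q / 2\<bar> \<le> \<epsilon> * n\<^sup>2"
      using d(2)[of \<eta>] \<eta> e by (simp add: \<Delta>_def l_def q_def n_def)
    have l_le: "\<bar>l\<bar> \<le> norm (\<rho>' w) * n"
      unfolding l_def n_def using norm_blinfun[of "\<rho>' w" \<eta>] by simp
    have "\<bar>q\<bar> \<le> norm (\<rho>'' w \<eta>) * n"
      unfolding q_def n_def using norm_blinfun[of "\<rho>'' w \<eta>" \<eta>] by simp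
    also have "\<dots> \<le> norm (\<rho>'' w) * n * n"
      unfolding n_def using norm_blinfun[of "\<rho>'' w" \<eta>] by (intro mult_right_mono) auto
    finally have "\<bar>q / 2\<bar> \<le> norm (\<rho>'' w) * n\<^sup>2"
      by (simp add: power2_eq_square mult.assoc) 
    then have D1: "\<bar>\<Delta> - l\<bar> \<le> K1 * n\<^sup>2"
      using tay unfolding K1_def distrib_right by linarith
    have "K1 * n\<^sup>2 \<le> K1 * n" using n K by (intro mult_left_mono) (auto simp: power2_eq_square mult_left_le)
    then have D2: "\<bar>\<Delta> + l\<bar> \<le> K2 * n"
      using D1 l_le unfolding K2_def distrib_right by linarith
    have "\<bar>\<Delta>\<^sup>2 - l\<^sup>2\<bar> = \<bar>\<Delta> - l\<bar> * \<bar>\<Delta> + l\<bar>"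
      by (simp add: abs_mult[symmetric] power2_eq_square algebra_simps)
    also have "\<dots> \<le> (K1 * n\<^sup>2) * (K2 * n)"
      using D1 D2 K n by (intro mult_mono) auto
    finally have "K * \<bar>\<Delta>\<^sup>2 - l\<^sup>2\<bar> \<le> K * ((K1 * n\<^sup>2) * (K2 * n))"
      using \<open>0 \<le> K\<close> by (rule mult_left_mono)
    also have "\<dots> = (K * K1 * K2 * n) * n\<^sup>2" by (simp add: mult_ac)
    also have "\<dots> \<le> (c / 2) * n\<^sup>2"
    proof (rule mult_right_mono)
      have "K * K1 * K2 * n \<le> K * K1 * K2 * e"
        using K \<open>0 \<le> K\<close> n by (intro mult_left_mono) auto
      then show "K * K1 * K2 * n \<le> c / 2" using e(4) by linarith
    qed simp
    finally have "\<bar>K * (\<Delta>\<^sup>2 - l\<^sup>2)\<bar> \<le> c / 2 * n\<^sup>2"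
      using \<open>0 \<le> K\<close> by (simp add: abs_mult)
    then have E1: "K * l\<^sup>2 - c / 2 * n\<^sup>2 \<le> K * \<Delta>\<^sup>2"
      unfolding right_diff_distrib by linarith
    have "\<bar>A * (\<Delta> - l - q / 2)\<bar> \<le> \<bar>A\<bar> * (\<epsilon> * n\<^sup>2)"
      unfolding abs_mult using tay by (intro mult_left_mono) auto
    also have "\<dots> \<le> c / 2 * n\<^sup>2"
      using mult_right_mono[OF \<epsilon>(2), of "n\<^sup>2"] by (simp add: mult.assoc)
    finally have "- (A * (\<Delta> - l - q / 2)) \<le> c / 2 * n\<^sup>2" by (rule abs_le_D2)
    moreover have "A * (\<Delta> - l - q / 2) = A * \<Delta> - A * l - A * q / 2" by (simp add: algebra_simps)
    ultimately have E2: "A * l + A * q / 2 - c / 2 * n\<^sup>2 \<le> A * \<Delta>" by linarith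
    have E3: "\<rho> (w + \<eta>) + K * (\<rho> (w + \<eta>))\<^sup>2 = \<rho> w + K * (\<rho> w)\<^sup>2 + A * \<Delta> + K * \<Delta>\<^sup>2"
      by (simp add: A_def \<Delta>_def power2_eq_square algebra_simps)
    define q2 l2 where "q2 = \<rho>'' w (\<i> *s \<eta>) (\<i> *s \<eta>)" and "l2 = \<rho>' w (\<i> *s \<eta>)"
    have "2 * c * n\<^sup>2 \<le> A * ((q + q2) / 4) + K / 2 * (l\<^sup>2 + l2\<^sup>2)"
      using F[of \<eta>] by (simp add: A_def q_def q2_def l_def l2_def n_def)
    moreover have "Re (?Q \<eta>) = A * l + A * (q - q2) / 4 + K / 2 * (l\<^sup>2 - l2\<^sup>2)"
      unfolding Q[symmetric] ReQ by (simp add: q_def q2_def l_def l2_def)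
    moreover have "A * ((q + q2) / 4) + A * (q - q2) / 4 = A * q / 2"
      by (simp add: field_simps)
    moreover have "K / 2 * (l\<^sup>2 + l2\<^sup>2) + K / 2 * (l\<^sup>2 - l2\<^sup>2) = K * l\<^sup>2"
      by (simp add: field_simps)
    moreover have "c / 2 * n\<^sup>2 + c / 2 * n\<^sup>2 = c * n\<^sup>2" by (simp add: field_simps)
    moreover have "2 * c * n\<^sup>2 = c * n\<^sup>2 + c * n\<^sup>2" by (simp add: field_simps)
    ultimately show ?thesis
      unfolding E3 n_def[symmetric] using E1 E2 by linarith
  qed
  then show ?thesis
    unfolding strictly_psh_at_def using e(1)
    by (intro exI[of _ "\<lambda>j. of_real A * s j"]
        exI[of _ "\<lambda>j k. of_real (A / 2) * cc j k + of_real (K / 2) * (s j * s k)"] exI[of _ e]) blast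
qed

text \<open>Adding \<open>K * \<rho>\<^sup>2\<close> contributes \<open>K\<close> times the squared normal component, which compensates a
  Levi form that is only positive on the complex tangent space.\<close>

lemma strictly_psh_near:
  assumes p: "p \<in> U" "\<rho> p = 0"
    and levi: "\<And>v. v \<in> complex_tangent_space \<rho> p \<Longrightarrow> v \<noteq> 0 \<Longrightarrow> levi_form \<rho> p v > 0"
  obtains K R c where "0 \<le> K" "0 < R" "0 < c" "ball p R \<subseteq> U"
    "\<And>w. w \<in> ball p R \<Longrightarrow> strictly_psh_at c (\<lambda>z. \<rho> z + K * (\<rho> z)\<^sup>2) w"
proof -
  define q where "q w \<eta> = (\<rho>'' w \<eta> \<eta> + \<rho>'' w (\<i> *s \<eta>) (\<i> *s \<eta>)) / 4" for w \<eta>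
  define m where "m w \<eta> = ((\<rho>' w \<eta>)\<^sup>2 + (\<rho>' w (\<i> *s \<eta>))\<^sup>2) / 2" for w \<eta>
  have m_nonneg: "0 \<le> m w \<eta>" for w \<eta> by (simp add: m_def)
  have cont_i: "continuous_on T (\<lambda>x. \<i> *s g x)" if "continuous_on T g"
    for T :: "'x::topological_space set" and g :: "'x \<Rightarrow> complex^'n"
  proof -
    have "bounded_linear (\<lambda>x :: complex^'n. \<i> *s x)"
      by (rule bounded_linear_intro[where K = 1]) (simp_all add: norm_vector_scalar_mult)
    then show ?thesis using bounded_linear.continuous_on that by blast
  qed
  have cont_q: "continuous_on T (\<lambda>x. q (f x) (g x))" and cont_m: "continuous_on T (\<lambda>x. m (f x) (g x))"
    if "continuous_on T f" "continuous_on T g" "f ` T \<subseteq> U"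
    for T :: "'x::topological_space set" and f g
    unfolding q_def m_def
    by (intro continuous_intros cont_i that continuous_on_compose2[OF cont2 that(1) that(3)]
        continuous_on_compose2[OF C2_derivative_continuous that(1) that(3)]; simp)+
  let ?S = "sphere 0 1 :: (complex^'n) set"
  obtain n :: nat where n: "\<And>v. v \<in> ?S \<Longrightarrow> 0 < q p v + real n * m p v"
  proof -
    \<comment> \<open>These sets increase with \<open>n\<close> because \<open>m\<close> is
      non-negative, so the largest index of a finite subcover serves the whole sphere.\<close>
    let ?V = "\<lambda>n::nat. {v. 0 < q p v + real n * m p v}"
    have op: "open (?V n)" for n
      by (intro open_Collect_less continuous_intros cont_q cont_m) (use p in auto)
    have cov: "?S \<subseteq> (\<Union>n. ?V n)"
    proof
      fix v assume v: "v \<in> ?S"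
      show "v \<in> (\<Union>n. ?V n)"
      proof (cases "m p v = 0")
        case True
        then have "\<rho>' p v = 0 \<and> \<rho>' p (\<i> *s v) = 0"
          by (simp add: m_def add_nonneg_eq_0_iff)
        moreover have "v \<noteq> 0" using v by auto
        ultimately have "0 < q p v"
          using levi[of v] by (simp add: complex_tangent_space_iff[OF p(1)] levi_form_eq[OF p(1)] q_def)
        then show ?thesis by (intro UN_I[of 0]) auto
      next
        case False
        then have "0 < m p v" using m_nonneg[of p v] by linarith
        then obtain n :: nat where "- q p v < real n * m p v"
          using ex_less_of_nat_mult by blast
        then show ?thesis by (intro UN_I[of n]) auto
      qed
    qed
    obtain N where "N \<subseteq> UNIV" and N: "finite N" "?S \<subseteq> (\<Union>n\<in>N. ?V n)"
      by (rule compactE_image[OF compact_sphere, where f = ?V and C = UNIV, OF op cov])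
    have Max: "0 < q p v + real (Max N) * m p v" if "v \<in> ?S" for v
    proof -
      obtain k where k: "k \<in> N" "0 < q p v + real k * m p v" using N(2) \<open>v \<in> ?S\<close> by blast
      have "real k * m p v \<le> real (Max N) * m p v"
        using k N(1) m_nonneg by (intro mult_right_mono) auto
      then show ?thesis using k by linarith
    qed
    show thesis by (rule that[OF Max])
  qed
  define K where "K = real n"
  define F where "F w \<eta> = (1 + 2 * K * \<rho> w) * q w \<eta> + K * m w \<eta>" for w \<eta>
  have cont_F: "continuous_on (U \<times> ?S) (\<lambda>x. F (fst x) (snd x))"
    unfolding F_def
    by (intro continuous_intros cont_q cont_m continuous_on_compose2[OF C2_function_continuous]) auto
  have "continuous_on ?S (F p)"
    by (rule continuous_on_compose2[OF cont_F, of ?S "\<lambda>\<eta>. (p, \<eta>)", simplified])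
      (use p in \<open>auto intro!: continuous_intros\<close>)
  moreover have "?S \<noteq> {}" by simp
  ultimately obtain v0 where v0: "v0 \<in> ?S" "\<And>v. v \<in> ?S \<Longrightarrow> F p v0 \<le> F p v"
    using continuous_attains_inf[OF compact_sphere, of 0 1 "F p"] by blast
  \<comment> \<open>The minimum over the sphere at \<open>p\<close> is \<open>4 * c\<close>; moving
    away from \<open>p\<close> will cost at most \<open>c\<close>, and \<open>2 * c\<close> is
    demanded.\<close>
  define c where "c = F p v0 / 4"
  have c: "0 < c" using n[OF v0(1)] p by (simp add: c_def F_def K_def)
  obtain X where X: "p \<in> X" "open X"
    "\<forall>w\<in>X \<inter> U. \<forall>\<eta>\<in>?S. dist (F w \<eta>) (F p \<eta>) \<le> c"
    using continuous_on_prod_compactE[OF cont_F compact_sphere p(1) c] by auto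
  obtain R where R: "0 < R" "ball p R \<subseteq> X \<inter> U"
    using X(1,2) U p(1) open_contains_ball by (metis IntI open_Int)
  have "strictly_psh_at c (\<lambda>z. \<rho> z + K * (\<rho> z)\<^sup>2) w" if w: "w \<in> ball p R" for w
  proof (rule strictly_psh_at_of_form)
    show "w \<in> U" "0 < c" "0 \<le> K" using R w c by (auto simp: K_def)
    fix \<eta> :: "complex^'n"
    have "2 * c * (norm \<eta>)\<^sup>2 \<le> F w \<eta>"
    proof (cases "\<eta> = 0")
      case True
      then show ?thesis by (simp add: F_def q_def m_def)
    next
      case False
      define s where "s = sgn \<eta>"
      have s: "s \<in> ?S" "\<eta> = norm \<eta> *\<^sub>R s" using False by (simp_all add: s_def norm_sgn sgn_div_norm)
      have "q w (t *\<^sub>R s) = t\<^sup>2 * q w s" "m w (t *\<^sub>R s) = t\<^sup>2 * m w s" for t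
        by (simp_all add: q_def m_def blinfun.bilinear_simps power2_eq_square distrib_left mult_ac)
      then have "F w (t *\<^sub>R s) = t\<^sup>2 * F w s" for t
        by (simp add: F_def distrib_left mult_ac)
      then have "F w \<eta> = (norm \<eta>)\<^sup>2 * F w s" by (subst s(2))
      moreover have "2 * c \<le> F w s"
      proof -
        have "w \<in> X \<inter> U" using R(2) w by blast
        then have "\<bar>F w s - F p s\<bar> \<le> c" using X(3) s(1) by (simp add: dist_real_def)
        moreover have "4 * c \<le> F p s" using v0(2)[OF s(1)] by (simp add: c_def)
        ultimately show ?thesis using c by linarith
      qed
      ultimately show ?thesis
        using mult_left_mono[of "2 * c" "F w s" "(norm \<eta>)\<^sup>2"] by (simp add: mult.commute)
    qed
    then show "2 * c * (norm \<eta>)\<^sup>2 \<le> (1 + 2 * K * \<rho> w) * ((\<rho>'' w \<eta> \<eta> + \<rho>'' w (\<i> *s \<eta>) (\<i> *s \<eta>)) / 4)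
        + K / 2 * ((\<rho>' w \<eta>)\<^sup>2 + (\<rho>' w (\<i> *s \<eta>))\<^sup>2)"
      by (simp add: F_def q_def m_def)
  qed
  then show thesis
    using that[of K R c] R c by (auto simp: K_def)
qed

end

section \<open>Boundary growth of the Kobayashi distance\<close>

text \<open>A walk inwards along a fixed transversal direction. The inscribed radius is at least
  depth over \<open>L\<close>, and a step of half that radius has a fixed cost and multiplies the
  bound on the depth by \<open>\<beta>\<close>. Hence the number of steps to a compact set grows
  like the logarithm of the inverse depth.\<close>

lemma kobayashi_dist_le_log_near:
  fixes \<rho> :: "complex^'n \<Rightarrow> real" and \<rho>' :: "complex^'n \<Rightarrow> (complex^'n) \<Rightarrow>\<^sub>L real"
  assumes \<Omega>: "open \<Omega>" "connected \<Omega>" "o' \<in> \<Omega>"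
    and R0: "0 < R0" "\<And>w. w \<in> ball p R0 \<Longrightarrow> \<rho> w < 0 \<Longrightarrow> w \<in> \<Omega>"
    and der: "\<And>x. x \<in> ball p R0 \<Longrightarrow> (\<rho> has_derivative blinfun_apply (\<rho>' x)) (at x)"
    and cont: "continuous_on (ball p R0) \<rho>'"
    and p: "\<rho> p = 0" "\<rho>' p \<noteq> 0"
  obtains R C where "0 < R" "0 \<le> C" "\<And>z. z \<in> ball p R \<Longrightarrow> \<rho> z < 0 \<Longrightarrow>
    kobayashi_dist \<Omega> o' z \<le> C * (1 + \<bar>ln (- \<rho> z)\<bar>)"
proof -
  obtain \<nu>0 where \<nu>0: "\<rho>' p \<nu>0 \<noteq> 0"
    using p(2) blinfun_eqI[of "\<rho>' p" 0] by auto
  then have "\<nu>0 \<noteq> 0" by (auto simp: blinfun.bilinear_simps)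
  \<comment> \<open>A unit vector pointing inwards, obtained from any vector on which the
    differential does not vanish.\<close>
  define \<nu> where "\<nu> = (- sgn (\<rho>' p \<nu>0) / norm \<nu>0) *\<^sub>R \<nu>0"
  have "\<rho>' p \<nu> = - (\<bar>\<rho>' p \<nu>0\<bar> / norm \<nu>0)"
    by (simp add: \<nu>_def blinfun.bilinear_simps abs_sgn mult.commute)
  then have \<nu>: "norm \<nu> = 1" "\<rho>' p \<nu> < 0"
    using \<nu>0 \<open>\<nu>0 \<noteq> 0\<close> by (auto simp: \<nu>_def abs_sgn_eq)
  define c where "c = - \<rho>' p \<nu> / 2"
  define L where "L = norm (\<rho>' p) + c"
  have c: "0 < c" using \<nu> by (simp add: c_def)
  have "\<bar>\<rho>' p \<nu>\<bar> \<le> norm (\<rho>' p)" using norm_blinfun[of "\<rho>' p" \<nu>] \<nu> by simp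
  then have L: "0 < L" "c \<le> L" using c by (auto simp: L_def c_def)
  obtain R2 where R2: "0 < R2" "\<And>w. w \<in> ball p R0 \<Longrightarrow> dist w p < R2 \<Longrightarrow> dist (\<rho>' w) (\<rho>' p) < c"
    using cont c R0(1) unfolding continuous_on_iff by (metis centre_in_ball)
  define R1 where "R1 = min R0 R2"
  have R1: "0 < R1" "ball p R1 \<subseteq> ball p R0" using R0 R2 by (auto simp: R1_def)
  have close: "norm (\<rho>' w - \<rho>' p) < c" if "w \<in> ball p R1" for w
    using R2(2)[of w] that by (auto simp: R1_def dist_commute dist_norm[of "\<rho>' _", symmetric])
  have \<rho>'_le: "norm (\<rho>' w) \<le> L" "\<rho>' w \<nu> \<le> - c" if w: "w \<in> ball p R1" for w
  proof -
    show "norm (\<rho>' w) \<le> L"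
      using close[OF w] norm_triangle_sub[of "\<rho>' w" "\<rho>' p"] by (simp add: L_def)
    have "\<bar>(\<rho>' w - \<rho>' p) \<nu>\<bar> \<le> norm (\<rho>' w - \<rho>' p)"
      using norm_blinfun[of "\<rho>' w - \<rho>' p" \<nu>] \<nu> by simp
    then show "\<rho>' w \<nu> \<le> - c"
      using close[OF w] by (simp add: blinfun.bilinear_simps c_def)
  qed
  have lip: "\<bar>\<rho> x - \<rho> y\<bar> \<le> L * norm (x - y)" if "x \<in> ball p R1" "y \<in> ball p R1" for x y
  proof -
    have "norm (\<rho> x - \<rho> y) \<le> L * norm (x - y)"
    proof (rule differentiable_bound[OF convex_ball])
      fix w assume w: "w \<in> ball p R1"
      then show "(\<rho> has_derivative blinfun_apply (\<rho>' w)) (at w within ball p R1)"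
        using der R1 by (blast intro: has_derivative_at_withinI)
      show "onorm (blinfun_apply (\<rho>' w)) \<le> L" using \<rho>'_le(1)[OF w] by (simp add: norm_blinfun.rep_eq)
    qed (use that in auto)
    then show ?thesis by simp
  qed
  have down: "\<rho> (w + t *\<^sub>R \<nu>) \<le> \<rho> w - c * t"
    if "0 \<le> t" and w: "\<And>s. 0 \<le> s \<Longrightarrow> s \<le> t \<Longrightarrow> w + s *\<^sub>R \<nu> \<in> ball p R1" for w t
  proof -
    have D: "((\<lambda>s. \<rho> (w + s *\<^sub>R \<nu>) + c * s) has_real_derivative (\<rho>' (w + s *\<^sub>R \<nu>) \<nu> + c)) (at s)"
      if s: "0 \<le> s" "s \<le> t" for s
    proof -
      have "w + s *\<^sub>R \<nu> \<in> ball p R0" using w[OF s] R1 by blast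
      from der[OF this] have "((\<lambda>s. \<rho> (w + s *\<^sub>R \<nu>)) has_derivative (\<lambda>h. \<rho>' (w + s *\<^sub>R \<nu>) (h *\<^sub>R \<nu>))) (at s)"
        by (rule has_derivative_compose[rotated]) (auto intro!: derivative_eq_intros)
      then have "((\<lambda>s. \<rho> (w + s *\<^sub>R \<nu>)) has_real_derivative \<rho>' (w + s *\<^sub>R \<nu>) \<nu>) (at s)"
        by (simp add: has_field_derivative_def blinfun.bilinear_simps mult_commute_abs)
      then show ?thesis by (auto intro!: derivative_eq_intros)
    qed
    have "\<rho> (w + t *\<^sub>R \<nu>) + c * t \<le> \<rho> (w + 0 *\<^sub>R \<nu>) + c * 0"
    proof (rule DERIV_nonpos_imp_nonincreasing[OF \<open>0 \<le> t\<close>, of "\<lambda>s. \<rho> (w + s *\<^sub>R \<nu>) + c * s"])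
      fix s assume s: "0 \<le> s" "s \<le> t"
      show "\<exists>y. ((\<lambda>s. \<rho> (w + s *\<^sub>R \<nu>) + c * s) has_real_derivative y) (at s) \<and> y \<le> 0"
        using D[OF s] \<rho>'_le(2)[OF w[OF s]] by (intro exI conjI) auto
    qed
    then show ?thesis by simp
  qed
  \<comment> \<open>Starting within \<open>R1 / 8\<close> of \<open>p\<close>, the walk stays within
    \<open>3 / 8 * R1\<close>; the inscribed balls have at most that radius too, so they remain in
    \<open>ball p R1\<close>.\<close>
  define t1 where "t1 = R1 / 4"
  have t1: "0 < t1" using R1 by (simp add: t1_def)
  define \<beta> where "\<beta> = 1 + c / (2 * L)"
  have \<beta>: "1 < \<beta>" using c L by (simp add: \<beta>_def)
  \<comment> \<open>The depth guaranteed at the end: the last step may fall short of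
    \<open>c * t1\<close> by the factor \<open>\<beta>\<close>.\<close>
  define \<mu> where "\<mu> = c * t1 / \<beta>"
  have \<mu>: "0 < \<mu>" using c t1 \<beta> by (simp add: \<mu>_def)
  define C where "C = {w \<in> cball p (R1 / 2). \<rho> w \<le> - \<mu>}"
  have "continuous_on (ball p R0) \<rho>"
    using der has_derivative_continuous continuous_at_imp_continuous_on by blast
  then have "continuous_on (cball p (R1 / 2)) \<rho>"
    by (rule continuous_on_subset) (use R1(1) in \<open>auto simp: R1_def\<close>)
  then have "closed C"
    using continuous_closed_preimage[OF _ closed_cball, of p "R1 / 2" \<rho> "{..- \<mu>}"]
    by (simp add: C_def vimage_def Int_def)
  moreover have "bounded C" by (rule bounded_subset[OF bounded_cball[of p "R1 / 2"]]) (auto simp: C_def)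
  ultimately have "compact C" by (simp add: compact_eq_bounded_closed)
  moreover have "C \<subseteq> \<Omega>"
  proof
    fix w assume "w \<in> C"
    then show "w \<in> \<Omega>" using \<mu> R1 by (intro R0(2)) (auto simp: C_def R1_def)
  qed
  ultimately obtain B where B: "\<And>z. z \<in> C \<Longrightarrow> kobayashi_dist \<Omega> o' z \<le> B"
    using kobayashi_dist_bounded_on_compact[OF \<Omega>, of C] by blast
  define a where "a = artanh (1 / 2 :: real)"
  have a: "0 < a" by (simp add: a_def artanh_def)
  define \<alpha> where "\<alpha> = a / ln \<beta>"
  have \<alpha>: "0 < \<alpha>" using a \<beta> by (simp add: \<alpha>_def)
  define E where "E = L * R1 + c * t1"
  have bound: "kobayashi_dist \<Omega> o' z \<le> B + \<alpha> * (E - ln (- \<rho> z))" if z: "z \<in> ball p (R1 / 8)" "\<rho> z < 0" for z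
  proof -
    define d where "d = - \<rho> z"
    have d: "0 < d" using z by (simp add: d_def)
    have pz: "dist p z < R1 / 8" using z by simp
    have "\<bar>\<rho> z - \<rho> p\<bar> \<le> L * norm (z - p)" using z R1 by (intro lip) auto
    also have "\<dots> \<le> L * (R1 / 8)"
      using pz L by (intro mult_left_mono) (auto simp: dist_norm norm_minus_commute)
    finally have dL: "d \<le> L * (R1 / 8)" using p by (simp add: d_def)
    have wt: "dist p (z + t *\<^sub>R \<nu>) < 3 / 8 * R1" if "0 \<le> t" "t \<le> t1" for t
    proof -
      have "dist p (z + t *\<^sub>R \<nu>) \<le> dist p z + dist z (z + t *\<^sub>R \<nu>)" by (rule dist_triangle)
      also have "dist z (z + t *\<^sub>R \<nu>) = t" using that \<nu> by (simp add: dist_norm)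
      finally show ?thesis using pz that by (simp add: t1_def)
    qed
    have depth: "\<rho> (z + t *\<^sub>R \<nu>) \<le> - (d + c * t)" if t: "0 \<le> t" "t \<le> t1" for t
      using down[of t z] wt t R1 by (force simp: d_def)
    have balls: "ball (z + t *\<^sub>R \<nu>) ((d + c * t) / L) \<subseteq> \<Omega>" if t: "0 \<le> t" "t \<le> t1" for t
    proof
      fix y assume y: "y \<in> ball (z + t *\<^sub>R \<nu>) ((d + c * t) / L)"
      have "c * t \<le> L * t1" using t L c by (intro mult_mono) auto
      then have "(d + c * t) / L \<le> (L * (R1 / 8) + L * t1) / L"
        using dL L by (intro divide_right_mono) auto
      also have "\<dots> = 3 / 8 * R1" using L by (simp add: t1_def field_simps)
      finally have "dist (z + t *\<^sub>R \<nu>) y < 3 / 8 * R1" using y unfolding mem_ball by linarith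
      then have y1: "y \<in> ball p R1"
        using wt[OF t] dist_triangle[of p y "z + t *\<^sub>R \<nu>"] R1(1) unfolding mem_ball by linarith
      have w1: "z + t *\<^sub>R \<nu> \<in> ball p R1" using wt[OF t] R1(1) unfolding mem_ball by linarith
      have "\<rho> y - \<rho> (z + t *\<^sub>R \<nu>) \<le> L * norm (y - (z + t *\<^sub>R \<nu>))"
        using lip[OF y1 w1] by linarith
      also have "\<dots> < L * ((d + c * t) / L)"
        using y L by (intro mult_strict_left_mono) (auto simp: dist_norm norm_minus_commute)
      also have "\<dots> = d + c * t" using L by simp
      finally have "\<rho> y < 0" using depth[OF t] by linarith
      then show "y \<in> \<Omega>" using R0(2) R1(2) y1 by blast
    qed
    \<comment> \<open>The solved recursion of half-radius steps: the depth bound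
      \<open>d + c * t j\<close> is a geometric sequence.\<close>
    define t where "t j = d * (\<beta> ^ j - 1) / c" for j :: nat
    have dt: "d + c * t j = d * \<beta> ^ j" for j using c by (simp add: t_def field_simps)
    have t0: "0 \<le> t j" for j using c d \<beta> by (simp add: t_def)
    have t_Suc: "t (Suc j) - t j = (d + c * t j) / L / 2" for j
      unfolding dt using c L by (simp add: t_def \<beta>_def field_simps)
    have chain: "disc_chain \<Omega> z (z + t j *\<^sub>R \<nu>) (real j * a)" if "t j \<le> t1" for j
      using that
    proof (induction j)
      case 0
      then show ?case by (simp add: t_def disc_chain.trivial)
    next
      case (Suc j)
      have s0: "0 < (d + c * t j) / L" using d \<beta> L by (simp add: dt)
      then have tj: "t j \<le> t1" using t_Suc[of j] Suc.prems by simp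
      have "norm ((z + t (Suc j) *\<^sub>R \<nu>) - (z + t j *\<^sub>R \<nu>)) = \<bar>t (Suc j) - t j\<bar>"
        using \<nu> by (simp add: scaleR_left_diff_distrib[symmetric])
      then have "disc_chain \<Omega> (z + t j *\<^sub>R \<nu>) (z + t (Suc j) *\<^sub>R \<nu>) a"
        unfolding a_def using s0 t_Suc[of j] by (intro disc_chain_ball[OF balls[OF t0 tj]]) auto
      from disc_chain_append[OF Suc.IH[OF tj] this] show ?case
        by (simp add: algebra_simps)
    qed
    define X where "X = (d + c * t1) / d"
    have X: "1 \<le> X" using d c t1 by (simp add: X_def)
    obtain m0 where "X < \<beta> ^ m0" using real_arch_pow[OF \<beta>] by blast
    \<comment> \<open>The walk takes \<open>n = m - 1\<close> steps, the largest number that stays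
      within \<open>t1\<close>; that one more step would overshoot yields the depth
      \<open>\<mu>\<close>.\<close>
    define m where "m = (LEAST m. X < \<beta> ^ m)"
    have m: "X < \<beta> ^ m" unfolding m_def using \<open>X < \<beta> ^ m0\<close> by (rule LeastI)
    then have "m \<noteq> 0" using X by (cases m) auto
    then obtain n where n: "m = Suc n" using not0_implies_Suc by blast
    have Xn: "\<beta> ^ n \<le> X" using not_less_Least[of n "\<lambda>m. X < \<beta> ^ m"] n by (simp add: m_def)
    have "d * \<beta> ^ n \<le> d * X" using Xn d by (intro mult_left_mono) auto
    then have "c * t n \<le> c * t1" using dt[of n] d by (simp add: X_def)
    then have tn: "t n \<le> t1" using c by simp
    have "d * X < d * (\<beta> * \<beta> ^ n)" using m n d by (intro mult_strict_left_mono) auto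
    then have "c * t1 \<le> d * \<beta> ^ n * \<beta>" using d by (simp add: X_def mult_ac)
    then have "\<mu> \<le> d + c * t n" unfolding dt using \<beta> by (simp add: \<mu>_def field_simps)
    then have "z + t n *\<^sub>R \<nu> \<in> C"
      using depth[OF t0 tn] wt[OF t0 tn] R1(1) by (simp add: C_def)
    then have K1: "kobayashi_dist \<Omega> o' (z + t n *\<^sub>R \<nu>) \<le> B" and in_\<Omega>: "z + t n *\<^sub>R \<nu> \<in> \<Omega>"
      using B \<open>C \<subseteq> \<Omega>\<close> by auto
    have z\<Omega>: "z \<in> \<Omega>" using z R1 by (intro R0(2)) (auto simp: R1_def)
    have "kobayashi_dist \<Omega> z (z + t n *\<^sub>R \<nu>) \<le> real n * a"
      by (rule kobayashi_dist_le[OF chain[OF tn] z\<Omega> in_\<Omega>])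
    also have "real n * a \<le> \<alpha> * ln X"
    proof -
      have "ln (\<beta> ^ n) \<le> ln X" using Xn \<beta> X by (subst ln_le_cancel_iff) auto
      then have "real n * ln \<beta> \<le> ln X" using \<beta> by (simp add: ln_realpow)
      then have "\<alpha> * (real n * ln \<beta>) \<le> \<alpha> * ln X" using \<alpha> by (intro mult_left_mono) auto
      then show ?thesis using \<beta> by (simp add: \<alpha>_def mult.commute[of "real n"])
    qed
    also have "\<alpha> * ln X \<le> \<alpha> * (E - ln d)"
    proof (rule mult_left_mono)
      have pos: "0 < d + c * t1" using d c t1 by (simp add: add_pos_pos)
      then have "ln X = ln (d + c * t1) - ln d"
        using d by (simp add: X_def ln_div)
      also have "ln (d + c * t1) \<le> d + c * t1"
        using ln_bound[OF pos] .
      also have "d + c * t1 \<le> E"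
      proof -
        have "L * (R1 / 8) \<le> L * R1" using L R1 by (intro mult_left_mono) auto
        then show ?thesis using dL by (simp add: E_def)
      qed
      finally show "ln X \<le> E - ln d" by simp
    qed (use \<alpha> in simp)
    finally show ?thesis
      using kobayashi_dist_triangle[OF \<Omega> in_\<Omega> z\<Omega>] K1 kobayashi_dist_commute[of \<Omega> z] by (simp add: d_def)
  qed
  define C' where "C' = \<bar>B\<bar> + \<alpha> * \<bar>E\<bar> + \<alpha>"
  show thesis
  proof (rule that[of "R1 / 8" C'])
    show "0 < R1 / 8" "0 \<le> C'" using R1 \<alpha> by (auto simp: C'_def)
    fix z assume z: "z \<in> ball p (R1 / 8)" "\<rho> z < 0"
    have "\<alpha> * (E - ln (- \<rho> z)) \<le> \<alpha> * (\<bar>E\<bar> + \<bar>ln (- \<rho> z)\<bar>)"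
      using \<alpha> by (intro mult_left_mono) auto
    then have "B + \<alpha> * (E - ln (- \<rho> z)) \<le> \<bar>B\<bar> + \<alpha> * \<bar>E\<bar> + \<alpha> * \<bar>ln (- \<rho> z)\<bar>"
      by (simp add: distrib_left)
    also have "\<alpha> * \<bar>ln (- \<rho> z)\<bar> \<le> C' * \<bar>ln (- \<rho> z)\<bar>"
      using \<alpha> by (intro mult_right_mono) (auto simp: C'_def)
    also have "\<bar>B\<bar> + \<alpha> * \<bar>E\<bar> + C' * \<bar>ln (- \<rho> z)\<bar> \<le> C' * (1 + \<bar>ln (- \<rho> z)\<bar>)"
      using \<alpha> by (simp add: C'_def distrib_left)
    finally show "kobayashi_dist \<Omega> o' z \<le> C' * (1 + \<bar>ln (- \<rho> z)\<bar>)"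
      using bound[OF z] by simp
  qed
qed

text \<open>The local constants, including the \<open>K\<close> in the psh function, vary with
  \<open>p\<close>. Both conclusions are therefore expressed through the one function
  \<open>\<rho>\<close>, so that a finite subcover of the compact frontier makes them uniform. The
  discs live in \<open>D\<close>, the distance in \<open>D - A\<close>.\<close>

lemma boundary_estimates:
  fixes D :: "(complex^'n) set"
  assumes "open D" "bounded D" and def: "C2_defining_function D U \<rho>"
    and levi: "\<And>p v. p \<in> frontier D \<Longrightarrow> v \<in> complex_tangent_space \<rho> p \<Longrightarrow> v \<noteq> 0 \<Longrightarrow> levi_form \<rho> p v > 0"
    and A: "finite A" "A \<subseteq> D" and conn: "connected (D - A)" and o': "o' \<in> D - A"
  obtains N C where "open N" "frontier D \<subseteq> N" "N \<subseteq> U" "1 \<le> C"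
    "\<And>z f i. z \<in> D \<inter> N \<Longrightarrow> analytic_disc D f \<Longrightarrow> f 0 = z \<Longrightarrow>
      (cmod (deriv (\<lambda>\<zeta>. f \<zeta> $ i) 0))\<^sup>2 \<le> C * (- \<rho> z)"
    "\<And>z. z \<in> D \<inter> N \<Longrightarrow> kobayashi_dist (D - A) o' z \<le> C * (1 + \<bar>ln (- \<rho> z)\<bar>)"
proof -
  have U: "open U" "frontier D \<subseteq> U" and DU: "\<And>z. z \<in> U \<Longrightarrow> z \<in> D \<longleftrightarrow> \<rho> z < 0"
    and fr: "\<And>p. p \<in> frontier D \<Longrightarrow> \<rho> p = 0"
    and nz: "\<And>p. p \<in> frontier D \<Longrightarrow> frechet_derivative \<rho> (at p) \<noteq> (\<lambda>v. 0)"
    using def unfolding C2_defining_function_def by blast+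
  obtain \<rho>' and \<rho>'' :: "complex^'n \<Rightarrow> (complex^'n) \<Rightarrow>\<^sub>L (complex^'n) \<Rightarrow>\<^sub>L real" where
    der: "\<And>x. x \<in> U \<Longrightarrow> (\<rho> has_derivative blinfun_apply (\<rho>' x)) (at x)"
    and der2: "\<And>x. x \<in> U \<Longrightarrow> (\<rho>' has_derivative blinfun_apply (\<rho>'' x)) (at x)"
    and cont2: "continuous_on U \<rho>''"
    using def unfolding C2_defining_function_def C2_on_def by blast
  have \<rho>_cont: "continuous_on U \<rho>" using C2_function_continuous[OF U(1) der der2 cont2] .
  have \<rho>'_cont: "continuous_on U \<rho>'" using C2_derivative_continuous[OF U(1) der der2 cont2] .
  have \<Omega>_open: "open (D - A)" using \<open>open D\<close> A finite_imp_closed by blast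
  obtain b where b: "0 < b" "\<And>x. x \<in> D \<Longrightarrow> norm x \<le> b" using \<open>bounded D\<close> bounded_pos by metis
  let ?P = "\<lambda>p R C. 0 < R \<and> 1 \<le> C \<and> ball p R \<subseteq> U \<and> (\<forall>z\<in>D \<inter> ball p R.
      (\<forall>f i. analytic_disc D f \<longrightarrow> f 0 = z \<longrightarrow> (cmod (deriv (\<lambda>\<zeta>. f \<zeta> $ i) 0))\<^sup>2 \<le> C * (- \<rho> z)) \<and>
      kobayashi_dist (D - A) o' z \<le> C * (1 + \<bar>ln (- \<rho> z)\<bar>))"
  have "\<exists>R C. ?P p R C" if p: "p \<in> frontier D" for p
  proof -
    have pU: "p \<in> U" using p U by blast
    have "p \<notin> A" using p A \<open>open D\<close> by (auto simp: frontier_def interior_open)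
    have "blinfun_apply (\<rho>' p) \<noteq> (\<lambda>v. 0)" using nz[OF p] frechet_derivative_at[OF der[OF pU]] by simp
    then have \<rho>'p: "\<rho>' p \<noteq> 0" by auto
    obtain K R1 c where K: "0 \<le> K" "0 < R1" "0 < c" "ball p R1 \<subseteq> U"
      and psh: "\<And>w. w \<in> ball p R1 \<Longrightarrow> strictly_psh_at c (\<lambda>z. \<rho> z + K * (\<rho> z)\<^sup>2) w"
      using strictly_psh_near[OF U(1) der der2 cont2 pU fr[OF p] levi[OF p]] by blast
    \<comment> \<open>With \<open>\<rho>\<close> this small, \<open>1 + K * \<rho>\<close> is
      positive, so \<open>\<rho> + K * \<rho>\<^sup>2\<close> inherits the sign of
      \<open>\<rho>\<close>.\<close>
    have "0 < 1 / (K + 1)" using K by simp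
    then obtain R2 where R2: "0 < R2" "\<And>w. w \<in> U \<Longrightarrow> dist w p < R2 \<Longrightarrow> dist (\<rho> w) (\<rho> p) < 1 / (K + 1)"
      using \<rho>_cont pU unfolding continuous_on_iff by meson
    define R3 where "R3 = min R1 R2"
    have R3: "0 < R3" "ball p R3 \<subseteq> U" "ball p R3 \<subseteq> ball p R1" using K R2 by (auto simp: R3_def)
    have small: "0 < 1 + K * \<rho> w" if "w \<in> ball p R3" for w
    proof -
      have "\<bar>\<rho> w\<bar> < 1 / (K + 1)"
        using R2(2)[of w] that R3 by (auto simp: R3_def fr[OF p] dist_commute)
      then have "(K + 1) * \<bar>\<rho> w\<bar> < 1" using K by (simp add: field_simps)
      moreover have "- (K * \<rho> w) \<le> (K + 1) * \<bar>\<rho> w\<bar>"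
      proof -
        have "K * (- \<rho> w) \<le> K * \<bar>\<rho> w\<bar>" using K by (intro mult_left_mono) auto
        then show ?thesis by (simp add: distrib_right)
      qed
      ultimately show ?thesis by linarith
    qed
    \<comment> \<open>The constant of the derivative bound for the radius \<open>R3 / 2\<close>
      around \<open>z\<close>; distances within \<open>D\<close> are at most
      \<open>2 * b\<close>.\<close>
    define C1 where "C1 = 12 / min c (c * (R3 / 2 / 2)\<^sup>2 / (2 * b)\<^sup>2)"
    have E1: "(cmod (deriv (\<lambda>\<zeta>. f \<zeta> $ i) 0))\<^sup>2 \<le> C1 * (- \<rho> z)"
      if z: "z \<in> D \<inter> ball p (R3 / 2)" and f: "analytic_disc D f" "f 0 = z" for z f i
    proof -
      have sub: "ball z (R3 / 2) \<subseteq> ball p R3"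
      proof
        fix y assume "y \<in> ball z (R3 / 2)"
        then show "y \<in> ball p R3" using z dist_triangle[of p y z] by auto
      qed
      have "(cmod (deriv (\<lambda>\<zeta>. f \<zeta> $ i) 0))\<^sup>2 \<le> C1 * (- (\<rho> z + K * (\<rho> z)\<^sup>2))"
        unfolding C1_def
      proof (rule disc_derivative_bound[OF \<open>open D\<close> _ _ _ _ _ _ _ f])
        show "0 < R3 / 2" "0 < c" "0 < 2 * b" using R3 K b by auto
        show "norm (w - z) \<le> 2 * b" if "w \<in> D" for w
          using norm_triangle_ineq4[of w z] b(2)[OF that] b(2)[of z] z by simp
        show "continuous_on (D \<inter> ball z (R3 / 2)) (\<lambda>z. \<rho> z + K * (\<rho> z)\<^sup>2)"
          by (intro continuous_intros continuous_on_subset[OF \<rho>_cont]) (use sub R3 in auto)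
        fix w assume w: "w \<in> D \<inter> ball z (R3 / 2)"
        then have w3: "w \<in> ball p R3" using sub by blast
        then show "strictly_psh_at c (\<lambda>z. \<rho> z + K * (\<rho> z)\<^sup>2) w" using psh R3 by blast
        have "\<rho> w < 0" using DU[of w] w w3 R3 by blast
        then have "\<rho> w * (1 + K * \<rho> w) < 0" using small[OF w3] by (simp add: mult_neg_pos)
        then show "\<rho> w + K * (\<rho> w)\<^sup>2 < 0" by (simp add: power2_eq_square algebra_simps)
      qed
      also have "\<dots> \<le> C1 * (- \<rho> z)"
        using K R3 b by (intro mult_left_mono) (auto simp: C1_def)
      finally show ?thesis .
    qed
    \<comment> \<open>The walk has to take place in \<open>D - A\<close>, so its neighbourhood of
      \<open>p\<close> is kept away from \<open>A\<close>.\<close>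
    have "open (U - A)" "p \<in> U - A" using U A finite_imp_closed pU \<open>p \<notin> A\<close> by blast+
    then obtain R0 where R0: "0 < R0" "ball p R0 \<subseteq> U - A" using open_contains_ball by blast
    obtain R4 C4 where R4: "0 < R4" "0 \<le> C4" and E2: "\<And>z. z \<in> ball p R4 \<Longrightarrow> \<rho> z < 0 \<Longrightarrow>
        kobayashi_dist (D - A) o' z \<le> C4 * (1 + \<bar>ln (- \<rho> z)\<bar>)"
    proof (rule kobayashi_dist_le_log_near[OF \<Omega>_open conn o' R0(1)])
      show "w \<in> D - A" if "w \<in> ball p R0" "\<rho> w < 0" for w using that R0 DU by blast
      show "(\<rho> has_derivative blinfun_apply (\<rho>' x)) (at x)" if "x \<in> ball p R0" for x
        using that R0 der by blast
      show "continuous_on (ball p R0) \<rho>'" by (rule continuous_on_subset[OF \<rho>'_cont]) (use R0 in blast)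
    qed (use fr[OF p] \<rho>'p in auto)
    define R where "R = min (R3 / 2) R4"
    define C where "C = max 1 (max C1 C4)"
    show ?thesis
    proof (intro exI conjI ballI allI impI)
      show "0 < R" "1 \<le> C" using R3 R4 by (auto simp: R_def C_def)
      show "ball p R \<subseteq> U" using R3 by (auto simp: R_def)
      fix z assume z: "z \<in> D \<inter> ball p R"
      then have "z \<in> ball p R3" using R3(1) by (auto simp: R_def)
      then have neg: "\<rho> z < 0" using z R3 DU by blast
      show "(cmod (deriv (\<lambda>\<zeta>. f \<zeta> $ i) 0))\<^sup>2 \<le> C * (- \<rho> z)" if "analytic_disc D f" "f 0 = z" for f i
      proof -
        have "(cmod (deriv (\<lambda>\<zeta>. f \<zeta> $ i) 0))\<^sup>2 \<le> C1 * (- \<rho> z)"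
          using E1[OF _ that] z by (simp add: R_def)
        also have "\<dots> \<le> C * (- \<rho> z)" using neg by (intro mult_right_mono) (auto simp: C_def)
        finally show ?thesis .
      qed
      have "kobayashi_dist (D - A) o' z \<le> C4 * (1 + \<bar>ln (- \<rho> z)\<bar>)"
        using E2[OF _ neg] z by (simp add: R_def)
      also have "\<dots> \<le> C * (1 + \<bar>ln (- \<rho> z)\<bar>)" by (intro mult_right_mono) (auto simp: C_def)
      finally show "kobayashi_dist (D - A) o' z \<le> C * (1 + \<bar>ln (- \<rho> z)\<bar>)" .
    qed
  qed
  then obtain R C where RC: "\<And>p. p \<in> frontier D \<Longrightarrow> ?P p (R p) (C p)" by metis
  have "compact (frontier D)" using \<open>bounded D\<close> by (rule compact_frontier_bounded)
  moreover have "frontier D \<subseteq> (\<Union>p\<in>frontier D. ball p (R p))"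
  proof
    fix p assume "p \<in> frontier D"
    then show "p \<in> (\<Union>p\<in>frontier D. ball p (R p))" using RC[of p] by (intro UN_I[of p]) auto
  qed
  ultimately obtain F where F: "F \<subseteq> frontier D" "finite F" "frontier D \<subseteq> (\<Union>p\<in>F. ball p (R p))"
    by (rule compactE_image[where f = "\<lambda>p. ball p (R p)", OF _ open_ball])
  define N where "N = (\<Union>p\<in>F. ball p (R p))"
  define C0 where "C0 = Max (insert 1 (C ` F))"
  have C_le: "C p \<le> C0" if "p \<in> F" for p using F(2) that by (simp add: C0_def)
  show thesis
  proof (rule that[of N C0])
    show "open N" "frontier D \<subseteq> N" using F by (auto simp: N_def)
    show "N \<subseteq> U" unfolding N_def using F(1) RC by blast
    show "1 \<le> C0" using F(2) by (simp add: C0_def)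
    fix z assume z: "z \<in> D \<inter> N"
    then obtain p where p: "p \<in> F" "z \<in> D \<inter> ball p (R p)" by (auto simp: N_def)
    have P: "?P p (R p) (C p)" using RC p(1) F(1) by blast
    have neg: "\<rho> z < 0" using P p(2) DU by blast
    show "(cmod (deriv (\<lambda>\<zeta>. f \<zeta> $ i) 0))\<^sup>2 \<le> C0 * (- \<rho> z)" if "analytic_disc D f" "f 0 = z" for f i
    proof -
      have "(cmod (deriv (\<lambda>\<zeta>. f \<zeta> $ i) 0))\<^sup>2 \<le> C p * (- \<rho> z)" using P p(2) that by blast
      also have "\<dots> \<le> C0 * (- \<rho> z)" using neg C_le[OF p(1)] by (intro mult_right_mono) auto
      finally show ?thesis .
    qed
    have "kobayashi_dist (D - A) o' z \<le> C p * (1 + \<bar>ln (- \<rho> z)\<bar>)" using P p(2) by blast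
    also have "\<dots> \<le> C0 * (1 + \<bar>ln (- \<rho> z)\<bar>)" using C_le[OF p(1)] by (intro mult_right_mono) auto
    finally show "kobayashi_dist (D - A) o' z \<le> C0 * (1 + \<bar>ln (- \<rho> z)\<bar>)" .
  qed
qed

text \<open>A small affine disc in direction \<open>v\<close> shows that the infimum runs over a
  non-empty set; only then does an upper bound for it produce a disc.\<close>

lemma kobayashi_metric_less_obtains:
  assumes "open \<Omega>" "z \<in> \<Omega>" "kobayashi_metric \<Omega> z v < c"
  obtains \<zeta> f where "cmod \<zeta> < c" "analytic_disc \<Omega> f" "f 0 = z" "\<zeta> *s disc_deriv f 0 = v"
proof -
  let ?S = "{cmod \<zeta> |\<zeta>. \<exists>f. analytic_disc \<Omega> f \<and> f 0 = z \<and> \<zeta> *s disc_deriv f 0 = v}"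
  obtain s where s: "0 < s" "ball z s \<subseteq> \<Omega>" using assms(1,2) open_contains_ball by blast
  \<comment> \<open>The summand \<open>1\<close> covers \<open>v = 0\<close> without a case
    distinction.\<close>
  define u where "u = of_real (s / (norm v + 1)) *s v"
  have pos: "0 < norm v + 1" by (simp add: add_nonneg_pos)
  have "norm u = \<bar>s / (norm v + 1)\<bar> * norm v"
    unfolding u_def norm_vector_scalar_mult norm_of_real ..
  also have "\<bar>s / (norm v + 1)\<bar> = s / (norm v + 1)" using s pos by (intro abs_of_pos divide_pos_pos)
  also have "s / (norm v + 1) * norm v \<le> s" using s pos by (simp add: field_simps)
  finally have "analytic_disc \<Omega> (\<lambda>\<zeta>. z + \<zeta> *s u)" using s by (intro analytic_disc_affine[of z s])
  moreover have "disc_deriv (\<lambda>\<zeta>. z + \<zeta> *s u) 0 = u"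
  proof -
    have "((\<lambda>\<xi>. z $ i + \<xi> * u $ i) has_field_derivative u $ i) (at 0)" for i
      by (auto intro!: derivative_eq_intros)
    then have "deriv (\<lambda>\<xi>. z $ i + \<xi> * u $ i) 0 = u $ i" for i by (rule DERIV_imp_deriv)
    then show ?thesis by (simp add: disc_deriv_def vec_eq_iff)
  qed
  moreover have "of_real ((norm v + 1) / s) *s u = v"
  proof -
    have "complex_of_real ((norm v + 1) / s) * of_real (s / (norm v + 1)) = of_real ((norm v + 1) / s * (s / (norm v + 1)))"
      by (rule of_real_mult[symmetric])
    also have "(norm v + 1) / s * (s / (norm v + 1)) = 1" using s pos by simp
    finally show ?thesis by (simp only: u_def vector_smult_assoc of_real_1 vector_smult_lid)
  qed
  ultimately have "\<exists>f. analytic_disc \<Omega> f \<and> f 0 = z \<and> of_real ((norm v + 1) / s) *s disc_deriv f 0 = v"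
    by (intro exI[of _ "\<lambda>\<zeta>. z + \<zeta> *s u"] conjI) (simp_all only: vector_smult_lzero add_0_right)
  then have "?S \<noteq> {}" by blast
  moreover have "Inf ?S < c" using assms(3) by (simp add: kobayashi_metric_def)
  ultimately obtain r where r: "r \<in> ?S" "r < c" using cInf_lessD[of ?S c] by blast
  from r(1) obtain \<zeta> f where "r = cmod \<zeta>" "analytic_disc \<Omega> f" "f 0 = z" "\<zeta> *s disc_deriv f 0 = v"
    by blast
  then show thesis using that r(2) by blast
qed

section \<open>Continuity and displacement of absolutely continuous curves\<close>

lemma abs_continuous_on_imp_continuous_on:
  assumes "abs_continuous_on I \<sigma>"
  shows "continuous_on I \<sigma>"
  unfolding continuous_on_iff
proof (intro ballI allI impI)
  fix s and e :: real assume "s \<in> I" "e > 0"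
  then obtain \<delta> where \<delta>: "\<delta> > 0" "\<And>(n::nat) l r.
      (\<forall>i<n. l i \<in> I \<and> r i \<in> I \<and> l i \<le> r i) \<and>
      disjoint_family_on (\<lambda>i. {l i<..<r i}) {..<n} \<and>
      (\<Sum>i<n. r i - l i) < \<delta> \<Longrightarrow> (\<Sum>i<n. dist (\<sigma> (l i)) (\<sigma> (r i))) < e"
    using assms unfolding abs_continuous_on_def by meson
  have "dist (\<sigma> t) (\<sigma> s) < e" if "t \<in> I" "dist t s < \<delta>" for t
    using \<delta>(2)[of 1 "\<lambda>_. min s t" "\<lambda>_. max s t"] that \<open>s \<in> I\<close>
    by (cases "s \<le> t") (auto simp: disjoint_family_on_def dist_real_def dist_commute)
  then show "\<exists>d>0. \<forall>t\<in>I. dist t s < d \<longrightarrow> dist (\<sigma> t) (\<sigma> s) < e" using \<delta>(1) by blast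
qed

lemma abs_continuous_on_subset:
  "abs_continuous_on I \<sigma> \<Longrightarrow> J \<subseteq> I \<Longrightarrow> abs_continuous_on J \<sigma>"
  unfolding abs_continuous_on_def by (meson subsetD)

text \<open>The majorant has an explicit antiderivative on either side of \<open>t0\<close>, and
  each side contributes at most \<open>H / \<gamma>\<close>. The bound does not depend on the length
  of the interval.\<close>

lemma abs_continuous_exp_decay_bound:
  fixes \<sigma> :: "real \<Rightarrow> 'a::real_normed_vector"
  assumes ac: "abs_continuous_on {a..b} \<sigma>" and t0: "t0 \<in> {a..b}" and pos: "0 < \<gamma>" "0 \<le> H"
    and ae: "AE t in lborel. t \<in> {a..b} \<longrightarrow>
      (\<exists>v. (\<sigma> has_vector_derivative v) (at t within {a..b}) \<and> norm v \<le> H * exp (- \<gamma> * \<bar>t - t0\<bar>))"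
  shows "norm (\<sigma> b - \<sigma> a) \<le> 2 * H / \<gamma>"
proof -
  have sub1: "{t0..b} \<subseteq> {a..b}" and sub2: "{a..t0} \<subseteq> {a..b}" using t0 by auto
  have "norm (\<sigma> b - \<sigma> t0) \<le> (- (H / \<gamma>) * exp (- \<gamma> * (b - t0))) - (- (H / \<gamma>) * exp (- \<gamma> * (t0 - t0)))"
  proof (rule abs_continuous_norm_le_increment[where g = "\<lambda>t. H * exp (- \<gamma> * (t - t0))"])
    show "abs_continuous_on {t0..b} \<sigma>" using abs_continuous_on_subset[OF ac] t0 by simp
    show "AE t in lborel. t \<in> {t0..b} \<longrightarrow>
      (\<exists>v. (\<sigma> has_vector_derivative v) (at t within {t0..b}) \<and> norm v \<le> H * exp (- \<gamma> * (t - t0)))"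
      using ae
    proof eventually_elim
      case (elim t)
      show ?case
      proof
        assume t: "t \<in> {t0..b}"
        then obtain v where "(\<sigma> has_vector_derivative v) (at t within {a..b})" "norm v \<le> H * exp (- \<gamma> * (t - t0))"
          using elim t0 by auto
        then show "\<exists>v. (\<sigma> has_vector_derivative v) (at t within {t0..b}) \<and> norm v \<le> H * exp (- \<gamma> * (t - t0))"
          using t0 has_vector_derivative_within_subset[of \<sigma> _ t "{a..b}"] by (metis sub1)
      qed
    qed
    show "((\<lambda>t. - (H / \<gamma>) * exp (- \<gamma> * (t - t0))) has_real_derivative H * exp (- \<gamma> * (t - t0))) (at t)" for t
      using pos by (auto intro!: derivative_eq_intros)
  qed (use t0 pos in auto)
  also have "\<dots> \<le> H / \<gamma>" using pos by simp
  finally have 1: "norm (\<sigma> b - \<sigma> t0) \<le> H / \<gamma>" .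
  have "norm (\<sigma> t0 - \<sigma> a) \<le> (H / \<gamma>) * exp (\<gamma> * (t0 - t0)) - (H / \<gamma>) * exp (\<gamma> * (a - t0))"
  proof (rule abs_continuous_norm_le_increment[where g = "\<lambda>t. H * exp (\<gamma> * (t - t0))"])
    show "abs_continuous_on {a..t0} \<sigma>" using abs_continuous_on_subset[OF ac] t0 by simp
    show "AE t in lborel. t \<in> {a..t0} \<longrightarrow>
      (\<exists>v. (\<sigma> has_vector_derivative v) (at t within {a..t0}) \<and> norm v \<le> H * exp (\<gamma> * (t - t0)))"
      using ae
    proof eventually_elim
      case (elim t)
      show ?case
      proof
        assume t: "t \<in> {a..t0}"
        then have "- \<gamma> * \<bar>t - t0\<bar> = \<gamma> * (t - t0)" by (simp add: abs_if algebra_simps)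
        then obtain v where "(\<sigma> has_vector_derivative v) (at t within {a..b})" "norm v \<le> H * exp (\<gamma> * (t - t0))"
          using elim t t0 by auto
        then show "\<exists>v. (\<sigma> has_vector_derivative v) (at t within {a..t0}) \<and> norm v \<le> H * exp (\<gamma> * (t - t0))"
          using t0 has_vector_derivative_within_subset[of \<sigma> _ t "{a..b}"] by (metis sub2)
      qed
    qed
    show "((\<lambda>t. (H / \<gamma>) * exp (\<gamma> * (t - t0))) has_real_derivative H * exp (\<gamma> * (t - t0))) (at t)" for t
      using pos by (auto intro!: derivative_eq_intros)
  qed (use t0 pos in auto)
  also have "\<dots> \<le> H / \<gamma>" using pos by simp
  finally have "norm (\<sigma> t0 - \<sigma> a) \<le> H / \<gamma>" .
  with 1 show ?thesis
    using norm_triangle_ineq[of "\<sigma> b - \<sigma> t0" "\<sigma> t0 - \<sigma> a"] by simp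
qed

section \<open>Visibility\<close>

text \<open>The infimum need not be attained, so a disc is taken at the slightly larger level
  \<open>l + 1\<close>. The dimension enters through the sum over coordinates.\<close>

lemma kobayashi_metric_norm_le:
  fixes v :: "complex^'n"
  assumes "open \<Omega>" "z \<in> \<Omega>" "kobayashi_metric \<Omega> z v \<le> l" "0 \<le> l"
    and B: "\<And>f i. analytic_disc \<Omega> f \<Longrightarrow> f 0 = z \<Longrightarrow> cmod (deriv (\<lambda>\<zeta>. f \<zeta> $ i) 0) \<le> B"
  shows "norm v \<le> real CARD('n) * ((l + 1) * B)"
proof -
  have "kobayashi_metric \<Omega> z v < l + 1" using assms(3) by simp
  then obtain \<zeta> f where f: "cmod \<zeta> < l + 1" "analytic_disc \<Omega> f" "f 0 = z" "\<zeta> *s disc_deriv f 0 = v"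
    using kobayashi_metric_less_obtains[OF assms(1,2)] by blast
  have le: "cmod (v $ i) \<le> (l + 1) * B" for i
  proof -
    have "v $ i = \<zeta> * deriv (\<lambda>\<zeta>. f \<zeta> $ i) 0"
      unfolding f(4)[symmetric] by (simp add: disc_deriv_def)
    then have "cmod (v $ i) = cmod \<zeta> * cmod (deriv (\<lambda>\<zeta>. f \<zeta> $ i) 0)" by (simp only: norm_mult)
    also have "\<dots> \<le> (l + 1) * B"
      using f(1) B[OF f(2,3)] assms(4) by (intro mult_mono) auto
    finally show ?thesis .
  qed
  have "norm v \<le> (\<Sum>i\<in>UNIV. cmod (v $ i))"
    unfolding norm_vec_def by (rule L2_set_le_sum) simp
  also have "\<dots> \<le> (\<Sum>i\<in>(UNIV :: 'n set). (l + 1) * B)" by (intro sum_mono le)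
  finally show ?thesis by simp
qed

text \<open>The exponent \<open>4\<close> leaves room to split \<open>sqrt (h z)\<close>: with
  \<open>y = - ln (h z)\<close>, the exponent \<open>- y / 2\<close> is twice
  \<open>- y / 4\<close>. One quarter is at most \<open>ln s\<close>, the other gives decay in time
  at rate \<open>1 / (8 * C * l)\<close>; twice the inverse rate is the factor
  \<open>16 * C * l\<close>.\<close>

lemma almost_geodesic_near_boundary_short:
  fixes \<Omega> :: "(complex^'n) set" and h :: "complex^'n \<Rightarrow> real"
  assumes \<Omega>: "open \<Omega>" "connected \<Omega>" "o' \<in> \<Omega>" and "1 \<le> l" "0 \<le> \<kappa>" "1 \<le> C"
    and geo: "almost_geodesic \<Omega> l \<kappa> {a..b} \<sigma>" and "a \<le> b"
    and "0 < s" "s < 1"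
    and cont: "continuous_on (\<sigma> ` {a..b}) h"
    and h: "\<And>z. z \<in> \<sigma> ` {a..b} \<Longrightarrow> 0 < h z" "\<And>z. z \<in> \<sigma> ` {a..b} \<Longrightarrow> h z \<le> s ^ 4"
    and disc: "\<And>z f i. z \<in> \<sigma> ` {a..b} \<Longrightarrow> analytic_disc \<Omega> f \<Longrightarrow> f 0 = z \<Longrightarrow>
      (cmod (deriv (\<lambda>\<zeta>. f \<zeta> $ i) 0))\<^sup>2 \<le> C * h z"
    and dist: "\<And>z. z \<in> \<sigma> ` {a..b} \<Longrightarrow> kobayashi_dist \<Omega> o' z \<le> C * (1 + \<bar>ln (h z)\<bar>)"
  shows "norm (\<sigma> b - \<sigma> a) \<le> 16 * C * l * (real CARD('n) * (l + 1) * sqrt C * exp ((\<kappa> + 2 * C) / (8 * C))) * s"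
proof -
  have \<sigma>_in: "\<And>t. t \<in> {a..b} \<Longrightarrow> \<sigma> t \<in> \<Omega>"
    and lower: "\<And>s t. s \<in> {a..b} \<Longrightarrow> t \<in> {a..b} \<Longrightarrow> \<bar>t - s\<bar> / l - \<kappa> \<le> kobayashi_dist \<Omega> (\<sigma> s) (\<sigma> t)"
    and ac: "abs_continuous_on {a..b} \<sigma>"
    and ae: "AE t in lborel. t \<in> {a..b} \<longrightarrow>
        (\<exists>v. (\<sigma> has_vector_derivative v) (at t within {a..b}) \<and> kobayashi_metric \<Omega> (\<sigma> t) v \<le> l)"
    using geo unfolding almost_geodesic_def by blast+
  define y where "y t = - ln (h (\<sigma> t))" for t
  have y_ge: "- 4 * ln s \<le> y t" if "t \<in> {a..b}" for t
  proof -
    have "ln (h (\<sigma> t)) \<le> ln (s ^ 4)"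
      using h(1)[of "\<sigma> t"] h(2)[of "\<sigma> t"] that \<open>0 < s\<close> by (subst ln_le_cancel_iff) auto
    then show ?thesis by (simp add: y_def ln_realpow)
  qed
  have ln_s: "ln s < 0" using \<open>0 < s\<close> \<open>s < 1\<close> by simp
  have "continuous_on {a..b} (\<lambda>t. h (\<sigma> t))"
    by (rule continuous_on_compose2[OF cont abs_continuous_on_imp_continuous_on[OF ac]]) simp
  moreover have "{a..b} \<noteq> {}" using \<open>a \<le> b\<close> by simp
  ultimately obtain t0 where t0: "t0 \<in> {a..b}" "\<And>t. t \<in> {a..b} \<Longrightarrow> h (\<sigma> t) \<le> h (\<sigma> t0)"
    using continuous_attains_sup[OF compact_Icc, of a b "\<lambda>t. h (\<sigma> t)"] by blast
  have y_t0: "y t0 \<le> y t" if "t \<in> {a..b}" for t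
    using t0 h(1) that by (simp add: y_def)
  have K_le: "kobayashi_dist \<Omega> o' (\<sigma> t) \<le> C * (1 + y t)" if "t \<in> {a..b}" for t
  proof -
    have "\<bar>ln (h (\<sigma> t))\<bar> = y t" using y_ge[OF that] ln_s by (simp add: y_def)
    then show ?thesis using dist[of "\<sigma> t"] that by simp
  qed
  \<comment> \<open>The depth \<open>h\<close> is largest at \<open>t0\<close>, so the time \<open>|t - t0|\<close> is controlled by \<open>y t\<close> alone; averaging this
    bound with \<open>y t \<ge> - 4 ln s\<close> yields both smallness and exponential decay.\<close>
  define \<gamma> where "\<gamma> = 1 / (8 * C * l)"
  have pos: "0 < l" "0 < C" "0 < \<gamma>" using \<open>1 \<le> l\<close> \<open>1 \<le> C\<close> by (auto simp: \<gamma>_def)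
  have decay: "sqrt (h (\<sigma> t)) \<le> s * exp ((\<kappa> + 2 * C) / (8 * C)) * exp (- \<gamma> * \<bar>t - t0\<bar>)"
    if t: "t \<in> {a..b}" for t
  proof -
    have "\<bar>t - t0\<bar> / l - \<kappa> \<le> kobayashi_dist \<Omega> (\<sigma> t0) (\<sigma> t)" by (rule lower[OF t0(1) t])
    also have "\<dots> \<le> kobayashi_dist \<Omega> (\<sigma> t0) o' + kobayashi_dist \<Omega> o' (\<sigma> t)"
      by (rule kobayashi_dist_triangle[OF \<Omega>(1,2) \<sigma>_in[OF t0(1)] \<Omega>(3) \<sigma>_in[OF t]])
    also have "\<dots> \<le> C * (1 + y t0) + C * (1 + y t)"
      using K_le[OF t0(1)] K_le[OF t] by (simp add: kobayashi_dist_commute[of \<Omega> _ o'])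
    also have "\<dots> \<le> C * (1 + y t) + C * (1 + y t)"
      using y_t0[OF t] pos by (intro add_mono mult_left_mono) auto
    finally have "\<bar>t - t0\<bar> / l - \<kappa> - 2 * C \<le> 2 * C * y t" by (simp add: algebra_simps)
    then have "(\<bar>t - t0\<bar> / l - \<kappa> - 2 * C) / (8 * C) \<le> 2 * C * y t / (8 * C)"
      using pos by (intro divide_right_mono) auto
    also have "2 * C * y t / (8 * C) = y t / 4" using pos by simp
    also have "(\<bar>t - t0\<bar> / l - \<kappa> - 2 * C) / (8 * C) = \<gamma> * \<bar>t - t0\<bar> - (\<kappa> + 2 * C) / (8 * C)"
      using pos by (simp add: \<gamma>_def field_simps)
    finally have "- y t / 2 \<le> ln s + (\<kappa> + 2 * C) / (8 * C) + - \<gamma> * \<bar>t - t0\<bar>"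
      using y_ge[OF t] by linarith
    then have "exp (- y t / 2) \<le> exp (ln s + (\<kappa> + 2 * C) / (8 * C) + - \<gamma> * \<bar>t - t0\<bar>)" by simp
    also have "\<dots> = s * exp ((\<kappa> + 2 * C) / (8 * C)) * exp (- \<gamma> * \<bar>t - t0\<bar>)"
      using \<open>0 < s\<close> by (simp only: exp_add exp_ln)
    also have "exp (- y t / 2) = sqrt (h (\<sigma> t))"
    proof (rule real_sqrt_unique[symmetric])
      have "(exp (- y t / 2))\<^sup>2 = exp (- y t)" by (simp add: exp_double[symmetric])
      then show "(exp (- y t / 2))\<^sup>2 = h (\<sigma> t)" using h(1)[of "\<sigma> t"] t by (simp add: y_def)
    qed simp
    finally show ?thesis .
  qed
  define E where "E = real CARD('n) * (l + 1) * sqrt C * exp ((\<kappa> + 2 * C) / (8 * C))"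
  have "0 \<le> E" using pos by (simp add: E_def)
  have "norm (\<sigma> b - \<sigma> a) \<le> 2 * (E * s) / \<gamma>"
  proof (rule abs_continuous_exp_decay_bound[OF ac t0(1) pos(3)])
    show "0 \<le> E * s" using \<open>0 \<le> E\<close> \<open>0 < s\<close> by simp
    show "AE t in lborel. t \<in> {a..b} \<longrightarrow> (\<exists>v. (\<sigma> has_vector_derivative v) (at t within {a..b}) \<and>
        norm v \<le> E * s * exp (- \<gamma> * \<bar>t - t0\<bar>))"
      using ae
    proof eventually_elim
      case (elim t)
      show ?case
      proof
        assume t: "t \<in> {a..b}"
        then obtain v where v: "(\<sigma> has_vector_derivative v) (at t within {a..b})"
          "kobayashi_metric \<Omega> (\<sigma> t) v \<le> l" using elim by blast
        have \<sigma>t: "\<sigma> t \<in> \<sigma> ` {a..b}" using t by simp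
        have "cmod (deriv (\<lambda>\<zeta>. f \<zeta> $ i) 0) \<le> sqrt (C * h (\<sigma> t))"
          if "analytic_disc \<Omega> f" "f 0 = \<sigma> t" for f i
          using disc[OF \<sigma>t that] by (rule real_le_rsqrt)
        then have "norm v \<le> real CARD('n) * ((l + 1) * sqrt (C * h (\<sigma> t)))"
          using kobayashi_metric_norm_le[OF \<Omega>(1) \<sigma>_in[OF t] v(2)] pos by simp
        also have "\<dots> = (real CARD('n) * (l + 1) * sqrt C) * sqrt (h (\<sigma> t))"
          by (simp add: real_sqrt_mult)
        also have "\<dots> \<le> (real CARD('n) * (l + 1) * sqrt C) *
            (s * exp ((\<kappa> + 2 * C) / (8 * C)) * exp (- \<gamma> * \<bar>t - t0\<bar>))"
          using decay[OF t] pos by (intro mult_left_mono) auto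
        also have "\<dots> = E * s * exp (- \<gamma> * \<bar>t - t0\<bar>)" by (simp add: E_def mult_ac)
        finally show "\<exists>v. (\<sigma> has_vector_derivative v) (at t within {a..b}) \<and>
            norm v \<le> E * s * exp (- \<gamma> * \<bar>t - t0\<bar>)" using v(1) by blast
      qed
    qed
  qed
  also have "\<dots> = 16 * C * l * E * s" by (simp add: \<gamma>_def)
  finally show ?thesis by (simp add: E_def)
qed

lemma finite_separated_cballs:
  fixes A :: "'a::metric_space set"
  assumes "finite A" "A \<subseteq> D" "open D" "0 < d"
  obtains r where "0 < r" "r < d" "\<And>x. x \<in> A \<Longrightarrow> cball x r \<subseteq> D"
    "\<And>x y. x \<in> A \<Longrightarrow> y \<in> A \<Longrightarrow> x \<noteq> y \<Longrightarrow> ball x r \<inter> ball y r = {}"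
proof -
  have "\<exists>e>0. cball x e \<subseteq> D \<and> (\<forall>y\<in>A. y \<noteq> x \<longrightarrow> e \<le> dist x y)" if "x \<in> A" for x
  proof -
    obtain e1 where e1: "0 < e1" "cball x e1 \<subseteq> D" using assms(2,3) \<open>x \<in> A\<close> open_contains_cball by blast
    obtain e2 where e2: "0 < e2" "\<forall>y\<in>A. y \<noteq> x \<longrightarrow> e2 \<le> dist x y"
      using finite_set_avoid[OF assms(1)] by metis
    show ?thesis using e1 e2 by (intro exI[of _ "min e1 e2"]) auto
  qed
  then obtain e where e: "\<And>x. x \<in> A \<Longrightarrow> 0 < e x" "\<And>x. x \<in> A \<Longrightarrow> cball x (e x) \<subseteq> D"
    "\<And>x y. x \<in> A \<Longrightarrow> y \<in> A \<Longrightarrow> y \<noteq> x \<Longrightarrow> e x \<le> dist x y"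
    by metis
  \<comment> \<open>Halving makes balls around different points disjoint and \<open>r < d\<close>
    strict; inserting \<open>d\<close> also covers an empty \<open>A\<close>.\<close>
  define r where "r = Min (insert d (e ` A)) / 2"
  have "0 < Min (insert d (e ` A))" using assms(1,4) e(1) by (subst Min_gr_iff) auto
  then have r: "0 < r" by (simp add: r_def)
  have "Min (insert d (e ` A)) \<le> d" using assms(1) by (intro Min_le) auto
  then have "r < d" using r by (simp add: r_def)
  have re: "2 * r \<le> e x" if "x \<in> A" for x
    using assms(1) that by (simp add: r_def Min_le)
  show thesis
  proof (rule that[OF r \<open>r < d\<close>])
    show "cball x r \<subseteq> D" if "x \<in> A" for x
      using e(2)[OF that] re[OF that] r by auto
    show "ball x r \<inter> ball y r = {}" if "x \<in> A" "y \<in> A" "x \<noteq> y" for x y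
    proof -
      have "2 * r \<le> dist x y" using e(3)[of x y] re[of x] that by force
      then have "\<not> (dist x z < r \<and> dist y z < r)" for z using dist_triangle2[of x y z] by linarith
      then show ?thesis by auto
    qed
  qed
qed

text \<open>The frontier of \<open>D - A\<close> consists of the frontier of \<open>D\<close> and of
  \<open>A\<close>. Removing from \<open>closure D\<close> a thin collar of the one and small balls
  around the other leaves the compact set. Curves confined to one of the removed pieces are shown to
  have end points closer than \<open>V\<close> and \<open>W\<close> permit.\<close>

lemma visibility_domain_strongly_pseudoconvex_minus_finite:
  fixes D A :: "(complex^'n) set"
  assumes "is_domain D" "bounded D" "is_domain (D - A)"
    and slp: "strongly_levi_pseudoconvex D" and A: "A \<subseteq> D" "finite A"
  shows "visibility_domain (D - A)"
  unfolding visibility_domain_def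
proof (intro conjI allI impI ballI)
  show "is_domain (D - A)" by fact
  show "bounded (D - A)" using \<open>bounded D\<close> by (rule bounded_subset) auto
  have "open D" using \<open>is_domain D\<close> by (simp add: is_domain_def)
  obtain o' where \<Omega>: "open (D - A)" "connected (D - A)" "o' \<in> D - A"
    using \<open>is_domain (D - A)\<close> by (auto simp: is_domain_def)
  obtain U \<rho> where def: "C2_defining_function D U \<rho>"
    and levi: "\<forall>p\<in>frontier D. \<forall>v\<in>complex_tangent_space \<rho> p. v \<noteq> 0 \<longrightarrow> levi_form \<rho> p v > 0"
    using slp unfolding strongly_levi_pseudoconvex_def by blast
  obtain N C where N: "open N" "frontier D \<subseteq> N" "N \<subseteq> U" and C: "1 \<le> C"
    and E1: "\<And>z f i. z \<in> D \<inter> N \<Longrightarrow> analytic_disc D f \<Longrightarrow> f 0 = z \<Longrightarrow>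
      (cmod (deriv (\<lambda>\<zeta>. f \<zeta> $ i) 0))\<^sup>2 \<le> C * (- \<rho> z)"
    and E2: "\<And>z. z \<in> D \<inter> N \<Longrightarrow> kobayashi_dist (D - A) o' z \<le> C * (1 + \<bar>ln (- \<rho> z)\<bar>)"
    using boundary_estimates[OF \<open>open D\<close> \<open>bounded D\<close> def _ A(2,1) \<Omega>(2,3)] levi by metis
  have DU: "\<And>z. z \<in> U \<Longrightarrow> z \<in> D \<longleftrightarrow> \<rho> z < 0" and fr: "\<And>p. p \<in> frontier D \<Longrightarrow> \<rho> p = 0"
    using def unfolding C2_defining_function_def by blast+
  have \<rho>_cont: "continuous_on U \<rho>"
    using def unfolding C2_defining_function_def C2_on_def
    by (meson has_derivative_continuous continuous_at_imp_continuous_on)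
  fix l \<kappa> :: real and \<xi> \<eta> and V W :: "(complex^'n) set"
  assume l: "1 \<le> l" and \<kappa>: "0 \<le> \<kappa>"
    and VW: "\<xi> \<noteq> \<eta> \<and> openin (top_of_set (closure (D - A))) V \<and> openin (top_of_set (closure (D - A))) W \<and>
        \<xi> \<in> V \<and> \<eta> \<in> W \<and> closure V \<inter> closure W = {}"
  have "V \<subseteq> closure (D - A)" using VW openin_imp_subset by blast
  then have "bounded V"
    using bounded_closure[OF \<open>bounded (D - A)\<close>] bounded_subset by blast
  then have "compact (closure V)" by (simp add: compact_closure)
  then obtain d where d: "0 < d" "\<And>x y. x \<in> closure V \<Longrightarrow> y \<in> closure W \<Longrightarrow> d \<le> dist x y"
    using separate_compact_closed[OF _ closed_closure, of "closure V" W] VW by blast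
  have d: "0 < d" "\<And>x y. x \<in> V \<Longrightarrow> y \<in> W \<Longrightarrow> d \<le> dist x y"
    using d closure_subset by blast+
  \<comment> \<open>Two points in one ball of radius \<open>r\<close> are closer than
    \<open>d\<close>.\<close>
  obtain r where r: "0 < r" "r < d / 2" "\<And>x. x \<in> A \<Longrightarrow> cball x r \<subseteq> D"
    "\<And>x y. x \<in> A \<Longrightarrow> y \<in> A \<Longrightarrow> x \<noteq> y \<Longrightarrow> ball x r \<inter> ball y r = {}"
    using finite_separated_cballs[OF A(2,1) \<open>open D\<close>, of "d / 2"] d(1) by auto
  define M where "M = 16 * C * l * (real CARD('n) * (l + 1) * sqrt C * exp ((\<kappa> + 2 * C) / (8 * C)))"
  have "0 < M" using C l by (simp add: M_def)
  \<comment> \<open>This makes the displacement bound \<open>M * s\<close> at most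
    \<open>d / 2\<close>; the cap \<open>1 / 2\<close> ensures \<open>s < 1\<close>.\<close>
  define s where "s = min (1 / 2) (d / (2 * M))"
  have s: "0 < s" "s < 1" "M * s < d"
  proof -
    show "0 < s" "s < 1" using d \<open>0 < M\<close> by (auto simp: s_def)
    have "M * s \<le> M * (d / (2 * M))" using \<open>0 < M\<close> by (intro mult_left_mono) (auto simp: s_def)
    then show "M * s < d" using \<open>0 < M\<close> d(1) by simp
  qed
  \<comment> \<open>Cutting out the closed balls makes \<open>O1\<close> and \<open>O2\<close>
    disjoint open sets, so that connectedness applies; the level condition supplies the depth
    \<open>s ^ 4\<close> required by the displacement bound.\<close>
  define O1 where "O1 = (N - (\<Union>x\<in>A. cball x r)) \<inter> \<rho> -` {- (s ^ 4)<..<s ^ 4}"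
  define O2 where "O2 = (\<Union>x\<in>A. ball x r)"
  have "closed (\<Union>x\<in>A. cball x r)" using A(2) by (intro closed_UN) auto
  then have "open (N - (\<Union>x\<in>A. cball x r))" using N(1) by (intro open_Diff)
  moreover have "continuous_on (N - (\<Union>x\<in>A. cball x r)) \<rho>"
    by (rule continuous_on_subset[OF \<rho>_cont]) (use N(3) in blast)
  ultimately have O1_open: "open O1"
    unfolding O1_def by (intro continuous_open_preimage) auto
  have fr_O1: "frontier D \<subseteq> O1"
  proof
    fix p assume p: "p \<in> frontier D"
    then have "p \<notin> D" using \<open>open D\<close> by (simp add: frontier_def interior_open)
    then have "p \<notin> (\<Union>x\<in>A. cball x r)" using r(3) by blast
    then show "p \<in> O1" using p N(2) fr[OF p] s(1) by (auto simp: O1_def)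
  qed
  show "\<exists>K. compact K \<and> K \<subseteq> D - A \<and> (\<forall>a b \<sigma>. a \<le> b \<and> almost_geodesic (D - A) l \<kappa> {a..b} \<sigma> \<and>
      \<sigma> a \<in> V \<and> \<sigma> b \<in> W \<longrightarrow> \<sigma> ` {a..b} \<inter> K \<noteq> {})"
  proof (intro exI conjI allI impI)
    show "compact (closure D - (O1 \<union> O2))"
      using \<open>bounded D\<close> O1_open by (intro compact_diff) (auto simp: compact_closure O2_def)
    show "closure D - (O1 \<union> O2) \<subseteq> D - A"
    proof
      fix x assume x: "x \<in> closure D - (O1 \<union> O2)"
      then have "x \<in> D" using fr_O1 \<open>open D\<close> by (auto simp: frontier_def interior_open)
      moreover have "x \<notin> A" using x r(1) by (auto simp: O2_def)
      ultimately show "x \<in> D - A" by blast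
    qed
    fix a b :: real and \<sigma>
    assume geo: "a \<le> b \<and> almost_geodesic (D - A) l \<kappa> {a..b} \<sigma> \<and> \<sigma> a \<in> V \<and> \<sigma> b \<in> W"
    have \<sigma>_in: "\<sigma> ` {a..b} \<subseteq> D - A" and ac: "abs_continuous_on {a..b} \<sigma>"
      using geo unfolding almost_geodesic_def by blast+
    have ends: "\<sigma> a \<in> \<sigma> ` {a..b}" "\<sigma> b \<in> \<sigma> ` {a..b}" using geo by auto
    have conn: "connected (\<sigma> ` {a..b})"
      by (intro connected_continuous_image abs_continuous_on_imp_continuous_on[OF ac] connected_Icc)
    have far: "d \<le> norm (\<sigma> b - \<sigma> a)"
      using d(2)[of "\<sigma> a" "\<sigma> b"] geo by (simp add: dist_norm norm_minus_commute)
    show "\<sigma> ` {a..b} \<inter> (closure D - (O1 \<union> O2)) \<noteq> {}"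
    proof
      assume "\<sigma> ` {a..b} \<inter> (closure D - (O1 \<union> O2)) = {}"
      then have cover: "\<sigma> ` {a..b} \<subseteq> O1 \<union> O2" using \<sigma>_in closure_subset by blast
      show False
      proof (cases "\<sigma> a \<in> O1")
        case True
        have disj: "O1 \<inter> O2 = {}" using ball_subset_cball by (fastforce simp: O1_def O2_def)
        have "open O2" by (auto simp: O2_def)
        then have "O2 \<inter> \<sigma> ` {a..b} = {}"
          using connectedD[OF conn O1_open, of O2] disj cover True ends(1) by blast
        then have sub: "\<sigma> ` {a..b} \<subseteq> O1" using cover by blast
        have sub_N: "z \<in> D \<inter> N \<and> \<bar>\<rho> z\<bar> < s ^ 4 \<and> \<rho> z < 0" if "z \<in> \<sigma> ` {a..b}" for z
          using subsetD[OF sub that] subsetD[OF \<sigma>_in that] N(3) DU[of z] by (auto simp: O1_def)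
        have "norm (\<sigma> b - \<sigma> a) \<le> M * s"
          unfolding M_def
        proof (rule almost_geodesic_near_boundary_short[OF \<Omega> l \<kappa> C, where h = "\<lambda>z. - \<rho> z"])
          show "almost_geodesic (D - A) l \<kappa> {a..b} \<sigma>" "a \<le> b" "0 < s" "s < 1" using geo s by auto
          show "continuous_on (\<sigma> ` {a..b}) (\<lambda>z. - \<rho> z)"
            by (intro continuous_intros continuous_on_subset[OF \<rho>_cont]) (use sub_N N(3) in blast)
          fix z assume z: "z \<in> \<sigma> ` {a..b}"
          note zN = sub_N[OF z]
          then show "0 < - \<rho> z" "- \<rho> z \<le> s ^ 4" by auto
          show "kobayashi_dist (D - A) o' z \<le> C * (1 + \<bar>ln (- \<rho> z)\<bar>)" using zN by (intro E2) simp
          \<comment> \<open>A disc in \<open>D - A\<close> is in particular a disc in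
            \<open>D\<close>, where the bound was proved.\<close>
          show "(cmod (deriv (\<lambda>\<zeta>. f \<zeta> $ i) 0))\<^sup>2 \<le> C * - \<rho> z"
            if "analytic_disc (D - A) f" "f 0 = z" for f i
            using zN that by (intro E1) (auto simp: analytic_disc_def)
        qed
        then show False using far s(3) by simp
      next
        case False
        then obtain x where x: "x \<in> A" "\<sigma> a \<in> ball x r" using cover ends(1) by (auto simp: O2_def)
        \<comment> \<open>All removed pieces other than the ball around \<open>x\<close>; being
          disjoint from that ball, they cannot be reached by a connected curve starting in
          it.\<close>
        define O3 where "O3 = O1 \<union> (\<Union>y\<in>A - {x}. ball y r)"
        have "open O3" using O1_open by (auto simp: O3_def)
        moreover have "ball x r \<inter> O3 = {}"
          using r(4)[OF x(1)] x(1) ball_subset_cball by (fastforce simp: O3_def O1_def)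
        moreover have "\<sigma> ` {a..b} \<subseteq> ball x r \<union> O3" using cover by (auto simp: O3_def O2_def)
        ultimately have "\<sigma> ` {a..b} \<subseteq> ball x r"
          using connectedD[OF conn open_ball, of O3 x r] x ends(1) by blast
        then have "dist x (\<sigma> b) < r" "dist x (\<sigma> a) < r" using ends by auto
        then have "dist (\<sigma> b) (\<sigma> a) < r + r" using dist_triangle3[of "\<sigma> b" "\<sigma> a" x] by linarith
        then show False using far r(2) by (simp add: dist_norm)
      qed
    qed
  qed
qed

theorem theorem1p2:
  fixes D A :: "(complex^'n) set"
  assumes "CARD('n) \<ge> 2"
    and "is_domain D" and "bounded D"
    and "C2_boundary D" and "strongly_levi_pseudoconvex D"
    and "A \<subseteq> D" and "finite A" and "A \<noteq> {}"
  shows "visibility_domain (D - A) \<and> \<not> pseudoconvex (D - A) \<and> \<not> kobayashi_complete (D - A)"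
proof (intro conjI)
  have D: "open D" "connected D" using \<open>is_domain D\<close> by (auto simp: is_domain_def)
  have \<Omega>: "open (D - A)" "connected (D - A)" "bounded (D - A)"
  proof -
    show "open (D - A)" using D \<open>finite A\<close> by (simp add: finite_imp_closed open_Diff)
    show "connected (D - A)"
      using D \<open>finite A\<close> \<open>CARD('n) \<ge> 2\<close> by (intro connected_open_delete_finite) auto
    show "bounded (D - A)" using \<open>bounded D\<close> by (rule bounded_subset) auto
  qed
  obtain a where a: "a \<in> A" using \<open>A \<noteq> {}\<close> by blast
  obtain r where r: "0 < r" "cball a r - {a} \<subseteq> D - A"
  proof -
    have "open (D - (A - {a}))" using D \<open>finite A\<close> by (simp add: finite_imp_closed open_Diff)
    moreover have "a \<in> D - (A - {a})" using a \<open>A \<subseteq> D\<close> by blast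
    ultimately obtain r where "0 < r" "cball a r \<subseteq> D - (A - {a})" using open_contains_cball by blast
    then show thesis using that[of r] by blast
  qed
  have "a \<in> cball a r" using r by simp
  \<comment> \<open>A non-empty open set is infinite, so it cannot coincide with
    \<open>A\<close>.\<close>
  have "D - A \<noteq> {}"
  proof
    assume "D - A = {}"
    then have "D = A" using \<open>A \<subseteq> D\<close> by blast
    then show False using D(1) \<open>finite A\<close> \<open>A \<noteq> {}\<close> not_open_singleton finite_imp_not_open by blast
  qed
  then have "is_domain (D - A)" using \<Omega> by (simp add: is_domain_def)
  then show "visibility_domain (D - A)"
    using assms by (intro visibility_domain_strongly_pseudoconvex_minus_finite)
  have "\<not> (\<forall>i j :: 'n. i = j)"
  proof
    assume "\<forall>i j :: 'n. i = j"
    then have "(UNIV :: 'n set) = {undefined}" by auto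
    then have "CARD('n) = card {undefined :: 'n}" by (rule arg_cong)
    then show False using \<open>CARD('n) \<ge> 2\<close> by simp
  qed
  then obtain i j :: 'n where "i \<noteq> j" by blast
  show "\<not> pseudoconvex (D - A)"
    using not_pseudoconvex_if_isolated_boundary_point[OF \<open>i \<noteq> j\<close> r] a by blast
  show "\<not> kobayashi_complete (D - A)"
    using not_kobayashi_complete_if_isolated_boundary_point[OF \<Omega> \<open>i \<noteq> j\<close> r] a by blast
qed

end
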